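(* Let $(\mathsf{S},\mu,\eta,\partial)$ be a coCartesian differential monad on a semi-additive category $\mathbb{X}$, and let $\mathsf{ALG}_{\mathsf{S}}$ be its category of algebras. Define: (i) the functor $\mathsf{T}:\mathsf{ALG}_{\mathsf{S}}\to\mathsf{ALG}_{\mathsf{S}}$, on objects by $\mathsf{T}(A,\alpha)=\big(A\times A,\langle\alpha\circ\mathsf{S}(\pi_1),\ \alpha\circ\mathsf{S}(\pi_1+\pi_4)\circ\partial_{A\times A}\rangle\big)$ and on maps by $\mathsf{T}(f)=f\times f$; (ii) $p_{(A,\alpha)}:=\pi_1:\mathsf{T}(A,\alpha)\to(A,\alpha)$, whose $n$-fold pullback is $$\mathsf{T}_n(A,\alpha)=\Big(\prod_{i=1}^{n+1}A,\ \big\langle\alpha\circ\mathsf{S}(\pi_1),\ \alpha\circ\mathsf{S}(\pi_1+\pi_4)\circ\partial_{A\times A}\circ\mathsf{S}(\langle\pi_1,\pi_2\rangle),\dots,\alpha\circ\mathsf{S}(\pi_1+\pi_4)\circ\partial_{A\times A}\circ\mathsf{S}(\langle\pi_1,\pi_{n+1}\rangle)\big\rangle\Big)$$ with pullback projections $q_j=\langle\pi_1,\pi_{j+1}\rangle:\mathsf{T}_n(A,\alpha)\to\mathsf{T}(A,\alpha)$; (iii) $s_{(A,\alpha)}:=\langle\pi_1,\pi_2+\pi_3\rangle:\mathsf{T}_2(A,\alpha)\to\mathsf{T}(A,\alpha)$; (iv) $z_{(A,\alpha)}:=\langle1_A,0\rangle:(A,\alpha)\to\mathsf{T}(A,\alpha)$;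 (v) $l_{(A,\alpha)}:=\langle\pi_1,0,0,\pi_2\rangle:\mathsf{T}(A,\alpha)\to\mathsf{T}^2(A,\alpha)$; (vi) $c_{(A,\alpha)}:=\langle\pi_1,\pi_3,\pi_2,\pi_4\rangle:\mathsf{T}^2(A,\alpha)\to\mathsf{T}^2(A,\alpha)$. Then $\mathbb{T}=(\mathsf{T},p,s,z,l,c)$ is a tangent structure on $\mathsf{ALG}_{\mathsf{S}}$, and $(\mathsf{ALG}_{\mathsf{S}},\mathbb{T})$ is a Cartesian tangent category. If $\mathbb{X}$ is moreover an additive category, define (vii) $n_{(A,\alpha)}:=\langle\pi_1,-\pi_2\rangle:\mathsf{T}(A,\alpha)\to\mathsf{T}(A,\alpha)$. Then $\mathbb{T}=(\mathsf{T},p,s,z,l,c,n)$ is a Rosický tangent structure on $\mathsf{ALG}_{\mathsf{S}}$, and $(\mathsf{ALG}_{\mathsf{S}},\mathbb{T})$ is a Cartesian Rosický tangent category.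
   Context: **Monads.** A semi-additive category is a category with finite biproducts (written $\times$ with projections $\pi_j$ and pairing $\langle-,\dots,-\rangle$), hence enriched in commutative monoids; an additive category is one whose homsets are moreover abelian groups. For $n$ copies of $A$, $\pi_j$ is the $j$-th projection; e.g. $\pi_1+\pi_4:A\times A\times A\times A\to A$. For a monad $(\mathsf{S},\mu,\eta)$, $\mathsf{ALG}_{\mathsf{S}}$ is its Eilenberg–Moore category: objects $(A,\alpha:\mathsf{S}(A)\to A)$ with $\alpha\eta_A=1_A$, $\alpha\mu_A=\alpha\mathsf{S}(\alpha)$. A coCartesian differential monad on a semi-additive category $\mathbb{X}$ is a monad $(\mathsf{S},\mu,\eta)$ with a differential combinator transformation, i.e. a natural transformation $\partial_A:\mathsf{S}(A)\to\mathsf{S}(A\times A)$ such that: [DC.1] $\mathsf{S}(\pi_1)\circ\partial_A=0$; [DC.2] $\mathsf{S}(\langle\pi_1,\pi_2,\pi_2\rangle)\circ\partial_A=\mathsf{S}(\langle\pi_1,\pi_2,0\rangle)\circ\partial_A+\mathsf{S}(\langle\pi_1,0,\pi_2\rangle)\circ\partial_A$; [DC.3] $\partial_A\circ\eta_A=\eta_{A\times A}\circ\langle0,1_A\rangle$; [DC.4] $\partial_A\circ\mu_A=\mu_{A\times A}\circ\mathsf{S}\big(\mathsf{S}(\langle1_A,0\rangle)\circ\pi_1+\partial_A\circ\pi_2\big)\circ\partial_{\mathsf{S}(A)}$; [DC.5] $\mathsf{S}(\langle\pi_1,\pi_4\rangle)\circ\partial_{A\times A}\circ\partial_A=\partial_A$;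 [DC.6] $\mathsf{S}(\langle\pi_1,\pi_3,\pi_2,\pi_4\rangle)\circ\partial_{A\times A}\circ\partial_A=\partial_{A\times A}\circ\partial_A$. **Tangent structures.** A tangent structure on a category consists of an endofunctor $\mathsf{T}$; a natural transformation $p_A:\mathsf{T}(A)\to A$ such that all $n$-fold pullbacks $\mathsf{T}_n(A)$ of $p_A$ (with projections $q_j:\mathsf{T}_n(A)\to\mathsf{T}(A)$) exist and are preserved by every power $\mathsf{T}^m$; and natural transformations $s_A:\mathsf{T}_2(A)\to\mathsf{T}(A)$, $z_A:A\to\mathsf{T}(A)$, $l_A:\mathsf{T}(A)\to\mathsf{T}^2(A)$, $c_A:\mathsf{T}^2(A)\to\mathsf{T}^2(A)$ such that: (1) $(p_A,s_A,z_A)$ makes $\mathsf{T}(A)$ a commutative monoid object in the slice category over $A$; (2) $\mathsf{T}(p_A) l_A=z_A p_A$, $l_A s_A=\mathsf{T}(s_A)\langle l_Aq_1,l_Aq_2\rangle$, $l_Az_A=\mathsf{T}(z_A)z_A$; (3) $p_{\mathsf{T}(A)}c_A=\mathsf{T}(p_A)$, $c_A\mathsf{T}(s_A)=s_{\mathsf{T}(A)}\langle c_A\mathsf{T}(q_1),c_A\mathsf{T}(q_2)\rangle$, $c_A\mathsf{T}(z_A)=z_{\mathsf{T}(A)}$; (4) $c_Ac_A=1$, $c_Al_A=l_A$, $\mathsf{T}(l_A)l_A=l_{\mathsf{T}(A)}l_A$, $\mathsf{T}(c_A)c_{\mathsf{T}(A)}\mathsf{T}(c_A)=c_{\mathsf{T}(A)}\mathsf{T}(c_A)c_{\mathsf{T}(A)}$,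 $c_{\mathsf{T}(A)}\mathsf{T}(c_A)l_{\mathsf{T}(A)}=\mathsf{T}(l_A)c_A$; (5) (universality of the lift) $\mathsf{T}(s_A)\langle l_Aq_1,z_{\mathsf{T}(A)}q_2\rangle:\mathsf{T}_2(A)\to\mathsf{T}^2(A)$ is an equalizer of $\mathsf{T}(p_A)$ and $z_Ap_Ap_{\mathsf{T}(A)}:\mathsf{T}^2(A)\to\mathsf{T}(A)$. It is a Rosický tangent structure if moreover there is a natural $n_A:\mathsf{T}(A)\to\mathsf{T}(A)$ with $p_An_A=p_A$ and $s_A\langle 1,n_A\rangle=z_Ap_A$. A (Rosický) tangent category is Cartesian if it has finite products and $\mathsf{T}$ preserves them. *)

theory Defs
  imports Main
begin

section \<open>Categories\<close>

record ('o, 'm) category =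
  Obj :: "'o set"
  Arr :: "'m set"
  Dom :: "'m \<Rightarrow> 'o"
  Cod :: "'m \<Rightarrow> 'o"
  Ide :: "'o \<Rightarrow> 'm"
  Comp :: "'m \<Rightarrow> 'm \<Rightarrow> 'm"  (infixl "\<cdot>\<index>" 70)

definition hom :: "('o, 'm, 'z) category_scheme \<Rightarrow> 'o \<Rightarrow> 'o \<Rightarrow> 'm set" where
  "hom C A B = {f \<in> Arr C. Dom C f = A \<and> Cod C f = B}"

locale category =
  fixes C :: "('o, 'm, 'z) category_scheme" (structure)
  assumes dom_obj: "f \<in> Arr C \<Longrightarrow> Dom C f \<in> Obj C"
    and cod_obj: "f \<in> Arr C \<Longrightarrow> Cod C f \<in> Obj C"
    and ide_hom: "A \<in> Obj C \<Longrightarrow> Ide C A \<in> hom C A A"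
    and comp_hom: "f \<in> hom C A B \<Longrightarrow> g \<in> hom C B E \<Longrightarrow> g \<cdot> f \<in> hom C A E"
    and comp_ide_left: "f \<in> hom C A B \<Longrightarrow> Ide C B \<cdot> f = f"
    and comp_ide_right: "f \<in> hom C A B \<Longrightarrow> f \<cdot> Ide C A = f"
    and comp_assoc: "f \<in> hom C A B \<Longrightarrow> g \<in> hom C B E \<Longrightarrow> h \<in> hom C E F
      \<Longrightarrow> (h \<cdot> g) \<cdot> f = h \<cdot> (g \<cdot> f)"

record ('o, 'm) endofunctor =
  FObj :: "'o \<Rightarrow> 'o"
  FMap :: "'m \<Rightarrow> 'm"

locale endofunctor = category C for C :: "('o, 'm, 'z) category_scheme" (structure) +
  fixes F :: "('o, 'm) endofunctor"
  assumes fobj: "A \<in> Obj C \<Longrightarrow> FObj F A \<in> Obj C"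
    and fmap: "f \<in> hom C A B \<Longrightarrow> FMap F f \<in> hom C (FObj F A) (FObj F B)"
    and fmap_ide: "A \<in> Obj C \<Longrightarrow> FMap F (Ide C A) = Ide C (FObj F A)"
    and fmap_comp: "f \<in> hom C A B \<Longrightarrow> g \<in> hom C B E \<Longrightarrow>
      FMap F (g \<cdot> f) = FMap F g \<cdot> FMap F f"

definition id_functor :: "('o, 'm) endofunctor" where
  "id_functor = \<lparr> FObj = (\<lambda>A. A), FMap = (\<lambda>f. f) \<rparr>"

definition comp_functor ::
  "('o, 'm) endofunctor \<Rightarrow> ('o, 'm) endofunctor \<Rightarrow> ('o, 'm) endofunctor" where
  "comp_functor F G = \<lparr> FObj = (\<lambda>A. FObj F (FObj G A)), FMap = (\<lambda>f. FMap F (FMap G f)) \<rparr>"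

definition natural :: "('o, 'm, 'z) category_scheme \<Rightarrow> ('o, 'm) endofunctor \<Rightarrow>
    ('o, 'm) endofunctor \<Rightarrow> ('o \<Rightarrow> 'm) \<Rightarrow> bool" where
  "natural C F G \<tau> \<longleftrightarrow>
     (\<forall>A \<in> Obj C. \<tau> A \<in> hom C (FObj F A) (FObj G A)) \<and>
     (\<forall>A \<in> Obj C. \<forall>B \<in> Obj C. \<forall>f \<in> hom C A B.
        \<tau> B \<cdot>\<^bsub>C\<^esub> FMap F f = FMap G f \<cdot>\<^bsub>C\<^esub> \<tau> A)"

subsection \<open>Limits and colimits\<close>

definition is_product :: "('o, 'm, 'z) category_scheme \<Rightarrow> 'o list \<Rightarrow> 'o \<Rightarrow> (nat \<Rightarrow> 'm) \<Rightarrow> bool" where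
  "is_product C As P pr \<longleftrightarrow>
     P \<in> Obj C \<and> (\<forall>i < length As. pr i \<in> hom C P (As ! i)) \<and>
     (\<forall>B \<in> Obj C. \<forall>f. (\<forall>i < length As. f i \<in> hom C B (As ! i)) \<longrightarrow>
        (\<exists>!u. u \<in> hom C B P \<and> (\<forall>i < length As. pr i \<cdot>\<^bsub>C\<^esub> u = f i)))"

definition is_coproduct :: "('o, 'm, 'z) category_scheme \<Rightarrow> 'o list \<Rightarrow> 'o \<Rightarrow> (nat \<Rightarrow> 'm) \<Rightarrow> bool" where
  "is_coproduct C As P ic \<longleftrightarrow>
     P \<in> Obj C \<and> (\<forall>i < length As. ic i \<in> hom C (As ! i) P) \<and>
     (\<forall>B \<in> Obj C. \<forall>f. (\<forall>i < length As. f i \<in> hom C (As ! i) B) \<longrightarrow>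
        (\<exists>!u. u \<in> hom C P B \<and> (\<forall>i < length As. u \<cdot>\<^bsub>C\<^esub> ic i = f i)))"

definition has_finite_products :: "('o, 'm, 'z) category_scheme \<Rightarrow> bool" where
  "has_finite_products C \<longleftrightarrow> (\<forall>As. set As \<subseteq> Obj C \<longrightarrow> (\<exists>P pr. is_product C As P pr))"

definition preserves_finite_products ::
  "('o, 'm, 'z) category_scheme \<Rightarrow> ('o, 'm) endofunctor \<Rightarrow> bool" where
  "preserves_finite_products C F \<longleftrightarrow>
     (\<forall>As P pr. set As \<subseteq> Obj C \<longrightarrow> is_product C As P pr \<longrightarrow>
        is_product C (map (FObj F) As) (FObj F P) (\<lambda>i. FMap F (pr i)))"

text \<open>The \<open>n\<close>-fold pullback of \<open>p : E \<rightarrow> A\<close>, with projections \<open>q 0, \<dots>, q (n - 1)\<close>. For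
  \<open>n \<ge> 1\<close> the leg \<open>b\<close> to the base and the map \<open>g\<close> are determined by the other legs; they are
  mentioned so that for \<open>n = 0\<close> the object \<open>P\<close> is a copy of \<open>A\<close> (not a terminal object).\<close>

definition is_fold_pullback :: "('o, 'm, 'z) category_scheme \<Rightarrow> 'o \<Rightarrow> 'o \<Rightarrow> 'm \<Rightarrow> nat \<Rightarrow> 'o \<Rightarrow>
    (nat \<Rightarrow> 'm) \<Rightarrow> bool" where
  "is_fold_pullback C E A p n P q \<longleftrightarrow>
     p \<in> hom C E A \<and> P \<in> Obj C \<and>
     (\<exists>b \<in> hom C P A.
        (\<forall>j < n. q j \<in> hom C P E \<and> p \<cdot>\<^bsub>C\<^esub> q j = b) \<and>
        (\<forall>B \<in> Obj C. \<forall>g \<in> hom C B A. \<forall>f.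
           (\<forall>j < n. f j \<in> hom C B E \<and> p \<cdot>\<^bsub>C\<^esub> f j = g) \<longrightarrow>
           (\<exists>!u. u \<in> hom C B P \<and> b \<cdot>\<^bsub>C\<^esub> u = g \<and> (\<forall>j < n. q j \<cdot>\<^bsub>C\<^esub> u = f j))))"

definition is_equalizer :: "('o, 'm, 'z) category_scheme \<Rightarrow> 'o \<Rightarrow> 'o \<Rightarrow> 'o \<Rightarrow> 'm \<Rightarrow> 'm \<Rightarrow> 'm \<Rightarrow> bool" where
  "is_equalizer C E A B e f g \<longleftrightarrow>
     e \<in> hom C E A \<and> f \<in> hom C A B \<and> g \<in> hom C A B \<and> f \<cdot>\<^bsub>C\<^esub> e = g \<cdot>\<^bsub>C\<^esub> e \<and>
     (\<forall>D \<in> Obj C. \<forall>h \<in> hom C D A. f \<cdot>\<^bsub>C\<^esub> h = g \<cdot>\<^bsub>C\<^esub> h \<longrightarrow>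
        (\<exists>!u. u \<in> hom C D E \<and> e \<cdot>\<^bsub>C\<^esub> u = h))"


section \<open>Semi-additive and additive categories\<close>

text \<open>Finite biproducts are chosen, one for every finite list of objects; \<open>Pr X As i\<close> is the
  projection \<open>\<pi>\<^sub>i\<^sub>+\<^sub>1\<close>, as positions in lists start at 0. The empty biproduct is the zero object.\<close>

record ('o, 'm) biproduct_category = "('o, 'm) category" +
  Bip :: "'o list \<Rightarrow> 'o"
  Pr :: "'o list \<Rightarrow> nat \<Rightarrow> 'm"
  Inj :: "'o list \<Rightarrow> nat \<Rightarrow> 'm"

definition zero_map :: "('o, 'm, 'z) biproduct_category_scheme \<Rightarrow> 'o \<Rightarrow> 'o \<Rightarrow> 'm" where
  "zero_map X A B =
     (THE v. v \<in> hom X (Bip X []) B) \<cdot>\<^bsub>X\<^esub> (THE u. u \<in> hom X A (Bip X []))"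

locale semi_additive_category = category X
  for X :: "('o, 'm, 'z) biproduct_category_scheme" (structure) +
  assumes bip_product: "set As \<subseteq> Obj X \<Longrightarrow> is_product X As (Bip X As) (Pr X As)"
    and bip_coproduct: "set As \<subseteq> Obj X \<Longrightarrow> is_coproduct X As (Bip X As) (Inj X As)"
    and pr_inj: "set As \<subseteq> Obj X \<Longrightarrow> i < length As \<Longrightarrow> j < length As \<Longrightarrow>
      Pr X As i \<cdot> Inj X As j = (if i = j then Ide X (As ! i) else zero_map X (As ! j) (As ! i))"

text \<open>The pairing \<open>\<langle>f\<^sub>1, \<dots>, f\<^sub>n\<rangle>\<close> of a nonempty list of maps with common domain.\<close>

definition tup :: "('o, 'm, 'z) biproduct_category_scheme \<Rightarrow> 'm list \<Rightarrow> 'm" where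
  "tup X fs = (THE u. u \<in> hom X (Dom X (hd fs)) (Bip X (map (Cod X) fs)) \<and>
     (\<forall>i < length fs. Pr X (map (Cod X) fs) i \<cdot>\<^bsub>X\<^esub> u = fs ! i))"

definition codiag :: "('o, 'm, 'z) biproduct_category_scheme \<Rightarrow> 'o \<Rightarrow> 'm" where
  "codiag X B = (THE u. u \<in> hom X (Bip X [B, B]) B \<and>
     (\<forall>i < 2. u \<cdot>\<^bsub>X\<^esub> Inj X [B, B] i = Ide X B))"

text \<open>The addition of parallel maps that comes with the biproducts.\<close>

definition plus_map :: "('o, 'm, 'z) biproduct_category_scheme \<Rightarrow> 'm \<Rightarrow> 'm \<Rightarrow> 'm"
    (infixl "\<oplus>\<index>" 65) where
  "f \<oplus>\<^bsub>X\<^esub> g = codiag X (Cod X f) \<cdot>\<^bsub>X\<^esub> tup X [f, g]"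

locale additive_category = semi_additive_category X
  for X :: "('o, 'm, 'z) biproduct_category_scheme" (structure) +
  assumes has_negatives: "f \<in> hom X A B \<Longrightarrow> \<exists>g \<in> hom X A B. f \<oplus> g = zero_map X A B"

definition neg_map :: "('o, 'm, 'z) biproduct_category_scheme \<Rightarrow> 'm \<Rightarrow> 'm" where
  "neg_map X f = (THE g. g \<in> hom X (Dom X f) (Cod X f) \<and>
     f \<oplus>\<^bsub>X\<^esub> g = zero_map X (Dom X f) (Cod X f))"

text \<open>The functor \<open>A \<mapsto> A \<times> A\<close>, \<open>f \<mapsto> f \<times> f\<close>. The fourfold product \<open>A \<times> A \<times> A \<times> A\<close> is taken
  to be \<open>(A \<times> A) \<times> (A \<times> A)\<close>, with projections \<open>pr4\<close> (again counted from 0) and pairing \<open>tup4\<close>.\<close>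

definition square :: "('o, 'm, 'z) biproduct_category_scheme \<Rightarrow> ('o, 'm) endofunctor" where
  "square X = \<lparr> FObj = (\<lambda>A. Bip X [A, A]),
     FMap = (\<lambda>f. tup X [f \<cdot>\<^bsub>X\<^esub> Pr X [Dom X f, Dom X f] 0, f \<cdot>\<^bsub>X\<^esub> Pr X [Dom X f, Dom X f] 1]) \<rparr>"

definition pr4 :: "('o, 'm, 'z) biproduct_category_scheme \<Rightarrow> 'o \<Rightarrow> nat \<Rightarrow> 'm" where
  "pr4 X A i = Pr X [A, A] (i mod 2) \<cdot>\<^bsub>X\<^esub> Pr X [Bip X [A, A], Bip X [A, A]] (i div 2)"

definition tup4 :: "('o, 'm, 'z) biproduct_category_scheme \<Rightarrow> 'm \<Rightarrow> 'm \<Rightarrow> 'm \<Rightarrow> 'm \<Rightarrow> 'm" where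
  "tup4 X f0 f1 f2 f3 = tup X [tup X [f0, f1], tup X [f2, f3]]"


section \<open>Monads, their algebras, and coCartesian differential monads\<close>

locale monad = endofunctor X S
  for X :: "('o, 'm, 'z) category_scheme" (structure) and S :: "('o, 'm) endofunctor" +
  fixes \<mu> \<eta> :: "'o \<Rightarrow> 'm"
  assumes mu_natural: "natural X (comp_functor S S) S \<mu>"
    and eta_natural: "natural X id_functor S \<eta>"
    and mu_assoc: "A \<in> Obj X \<Longrightarrow> \<mu> A \<cdot> FMap S (\<mu> A) = \<mu> A \<cdot> \<mu> (FObj S A)"
    and mu_eta: "A \<in> Obj X \<Longrightarrow> \<mu> A \<cdot> \<eta> (FObj S A) = Ide X (FObj S A)"
    and mu_S_eta: "A \<in> Obj X \<Longrightarrow> \<mu> A \<cdot> FMap S (\<eta> A) = Ide X (FObj S A)"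

definition algebras :: "('o, 'm, 'z) category_scheme \<Rightarrow> ('o, 'm) endofunctor \<Rightarrow>
    ('o \<Rightarrow> 'm) \<Rightarrow> ('o \<Rightarrow> 'm) \<Rightarrow> ('o \<times> 'm) set" where
  "algebras X S \<mu> \<eta> = {(A, \<alpha>). A \<in> Obj X \<and> \<alpha> \<in> hom X (FObj S A) A \<and>
     \<alpha> \<cdot>\<^bsub>X\<^esub> \<eta> A = Ide X A \<and> \<alpha> \<cdot>\<^bsub>X\<^esub> \<mu> A = \<alpha> \<cdot>\<^bsub>X\<^esub> FMap S \<alpha>}"

text \<open>A map of algebras is a triple of its domain, its codomain and the underlying map.\<close>

type_synonym ('o, 'm) alg_map = "('o \<times> 'm) \<times> ('o \<times> 'm) \<times> 'm"

definition ALG :: "('o, 'm, 'z) category_scheme \<Rightarrow> ('o, 'm) endofunctor \<Rightarrow>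
    ('o \<Rightarrow> 'm) \<Rightarrow> ('o \<Rightarrow> 'm) \<Rightarrow> ('o \<times> 'm, ('o, 'm) alg_map) category" where
  "ALG X S \<mu> \<eta> =
    \<lparr> Obj = algebras X S \<mu> \<eta>,
      Arr = {((A, \<alpha>), (B, \<beta>), f) | A \<alpha> B \<beta> f.
        (A, \<alpha>) \<in> algebras X S \<mu> \<eta> \<and> (B, \<beta>) \<in> algebras X S \<mu> \<eta> \<and>
        f \<in> hom X A B \<and> f \<cdot>\<^bsub>X\<^esub> \<alpha> = \<beta> \<cdot>\<^bsub>X\<^esub> FMap S f},
      Dom = (\<lambda>(P, Q, f). P),
      Cod = (\<lambda>(P, Q, f). Q),
      Ide = (\<lambda>(A, \<alpha>). ((A, \<alpha>), (A, \<alpha>), Ide X A)),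
      Comp = (\<lambda>(Q, R, g) (P, Q', f). (P, R, g \<cdot>\<^bsub>X\<^esub> f)) \<rparr>"

text \<open>\<open>\<delta>\<close> is the differential combinator transformation \<open>\<partial>\<close>.\<close>

locale cocartesian_differential_monad = semi_additive_category X + monad X S \<mu> \<eta>
  for X :: "('o, 'm, 'z) biproduct_category_scheme" (structure)
    and S :: "('o, 'm) endofunctor" and \<mu> \<eta> :: "'o \<Rightarrow> 'm" +
  fixes \<delta> :: "'o \<Rightarrow> 'm"
  assumes delta_natural: "natural X S (comp_functor S (square X)) \<delta>"
    and DC1: "A \<in> Obj X \<Longrightarrow>
      FMap S (Pr X [A, A] 0) \<cdot> \<delta> A = zero_map X (FObj S A) (FObj S A)"
    and DC2: "A \<in> Obj X \<Longrightarrow>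
      FMap S (tup X [Pr X [A, A] 0, Pr X [A, A] 1, Pr X [A, A] 1]) \<cdot> \<delta> A
      = FMap S (tup X [Pr X [A, A] 0, Pr X [A, A] 1, zero_map X (Bip X [A, A]) A]) \<cdot> \<delta> A
        \<oplus> FMap S (tup X [Pr X [A, A] 0, zero_map X (Bip X [A, A]) A, Pr X [A, A] 1]) \<cdot> \<delta> A"
    and DC3: "A \<in> Obj X \<Longrightarrow>
      \<delta> A \<cdot> \<eta> A = \<eta> (Bip X [A, A]) \<cdot> tup X [zero_map X A A, Ide X A]"
    and DC4: "A \<in> Obj X \<Longrightarrow>
      \<delta> A \<cdot> \<mu> A
      = \<mu> (Bip X [A, A])
        \<cdot> FMap S (FMap S (tup X [Ide X A, zero_map X A A]) \<cdot> Pr X [FObj S A, FObj S A] 0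
                  \<oplus> \<delta> A \<cdot> Pr X [FObj S A, FObj S A] 1)
        \<cdot> \<delta> (FObj S A)"
    and DC5: "A \<in> Obj X \<Longrightarrow>
      FMap S (tup X [pr4 X A 0, pr4 X A 3]) \<cdot> \<delta> (Bip X [A, A]) \<cdot> \<delta> A = \<delta> A"
    and DC6: "A \<in> Obj X \<Longrightarrow>
      FMap S (tup4 X (pr4 X A 0) (pr4 X A 2) (pr4 X A 1) (pr4 X A 3)) \<cdot> \<delta> (Bip X [A, A]) \<cdot> \<delta> A
      = \<delta> (Bip X [A, A]) \<cdot> \<delta> A"


section \<open>Tangent structures\<close>

text \<open>The chosen \<open>n\<close>-fold pullbacks \<open>T\<^sub>n(A) = Tn n A\<close> of \<open>p\<^sub>A\<close> and their projections
  \<open>q\<^sub>j\<^sub>+\<^sub>1 = q n A j\<close>, \<open>j < n\<close>, are part of the data, as \<open>s\<^sub>A\<close> has domain \<open>T\<^sub>2(A)\<close>.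

  \<open>tan_pair C T Tn q m A f g\<close> is the pairing \<open>\<langle>f, g\<rangle>\<close> of two maps into \<open>T\<^sup>m(T(A))\<close> that agree
  after \<open>T\<^sup>m(p\<^sub>A)\<close>; it is a map into \<open>T\<^sup>m(T\<^sub>2(A))\<close>, a pullback with projections \<open>T\<^sup>m(q\<^sub>j)\<close>.\<close>

definition tan_pair :: "('o, 'm, 'z) category_scheme \<Rightarrow> ('o, 'm) endofunctor \<Rightarrow>
    (nat \<Rightarrow> 'o \<Rightarrow> 'o) \<Rightarrow> (nat \<Rightarrow> 'o \<Rightarrow> nat \<Rightarrow> 'm) \<Rightarrow> nat \<Rightarrow> 'o \<Rightarrow> 'm \<Rightarrow> 'm \<Rightarrow> 'm" where
  "tan_pair C T Tn q m A f g =
     (THE u. u \<in> hom C (Dom C f) ((FObj T ^^ m) (Tn 2 A)) \<and>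
        (FMap T ^^ m) (q 2 A 0) \<cdot>\<^bsub>C\<^esub> u = f \<and> (FMap T ^^ m) (q 2 A 1) \<cdot>\<^bsub>C\<^esub> u = g)"

definition T2_functor :: "('o, 'm, 'z) category_scheme \<Rightarrow> ('o, 'm) endofunctor \<Rightarrow>
    (nat \<Rightarrow> 'o \<Rightarrow> 'o) \<Rightarrow> (nat \<Rightarrow> 'o \<Rightarrow> nat \<Rightarrow> 'm) \<Rightarrow> ('o, 'm) endofunctor" where
  "T2_functor C T Tn q = \<lparr> FObj = Tn 2,
     FMap = (\<lambda>f. tan_pair C T Tn q 0 (Cod C f)
       (FMap T f \<cdot>\<^bsub>C\<^esub> q 2 (Dom C f) 0) (FMap T f \<cdot>\<^bsub>C\<^esub> q 2 (Dom C f) 1)) \<rparr>"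

text \<open>Commutative monoid object \<open>(p : E \<rightarrow> A, s, z)\<close> in the slice over \<open>A\<close>: \<open>q0, q1\<close> and
  \<open>r0, r1, r2\<close> are the projections of the binary and ternary powers of \<open>p\<close> in the slice (the
  twofold and threefold pullbacks), \<open>pair\<close> is the pairing into the binary power, and the terminal
  object is \<open>1\<^sub>A\<close>. The first three conditions say that \<open>s\<close> and \<open>z\<close> are maps over \<open>A\<close>.\<close>

definition commutative_monoid_over :: "('o, 'm, 'z) category_scheme \<Rightarrow> 'o \<Rightarrow> 'o \<Rightarrow> 'm \<Rightarrow>
    ('m \<Rightarrow> 'm \<Rightarrow> 'm) \<Rightarrow> 'm \<Rightarrow> 'm \<Rightarrow> 'm \<Rightarrow> 'm \<Rightarrow> 'm \<Rightarrow> 'm \<Rightarrow> 'm \<Rightarrow> bool" where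
  "commutative_monoid_over C A E p pair q0 q1 r0 r1 r2 s z \<longleftrightarrow>
     p \<cdot>\<^bsub>C\<^esub> s = p \<cdot>\<^bsub>C\<^esub> q0 \<and>
     p \<cdot>\<^bsub>C\<^esub> s = p \<cdot>\<^bsub>C\<^esub> q1 \<and>
     p \<cdot>\<^bsub>C\<^esub> z = Ide C A \<and>
     s \<cdot>\<^bsub>C\<^esub> pair (s \<cdot>\<^bsub>C\<^esub> pair r0 r1) r2 = s \<cdot>\<^bsub>C\<^esub> pair r0 (s \<cdot>\<^bsub>C\<^esub> pair r1 r2) \<and>
     s \<cdot>\<^bsub>C\<^esub> pair (Ide C E) (z \<cdot>\<^bsub>C\<^esub> p) = Ide C E \<and>
     s \<cdot>\<^bsub>C\<^esub> pair (z \<cdot>\<^bsub>C\<^esub> p) (Ide C E) = Ide C E \<and>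
     s \<cdot>\<^bsub>C\<^esub> pair q1 q0 = s"

locale tangent_structure = endofunctor C T
  for C :: "('o, 'm, 'z) category_scheme" (structure) and T :: "('o, 'm) endofunctor" +
  fixes p :: "'o \<Rightarrow> 'm"
    and Tn :: "nat \<Rightarrow> 'o \<Rightarrow> 'o" and q :: "nat \<Rightarrow> 'o \<Rightarrow> nat \<Rightarrow> 'm"
    and s z l c :: "'o \<Rightarrow> 'm"
  assumes p_natural: "natural C T id_functor p"
    and fold_pullback: "A \<in> Obj C \<Longrightarrow> is_fold_pullback C (FObj T A) A (p A) n (Tn n A) (q n A)"
    and fold_pullback_preserved: "A \<in> Obj C \<Longrightarrow>
      is_fold_pullback C ((FObj T ^^ m) (FObj T A)) ((FObj T ^^ m) A) ((FMap T ^^ m) (p A)) n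
        ((FObj T ^^ m) (Tn n A)) (\<lambda>j. (FMap T ^^ m) (q n A j))"
    and s_natural: "natural C (T2_functor C T Tn q) T s"
    and z_natural: "natural C id_functor T z"
    and l_natural: "natural C T (comp_functor T T) l"
    and c_natural: "natural C (comp_functor T T) (comp_functor T T) c"
    and monoid: "A \<in> Obj C \<Longrightarrow>
      commutative_monoid_over C A (FObj T A) (p A) (tan_pair C T Tn q 0 A)
        (q 2 A 0) (q 2 A 1) (q 3 A 0) (q 3 A 1) (q 3 A 2) (s A) (z A)"
    and l_p: "A \<in> Obj C \<Longrightarrow> FMap T (p A) \<cdot> l A = z A \<cdot> p A"
    and l_s: "A \<in> Obj C \<Longrightarrow>
      l A \<cdot> s A = FMap T (s A) \<cdot> tan_pair C T Tn q 1 A (l A \<cdot> q 2 A 0) (l A \<cdot> q 2 A 1)"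
    and l_z: "A \<in> Obj C \<Longrightarrow> l A \<cdot> z A = FMap T (z A) \<cdot> z A"
    and c_p: "A \<in> Obj C \<Longrightarrow> p (FObj T A) \<cdot> c A = FMap T (p A)"
    and c_s: "A \<in> Obj C \<Longrightarrow>
      c A \<cdot> FMap T (s A) = s (FObj T A) \<cdot>
        tan_pair C T Tn q 0 (FObj T A) (c A \<cdot> FMap T (q 2 A 0)) (c A \<cdot> FMap T (q 2 A 1))"
    and c_z: "A \<in> Obj C \<Longrightarrow> c A \<cdot> FMap T (z A) = z (FObj T A)"
    and c_c: "A \<in> Obj C \<Longrightarrow> c A \<cdot> c A = Ide C (FObj T (FObj T A))"
    and c_l: "A \<in> Obj C \<Longrightarrow> c A \<cdot> l A = l A"
    and l_l: "A \<in> Obj C \<Longrightarrow> FMap T (l A) \<cdot> l A = l (FObj T A) \<cdot> l A"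
    and c_c_c: "A \<in> Obj C \<Longrightarrow>
      FMap T (c A) \<cdot> c (FObj T A) \<cdot> FMap T (c A) = c (FObj T A) \<cdot> FMap T (c A) \<cdot> c (FObj T A)"
    and c_c_l: "A \<in> Obj C \<Longrightarrow>
      c (FObj T A) \<cdot> FMap T (c A) \<cdot> l (FObj T A) = FMap T (l A) \<cdot> c A"
    and lift_universal: "A \<in> Obj C \<Longrightarrow>
      is_equalizer C (Tn 2 A) (FObj T (FObj T A)) (FObj T A)
        (FMap T (s A) \<cdot> tan_pair C T Tn q 1 A (l A \<cdot> q 2 A 0) (z (FObj T A) \<cdot> q 2 A 1))
        (FMap T (p A)) (z A \<cdot> p A \<cdot> p (FObj T A))"

locale rosicky_tangent_structure = tangent_structure C T p Tn q s z l c
  for C :: "('o, 'm, 'z) category_scheme" (structure) and T and p Tn q s z l c +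
  fixes n :: "'o \<Rightarrow> 'm"
  assumes n_natural: "natural C T T n"
    and n_p: "A \<in> Obj C \<Longrightarrow> p A \<cdot> n A = p A"
    and n_s: "A \<in> Obj C \<Longrightarrow>
      s A \<cdot> tan_pair C T Tn q 0 A (Ide C (FObj T A)) (n A) = z A \<cdot> p A"

locale cartesian_tangent_category = tangent_structure +
  assumes finite_products: "has_finite_products C"
    and T_preserves_products: "preserves_finite_products C T"

locale cartesian_rosicky_tangent_category = rosicky_tangent_structure +
  assumes finite_products: "has_finite_products C"
    and T_preserves_products: "preserves_finite_products C T"


section \<open>The tangent structure on the category of algebras\<close>

text \<open>\<open>alg_diff\<close> is \<open>\<alpha> \<circ> S(\<pi>\<^sub>1 + \<pi>\<^sub>4) \<circ> \<partial> : S(A \<times> A) \<rightarrow> A\<close>, the derivative of the structure map \<open>\<alpha>\<close>.\<close>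

definition alg_diff :: "('o, 'm, 'z) biproduct_category_scheme \<Rightarrow> ('o, 'm) endofunctor \<Rightarrow>
    ('o \<Rightarrow> 'm) \<Rightarrow> 'o \<times> 'm \<Rightarrow> 'm" where
  "alg_diff X S \<delta> = (\<lambda>(A, \<alpha>).
     \<alpha> \<cdot>\<^bsub>X\<^esub> FMap S (pr4 X A 0 \<oplus>\<^bsub>X\<^esub> pr4 X A 3) \<cdot>\<^bsub>X\<^esub> \<delta> (Bip X [A, A]))"

definition alg_T_obj :: "('o, 'm, 'z) biproduct_category_scheme \<Rightarrow> ('o, 'm) endofunctor \<Rightarrow>
    ('o \<Rightarrow> 'm) \<Rightarrow> 'o \<times> 'm \<Rightarrow> 'o \<times> 'm" where
  "alg_T_obj X S \<delta> = (\<lambda>(A, \<alpha>).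
     (Bip X [A, A], tup X [\<alpha> \<cdot>\<^bsub>X\<^esub> FMap S (Pr X [A, A] 0), alg_diff X S \<delta> (A, \<alpha>)]))"

definition alg_T :: "('o, 'm, 'z) biproduct_category_scheme \<Rightarrow> ('o, 'm) endofunctor \<Rightarrow>
    ('o \<Rightarrow> 'm) \<Rightarrow> ('o \<times> 'm, ('o, 'm) alg_map) endofunctor" where
  "alg_T X S \<delta> = \<lparr> FObj = alg_T_obj X S \<delta>,
     FMap = (\<lambda>(P, Q, f). (alg_T_obj X S \<delta> P, alg_T_obj X S \<delta> Q, FMap (square X) f)) \<rparr>"

definition alg_p :: "('o, 'm, 'z) biproduct_category_scheme \<Rightarrow> ('o, 'm) endofunctor \<Rightarrow>
    ('o \<Rightarrow> 'm) \<Rightarrow> 'o \<times> 'm \<Rightarrow> ('o, 'm) alg_map" where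
  "alg_p X S \<delta> = (\<lambda>(A, \<alpha>). (alg_T_obj X S \<delta> (A, \<alpha>), (A, \<alpha>), Pr X [A, A] 0))"

definition alg_Tn :: "('o, 'm, 'z) biproduct_category_scheme \<Rightarrow> ('o, 'm) endofunctor \<Rightarrow>
    ('o \<Rightarrow> 'm) \<Rightarrow> nat \<Rightarrow> 'o \<times> 'm \<Rightarrow> 'o \<times> 'm" where
  "alg_Tn X S \<delta> n = (\<lambda>(A, \<alpha>). let As = replicate (n + 1) A in
     (Bip X As,
      tup X (\<alpha> \<cdot>\<^bsub>X\<^esub> FMap S (Pr X As 0) #
        map (\<lambda>j. alg_diff X S \<delta> (A, \<alpha>) \<cdot>\<^bsub>X\<^esub> FMap S (tup X [Pr X As 0, Pr X As j])) [1..<n + 1])))"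

definition alg_q :: "('o, 'm, 'z) biproduct_category_scheme \<Rightarrow> ('o, 'm) endofunctor \<Rightarrow>
    ('o \<Rightarrow> 'm) \<Rightarrow> nat \<Rightarrow> 'o \<times> 'm \<Rightarrow> nat \<Rightarrow> ('o, 'm) alg_map" where
  "alg_q X S \<delta> n = (\<lambda>(A, \<alpha>) j. let As = replicate (n + 1) A in
     (alg_Tn X S \<delta> n (A, \<alpha>), alg_T_obj X S \<delta> (A, \<alpha>), tup X [Pr X As 0, Pr X As (j + 1)]))"

definition alg_s :: "('o, 'm, 'z) biproduct_category_scheme \<Rightarrow> ('o, 'm) endofunctor \<Rightarrow>
    ('o \<Rightarrow> 'm) \<Rightarrow> 'o \<times> 'm \<Rightarrow> ('o, 'm) alg_map" where
  "alg_s X S \<delta> = (\<lambda>(A, \<alpha>).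
     (alg_Tn X S \<delta> 2 (A, \<alpha>), alg_T_obj X S \<delta> (A, \<alpha>),
      tup X [Pr X [A, A, A] 0, Pr X [A, A, A] 1 \<oplus>\<^bsub>X\<^esub> Pr X [A, A, A] 2]))"

definition alg_z :: "('o, 'm, 'z) biproduct_category_scheme \<Rightarrow> ('o, 'm) endofunctor \<Rightarrow>
    ('o \<Rightarrow> 'm) \<Rightarrow> 'o \<times> 'm \<Rightarrow> ('o, 'm) alg_map" where
  "alg_z X S \<delta> = (\<lambda>(A, \<alpha>).
     ((A, \<alpha>), alg_T_obj X S \<delta> (A, \<alpha>), tup X [Ide X A, zero_map X A A]))"

definition alg_l :: "('o, 'm, 'z) biproduct_category_scheme \<Rightarrow> ('o, 'm) endofunctor \<Rightarrow>
    ('o \<Rightarrow> 'm) \<Rightarrow> 'o \<times> 'm \<Rightarrow> ('o, 'm) alg_map" where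
  "alg_l X S \<delta> = (\<lambda>(A, \<alpha>). let zero = zero_map X (Bip X [A, A]) A in
     (alg_T_obj X S \<delta> (A, \<alpha>), alg_T_obj X S \<delta> (alg_T_obj X S \<delta> (A, \<alpha>)),
      tup4 X (Pr X [A, A] 0) zero zero (Pr X [A, A] 1)))"

definition alg_c :: "('o, 'm, 'z) biproduct_category_scheme \<Rightarrow> ('o, 'm) endofunctor \<Rightarrow>
    ('o \<Rightarrow> 'm) \<Rightarrow> 'o \<times> 'm \<Rightarrow> ('o, 'm) alg_map" where
  "alg_c X S \<delta> = (\<lambda>(A, \<alpha>). let TT = alg_T_obj X S \<delta> (alg_T_obj X S \<delta> (A, \<alpha>)) in
     (TT, TT, tup4 X (pr4 X A 0) (pr4 X A 2) (pr4 X A 1) (pr4 X A 3)))"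

definition alg_n :: "('o, 'm, 'z) biproduct_category_scheme \<Rightarrow> ('o, 'm) endofunctor \<Rightarrow>
    ('o \<Rightarrow> 'm) \<Rightarrow> 'o \<times> 'm \<Rightarrow> ('o, 'm) alg_map" where
  "alg_n X S \<delta> = (\<lambda>(A, \<alpha>).
     (alg_T_obj X S \<delta> (A, \<alpha>), alg_T_obj X S \<delta> (A, \<alpha>),
      tup X [Pr X [A, A] 0, neg_map X (Pr X [A, A] 1)]))"

end

theory Submission
  imports Defs
begin

text \<open>For an algebra \<open>(A, \<alpha>)\<close> put \<open>D\<alpha>(a, b) = \<alpha> \<circ> S(a \<pi>\<^sub>1 + b \<pi>\<^sub>2) \<circ> \<partial>\<close>, the derivative of \<open>\<alpha>\<close> at \<open>a\<close> in
  direction \<open>b\<close>. Naturality of \<open>\<partial>\<close> makes \<open>D\<alpha>\<close> compatible with precomposition and with algebra maps,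
  [DC.1] and [DC.2] make it additive in \<open>b\<close>, [DC.3] and [DC.4] give the algebra laws for \<open>T(A, \<alpha>)\<close>,
  and on the second derivative [DC.5] and [DC.6] say exactly that \<open>l\<close> and \<open>c\<close> are maps of algebras.
  The forgetful functor to \<open>X\<close> is faithful, reflects and creates limits, and turns \<open>T\<close> into
  \<open>A \<mapsto> A \<times> A\<close>; so the pullbacks, the products and the universality of the lift are checked in \<open>X\<close>, and
  the equations between structure maps become identities between tuples of projections.\<close>

section \<open>Composition calculus in a semi-additive category\<close>

text \<open>Maps of algebras are tagged triples, and the pairings as well as \<open>tan_pair\<close>
  are definite descriptions, so the tangent axioms do not compute by themselves. Each pairing is
  first identified with an explicit tuple in \<open>X\<close>, and that tuple must be shown to be a
  map of algebras. Joint monicity settles this uniformly: along a jointly monic family of legs, both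
  the algebra laws of a structure map (\<open>algebra_lift\<close>) and the homomorphism property
  (\<open>alg_hom_lift\<close>) can be tested after the legs. \<open>T_obj\<close> escapes this
  method, because its second component is a derivative and not \<open>snd P\<close> after
  \<open>S\<close> of a projection; its laws need a direct computation with \<open>\<mu>\<close> and
  \<open>\<eta>\<close>. A second obstacle is that preservation of products concerns arbitrary
  product cones of algebras, not only those carried by the chosen biproducts; hence any such cone is
  compared with a constructed one in \<open>product_underlying\<close>.\<close>

lemma in_hom_iff: "f \<in> hom C A B \<longleftrightarrow> f \<in> Arr C \<and> Dom C f = A \<and> Cod C f = B"
  by (simp add: hom_def)

context category
begin

lemma obj_simps [simp]:
  "f \<in> Arr C \<Longrightarrow> Dom C f \<in> Obj C" "f \<in> Arr C \<Longrightarrow> Cod C f \<in> Obj C"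
  by (fact dom_obj cod_obj)+

lemma ide_simps [simp]:
  assumes "A \<in> Obj C"
  shows "Ide C A \<in> Arr C" "Dom C (Ide C A) = A" "Cod C (Ide C A) = A"
  using ide_hom[OF assms] by (simp_all add: in_hom_iff)

lemma comp_simps [simp]:
  assumes "f \<in> Arr C" "g \<in> Arr C" "Cod C f = Dom C g"
  shows "g \<cdot> f \<in> Arr C" "Dom C (g \<cdot> f) = Dom C f" "Cod C (g \<cdot> f) = Cod C g"
  using comp_hom[of f "Dom C f" "Cod C f" g "Cod C g"] assms by (simp_all add: in_hom_iff)

lemma comp_ide_simps [simp]:
  "f \<in> Arr C \<Longrightarrow> Cod C f = B \<Longrightarrow> Ide C B \<cdot> f = f"
  "f \<in> Arr C \<Longrightarrow> Dom C f = A \<Longrightarrow> f \<cdot> Ide C A = f"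
  using comp_ide_left[of f "Dom C f" "Cod C f"] comp_ide_right[of f "Dom C f" "Cod C f"]
  by (simp_all add: in_hom_iff)

lemma comp_assoc_simp [simp]:
  assumes "f \<in> Arr C" "g \<in> Arr C" "h \<in> Arr C" "Cod C f = Dom C g" "Cod C g = Dom C h"
  shows "(h \<cdot> g) \<cdot> f = h \<cdot> (g \<cdot> f)"
  using comp_assoc[of f "Dom C f" "Cod C f" g "Cod C g" h "Cod C h"] assms
  by (simp add: in_hom_iff)

end

context endofunctor
begin

lemma functor_simps [simp]:
  "A \<in> Obj C \<Longrightarrow> FObj F A \<in> Obj C"
  "f \<in> Arr C \<Longrightarrow> FMap F f \<in> Arr C"
  "f \<in> Arr C \<Longrightarrow> Dom C (FMap F f) = FObj F (Dom C f)"
  "f \<in> Arr C \<Longrightarrow> Cod C (FMap F f) = FObj F (Cod C f)"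
  "A \<in> Obj C \<Longrightarrow> FMap F (Ide C A) = Ide C (FObj F A)"
  using fobj fmap[of f "Dom C f" "Cod C f"] fmap_ide by (simp_all add: in_hom_iff)

lemma functor_comp:
  assumes "f \<in> Arr C" "g \<in> Arr C" "Cod C f = Dom C g"
  shows "FMap F g \<cdot> FMap F f = FMap F (g \<cdot> f)"
  using fmap_comp[of f "Dom C f" "Cod C f" g "Cod C g"] assms by (simp add: in_hom_iff)

text \<open>Composites are normalised by nesting to the right, so two adjacent factors in the image
  of \<open>F\<close> usually come with a tail \<open>h\<close>. This is the merging rule for that
  shape.\<close>

lemma functor_comp_assoc:
  assumes "f \<in> Arr C" "g \<in> Arr C" "Cod C f = Dom C g" "h \<in> Arr C" "Cod C h = FObj F (Dom C f)"
  shows "FMap F g \<cdot> (FMap F f \<cdot> h) = FMap F (g \<cdot> f) \<cdot> h"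
  using assms functor_comp[of f g] comp_assoc_simp[of h "FMap F f" "FMap F g"] by simp

end

context semi_additive_category
begin

section \<open>Projections and pairings of the chosen biproducts\<close>

lemma Bip_obj [simp]: "set As \<subseteq> Obj X \<Longrightarrow> Bip X As \<in> Obj X"
  using bip_product by (simp add: is_product_def)

lemma Pr_simps [simp]:
  assumes "set As \<subseteq> Obj X" "i < length As"
  shows "Pr X As i \<in> Arr X" "Dom X (Pr X As i) = Bip X As" "Cod X (Pr X As i) = As ! i"
  using bip_product[OF assms(1)] assms(2) by (simp_all add: is_product_def in_hom_iff)

lemma Inj_simps [simp]:
  assumes "set As \<subseteq> Obj X" "i < length As"
  shows "Inj X As i \<in> Arr X" "Cod X (Inj X As i) = Bip X As" "Dom X (Inj X As i) = As ! i"
  using bip_coproduct[OF assms(1)] assms(2) by (simp_all add: is_coproduct_def in_hom_iff)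

lemma Bip_eqI:
  assumes "set As \<subseteq> Obj X" "u \<in> Arr X" "v \<in> Arr X" "Cod X u = Bip X As" "Cod X v = Bip X As"
    "Dom X u = Dom X v" "\<And>i. i < length As \<Longrightarrow> Pr X As i \<cdot> u = Pr X As i \<cdot> v"
  shows "u = v"
proof -
  have "\<exists>!w. w \<in> hom X (Dom X u) (Bip X As) \<and> (\<forall>i < length As. Pr X As i \<cdot> w = Pr X As i \<cdot> u)"
    using bip_product[OF assms(1)] assms unfolding is_product_def
    by (auto simp: in_hom_iff nth_mem subset_iff)
  then show ?thesis
    using assms(2-) by (metis in_hom_iff)
qed

lemma Bip_coeqI:
  assumes "set As \<subseteq> Obj X" "u \<in> Arr X" "v \<in> Arr X" "Dom X u = Bip X As" "Dom X v = Bip X As"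
    "Cod X u = Cod X v" "\<And>i. i < length As \<Longrightarrow> u \<cdot> Inj X As i = v \<cdot> Inj X As i"
  shows "u = v"
proof -
  have "\<exists>!w. w \<in> hom X (Bip X As) (Cod X u) \<and> (\<forall>i < length As. w \<cdot> Inj X As i = u \<cdot> Inj X As i)"
    using bip_coproduct[OF assms(1)] assms unfolding is_coproduct_def
    by (auto simp: in_hom_iff nth_mem subset_iff)
  then show ?thesis
    using assms(2-) by (metis in_hom_iff)
qed

lemma tup_char:
  assumes "fs \<noteq> []" "\<forall>f \<in> set fs. f \<in> Arr X \<and> Dom X f = D"
  shows "tup X fs \<in> hom X D (Bip X (map (Cod X) fs)) \<and>
     (\<forall>i < length fs. Pr X (map (Cod X) fs) i \<cdot> tup X fs = fs ! i)"
proof -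
  have hd: "hd fs \<in> Arr X" "Dom X (hd fs) = D"
    using assms by auto
  then have obj: "set (map (Cod X) fs) \<subseteq> Obj X" "D \<in> Obj X"
    using assms obj_simps(1)[of "hd fs"] by auto
  have "\<forall>i < length fs. fs ! i \<in> hom X D (map (Cod X) fs ! i)"
    using assms(2) by (simp add: in_hom_iff)
  then have "\<exists>!u. u \<in> hom X D (Bip X (map (Cod X) fs)) \<and>
     (\<forall>i < length fs. Pr X (map (Cod X) fs) i \<cdot> u = fs ! i)"
    using bip_product[OF obj(1)] obj(2) unfolding is_product_def by simp
  from theI'[OF this] show ?thesis
    unfolding tup_def hd(2) .
qed

lemma tup_simps [simp]:
  assumes "fs \<noteq> []" "\<forall>f \<in> set fs. f \<in> Arr X \<and> Dom X f = Dom X (hd fs)"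
  shows "tup X fs \<in> Arr X" "Dom X (tup X fs) = Dom X (hd fs)"
    "Cod X (tup X fs) = Bip X (map (Cod X) fs)"
  using tup_char[OF assms] by (auto simp only: in_hom_iff)

lemma Pr_tup [simp]:
  assumes "map (Cod X) fs = As" "i < length fs"
    "\<forall>f \<in> set fs. f \<in> Arr X \<and> Dom X f = Dom X (hd fs)"
  shows "Pr X As i \<cdot> tup X fs = fs ! i"
  using tup_char[OF _ assms(3)] assms(1,2) by fastforce

text \<open>Companion of \<open>Pr_tup\<close> for right-nested composites, where the tail
  \<open>h\<close> separates the projection from the bare pairing.\<close>

lemma Pr_tup_comp [simp]:
  assumes "map (Cod X) fs = As" "i < length fs"
    "\<forall>f \<in> set fs. f \<in> Arr X \<and> Dom X f = Dom X (hd fs)" "h \<in> Arr X" "Cod X h = Dom X (hd fs)"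
  shows "Pr X As i \<cdot> (tup X fs \<cdot> h) = fs ! i \<cdot> h"
proof -
  have "fs \<noteq> []" using assms(2) by auto
  note t = tup_char[OF this assms(3)]
  have "set As \<subseteq> Obj X" "length As = length fs"
    using assms(1,3) by auto
  then have "(Pr X As i \<cdot> tup X fs) \<cdot> h = Pr X As i \<cdot> (tup X fs \<cdot> h)"
    using t assms(1,2,4,5) by (intro comp_assoc_simp) (simp_all add: in_hom_iff)
  then show ?thesis
    using t assms(1,2) by simp
qed

lemma tup_comp:
  assumes "fs \<noteq> []" "\<forall>f \<in> set fs. f \<in> Arr X \<and> Dom X f = D" "h \<in> Arr X" "Cod X h = D"
  shows "tup X fs \<cdot> h = tup X (map (\<lambda>f. f \<cdot> h) fs)"
proof -
  have arr: "\<forall>f \<in> set (map (\<lambda>f. f \<cdot> h) fs). f \<in> Arr X \<and> Dom X f = Dom X h"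
    using assms by auto
  have cods: "map (Cod X) (map (\<lambda>f. f \<cdot> h) fs) = map (Cod X) fs"
    using assms by auto
  have objs: "set (map (Cod X) fs) \<subseteq> Obj X"
    using assms by auto
  have hd: "Dom X (hd fs) = D"
    using assms by auto
  note t1 = tup_char[OF assms(1,2)]
  note t2 = tup_char[OF _ arr, unfolded cods]
  show ?thesis
  proof (rule Bip_eqI[OF objs])
    fix i assume "i < length (map (Cod X) fs)"
    then have i: "i < length fs" by simp
    have "Pr X (map (Cod X) fs) i \<cdot> (tup X fs \<cdot> h) = fs ! i \<cdot> h"
      by (rule Pr_tup_comp) (use i assms hd in simp_all)
    then show "Pr X (map (Cod X) fs) i \<cdot> (tup X fs \<cdot> h)
      = Pr X (map (Cod X) fs) i \<cdot> tup X (map (\<lambda>f. f \<cdot> h) fs)"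
      using t2 i assms(1) by simp
  qed (use assms t1 t2 in \<open>simp_all add: in_hom_iff\<close>)
qed

lemma tup2_comp [simp]:
  assumes "f \<in> Arr X" "g \<in> Arr X" "Dom X f = Dom X g" "h \<in> Arr X" "Cod X h = Dom X g"
  shows "tup X [f, g] \<cdot> h = tup X [f \<cdot> h, g \<cdot> h]"
  using tup_comp[of "[f, g]" _ h] assms by simp

lemma tup3_comp [simp]:
  assumes "f \<in> Arr X" "g \<in> Arr X" "k \<in> Arr X" "Dom X f = Dom X k" "Dom X g = Dom X k"
    "h \<in> Arr X" "Cod X h = Dom X k"
  shows "tup X [f, g, k] \<cdot> h = tup X [f \<cdot> h, g \<cdot> h, k \<cdot> h]"
  using tup_comp[of "[f, g, k]" _ h] assms by simp

lemma Bip2_eqI: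
  assumes "u \<in> Arr X" "v \<in> Arr X" "Cod X u = Bip X [A, B]" "Cod X v = Bip X [A, B]"
    "Dom X u = Dom X v" "A \<in> Obj X" "B \<in> Obj X"
    "Pr X [A, B] 0 \<cdot> u = Pr X [A, B] 0 \<cdot> v" "Pr X [A, B] (Suc 0) \<cdot> u = Pr X [A, B] (Suc 0) \<cdot> v"
  shows "u = v"
  by (rule Bip_eqI[of "[A, B]"]) (use assms in \<open>auto simp: less_Suc_eq\<close>)

lemma Bip3_eqI:
  assumes "u \<in> Arr X" "v \<in> Arr X" "Cod X u = Bip X [A, B, D]" "Cod X v = Bip X [A, B, D]"
    "Dom X u = Dom X v" "A \<in> Obj X" "B \<in> Obj X" "D \<in> Obj X"
    "Pr X [A, B, D] 0 \<cdot> u = Pr X [A, B, D] 0 \<cdot> v"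
    "Pr X [A, B, D] (Suc 0) \<cdot> u = Pr X [A, B, D] (Suc 0) \<cdot> v"
    "Pr X [A, B, D] 2 \<cdot> u = Pr X [A, B, D] 2 \<cdot> v"
  shows "u = v"
  by (rule Bip_eqI[of "[A, B, D]"]) (use assms in \<open>auto simp: less_Suc_eq numeral_2_eq_2\<close>)

lemma tup_eta:
  assumes "u \<in> Arr X" "Cod X u = Bip X [A, B]" "A \<in> Obj X" "B \<in> Obj X"
  shows "tup X [Pr X [A, B] 0 \<cdot> u, Pr X [A, B] (Suc 0) \<cdot> u] = u"
  by (rule Bip2_eqI[of _ _ A B]) (use assms in simp_all)

lemma tup_Pr [simp]:
  assumes "A \<in> Obj X" "B \<in> Obj X"
  shows "tup X [Pr X [A, B] 0, Pr X [A, B] (Suc 0)] = Ide X (Bip X [A, B])"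
  by (rule Bip2_eqI[of _ _ A B]) (use assms in simp_all)

subsection \<open>Enrichment in commutative monoids\<close>

lemma ex1_to_zero: "A \<in> Obj X \<Longrightarrow> \<exists>!u. u \<in> hom X A (Bip X [])"
  using bip_product[of "[]"] by (simp add: is_product_def)

lemma ex1_from_zero: "A \<in> Obj X \<Longrightarrow> \<exists>!u. u \<in> hom X (Bip X []) A"
  using bip_coproduct[of "[]"] by (simp add: is_coproduct_def)

text \<open>Maps into and out of the empty biproduct are unique, which identifies the descriptions
  inside \<open>zero_map\<close> with any given factorisation. The absorption laws
  \<open>comp_zero\<close> and \<open>zero_comp\<close> rest on this freedom of choice.\<close>

lemma zero_map_eq:
  assumes "u \<in> hom X A (Bip X [])" "v \<in> hom X (Bip X []) B"
  shows "v \<cdot> u = zero_map X A B"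
proof -
  have "A \<in> Obj X" "B \<in> Obj X"
    using assms by (auto simp: in_hom_iff)
  then show ?thesis
    unfolding zero_map_def
    using the1_equality[OF ex1_to_zero assms(1)] the1_equality[OF ex1_from_zero assms(2)] by simp
qed

lemma zero_map_factors:
  assumes "A \<in> Obj X" "B \<in> Obj X"
  obtains u v where "u \<in> hom X A (Bip X [])" "v \<in> hom X (Bip X []) B" "zero_map X A B = v \<cdot> u"
  using ex1_to_zero[OF assms(1)] ex1_from_zero[OF assms(2)] zero_map_eq by metis

lemma zero_simps [simp]:
  assumes "A \<in> Obj X" "B \<in> Obj X"
  shows "zero_map X A B \<in> Arr X" "Dom X (zero_map X A B) = A" "Cod X (zero_map X A B) = B"
  using zero_map_factors[OF assms] by (force simp: in_hom_iff)+

lemma comp_zero [simp]: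
  assumes "f \<in> Arr X" "Dom X f = B" "A \<in> Obj X"
  shows "f \<cdot> zero_map X A B = zero_map X A (Cod X f)"
proof -
  have "B \<in> Obj X" using assms by auto
  then obtain u v where uv: "u \<in> hom X A (Bip X [])" "v \<in> hom X (Bip X []) B"
    "zero_map X A B = v \<cdot> u"
    using zero_map_factors assms by metis
  have "(f \<cdot> v) \<cdot> u = zero_map X A (Cod X f)"
    by (rule zero_map_eq) (use uv assms in \<open>simp_all add: in_hom_iff\<close>)
  then show ?thesis
    using uv assms by (simp add: in_hom_iff)
qed

lemma zero_comp [simp]:
  assumes "f \<in> Arr X" "Cod X f = A" "B \<in> Obj X"
  shows "zero_map X A B \<cdot> f = zero_map X (Dom X f) B"
proof -
  have "A \<in> Obj X" using assms by auto
  then obtain u v where uv: "u \<in> hom X A (Bip X [])" "v \<in> hom X (Bip X []) B"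
    "zero_map X A B = v \<cdot> u"
    using zero_map_factors assms by metis
  have "v \<cdot> (u \<cdot> f) = zero_map X (Dom X f) B"
    by (rule zero_map_eq) (use uv assms in \<open>simp_all add: in_hom_iff\<close>)
  then show ?thesis
    using uv assms by (simp add: in_hom_iff)
qed

lemma Pr_Inj:
  assumes "A \<in> Obj X" "B \<in> Obj X"
  shows "Pr X [A, B] 0 \<cdot> Inj X [A, B] 0 = Ide X A"
    "Pr X [A, B] 0 \<cdot> Inj X [A, B] (Suc 0) = zero_map X B A"
    "Pr X [A, B] (Suc 0) \<cdot> Inj X [A, B] 0 = zero_map X A B"
    "Pr X [A, B] (Suc 0) \<cdot> Inj X [A, B] (Suc 0) = Ide X B"
  using pr_inj[of "[A, B]"] assms by simp_all

text \<open>The equations \<open>pr_inj\<close> determine the components of the injections. Once the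
  injections are pairings, all later calculations use projections only.\<close>

lemma Inj_eq_tup:
  assumes "A \<in> Obj X" "B \<in> Obj X"
  shows "Inj X [A, B] 0 = tup X [Ide X A, zero_map X A B]"
    "Inj X [A, B] (Suc 0) = tup X [zero_map X B A, Ide X B]"
  by (rule Bip2_eqI[of _ _ A B]; use assms in \<open>simp add: Pr_Inj\<close>)+

lemma codiag_char:
  assumes "B \<in> Obj X"
  shows "codiag X B \<in> hom X (Bip X [B, B]) B \<and> (\<forall>i < 2. codiag X B \<cdot> Inj X [B, B] i = Ide X B)"
proof -
  have "\<forall>i < 2. Ide X B \<in> hom X ([B, B] ! i) B"
    using assms by (auto simp: in_hom_iff less_Suc_eq numeral_2_eq_2)
  then have "\<exists>!u. u \<in> hom X (Bip X [B, B]) B \<and> (\<forall>i < 2. u \<cdot> Inj X [B, B] i = Ide X B)"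
    using bip_coproduct[of "[B, B]"] assms unfolding is_coproduct_def
    by (simp add: numeral_2_eq_2)
  from theI'[OF this] show ?thesis
    unfolding codiag_def .
qed

lemma codiag_simps [simp]:
  assumes "B \<in> Obj X"
  shows "codiag X B \<in> Arr X" "Dom X (codiag X B) = Bip X [B, B]" "Cod X (codiag X B) = B"
  using codiag_char[OF assms] by (simp_all add: in_hom_iff)

lemma codiag_tup:
  assumes "B \<in> Obj X"
  shows "codiag X B \<cdot> tup X [Ide X B, zero_map X B B] = Ide X B"
    "codiag X B \<cdot> tup X [zero_map X B B, Ide X B] = Ide X B"
  using codiag_char[OF assms] assms by (simp_all add: Inj_eq_tup[symmetric])

lemma codiag_eqI:
  assumes "u \<in> Arr X" "v \<in> Arr X" "Dom X u = Bip X [B, B]" "Dom X v = Bip X [B, B]"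
    "Cod X u = Cod X v" "B \<in> Obj X"
    "u \<cdot> tup X [Ide X B, zero_map X B B] = v \<cdot> tup X [Ide X B, zero_map X B B]"
    "u \<cdot> tup X [zero_map X B B, Ide X B] = v \<cdot> tup X [zero_map X B B, Ide X B]"
  shows "u = v"
  by (rule Bip_coeqI[of "[B, B]"]) (use assms in \<open>auto simp: less_Suc_eq Inj_eq_tup\<close>)

lemma plus_simps [simp]:
  assumes "f \<in> Arr X" "g \<in> Arr X" "Dom X f = Dom X g" "Cod X f = Cod X g"
  shows "f \<oplus> g \<in> Arr X" "Dom X (f \<oplus> g) = Dom X g" "Cod X (f \<oplus> g) = Cod X g"
  unfolding plus_map_def using assms by simp_all

lemma plus_comp [simp]:
  assumes "f \<in> Arr X" "g \<in> Arr X" "Dom X f = Dom X g" "Cod X f = Cod X g"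
    "h \<in> Arr X" "Cod X h = Dom X g"
  shows "(f \<oplus> g) \<cdot> h = f \<cdot> h \<oplus> g \<cdot> h"
  unfolding plus_map_def using assms by simp

text \<open>Both sides are maps out of a coproduct and restrict to \<open>h\<close> along each
  injection. This naturality of the codiagonal is what makes postcomposition additive.\<close>

lemma comp_codiag:
  assumes "h \<in> Arr X" "Dom X h = A" "Cod X h = B"
  shows "h \<cdot> codiag X A = codiag X B \<cdot> tup X [h \<cdot> Pr X [A, A] 0, h \<cdot> Pr X [A, A] 1]"
proof (rule codiag_eqI[of _ _ A])
  have A: "A \<in> Obj X" and B: "B \<in> Obj X"
    using assms by auto
  have 1: "tup X [h, zero_map X A B] = tup X [Ide X B, zero_map X B B] \<cdot> h"
    "tup X [zero_map X A B, h] = tup X [zero_map X B B, Ide X B] \<cdot> h"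
    using assms A B by simp_all
  \<comment> \<open>By \<open>1\<close> each pairing is an injection after \<open>h\<close>.
    Associativity is used from right to left here, so that \<open>codiag X B\<close> meets the
    injection and cancels it.\<close>
  have 2: "codiag X B \<cdot> tup X [h, zero_map X A B] = h" "codiag X B \<cdot> tup X [zero_map X A B, h] = h"
    unfolding 1 using assms A B
    by (simp_all del: tup2_comp comp_assoc_simp add: comp_assoc_simp[symmetric] codiag_tup)
  show "h \<cdot> codiag X A \<cdot> tup X [Ide X A, zero_map X A A]
    = codiag X B \<cdot> tup X [h \<cdot> Pr X [A, A] 0, h \<cdot> Pr X [A, A] 1] \<cdot> tup X [Ide X A, zero_map X A A]"
    "h \<cdot> codiag X A \<cdot> tup X [zero_map X A A, Ide X A]
    = codiag X B \<cdot> tup X [h \<cdot> Pr X [A, A] 0, h \<cdot> Pr X [A, A] 1] \<cdot> tup X [zero_map X A A, Ide X A]"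
    using assms A B by (simp_all add: codiag_tup 2)
qed (use assms in auto)

lemma comp_plus [simp]:
  assumes "f \<in> Arr X" "g \<in> Arr X" "Dom X f = Dom X g" "Cod X f = Cod X g"
    "h \<in> Arr X" "Dom X h = Cod X g"
  shows "h \<cdot> (f \<oplus> g) = h \<cdot> f \<oplus> h \<cdot> g"
proof -
  have "h \<cdot> (f \<oplus> g) = (h \<cdot> codiag X (Cod X g)) \<cdot> tup X [f, g]"
    unfolding plus_map_def using assms by simp
  also have "\<dots> = h \<cdot> f \<oplus> h \<cdot> g"
    unfolding comp_codiag[OF assms(5,6) refl] plus_map_def using assms by simp
  finally show ?thesis .
qed

lemma plus_zero [simp]:
  assumes "f \<in> Arr X" "Dom X f = A" "Cod X f = B"
  shows "f \<oplus> zero_map X A B = f" "zero_map X A B \<oplus> f = f"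
proof -
  have obj: "A \<in> Obj X" "B \<in> Obj X" using assms by auto
  have 1: "tup X [f, zero_map X A B] = tup X [Ide X B, zero_map X B B] \<cdot> f"
    "tup X [zero_map X A B, f] = tup X [zero_map X B B, Ide X B] \<cdot> f"
    using assms obj by simp_all
  show "f \<oplus> zero_map X A B = f" "zero_map X A B \<oplus> f = f"
    unfolding plus_map_def 1 using assms obj
    by (simp_all del: tup2_comp comp_assoc_simp add: comp_assoc_simp[symmetric] codiag_tup)
qed

lemma tup_plus:
  assumes "f \<in> Arr X" "g \<in> Arr X" "f' \<in> Arr X" "g' \<in> Arr X" "Dom X f = Dom X g"
    "Dom X f' = Dom X g" "Dom X g' = Dom X g" "Cod X f = Cod X f'" "Cod X g = Cod X g'"
  shows "tup X [f, g] \<oplus> tup X [f', g'] = tup X [f \<oplus> f', g \<oplus> g']"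
  by (rule Bip2_eqI[of _ _ "Cod X f'" "Cod X g'"]) (use assms in simp_all)

lemma tup_zero:
  assumes "A \<in> Obj X" "B \<in> Obj X" "D \<in> Obj X"
  shows "tup X [zero_map X D A, zero_map X D B] = zero_map X D (Bip X [A, B])"
  by (rule Bip2_eqI[of _ _ A B]) (use assms in simp_all)

text \<open>The Eckmann-Hilton argument: \<open>codiag\<close> is itself additive.\<close>

lemma plus_interchange:
  assumes "a \<in> Arr X" "b \<in> Arr X" "c \<in> Arr X" "d \<in> Arr X"
    "Dom X a = Dom X d" "Dom X b = Dom X d" "Dom X c = Dom X d"
    "Cod X a = Cod X d" "Cod X b = Cod X d" "Cod X c = Cod X d"
  shows "(a \<oplus> b) \<oplus> (c \<oplus> d) = (a \<oplus> c) \<oplus> (b \<oplus> d)"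
proof -
  \<comment> \<open>The sum of the two pairings can be evaluated componentwise, or
    \<open>codiag\<close> can be distributed over it by \<open>comp_plus\<close>; the two readings
    are the two sides of the interchange law.\<close>
  have "(a \<oplus> b) \<oplus> (c \<oplus> d) = codiag X (Cod X d) \<cdot> (tup X [a, c] \<oplus> tup X [b, d])"
    using assms by (simp add: tup_plus plus_map_def[of X "a \<oplus> b"] del: comp_plus)
  also have "\<dots> = (a \<oplus> c) \<oplus> (b \<oplus> d)"
    using assms by (simp add: plus_map_def[of X a c] plus_map_def[of X b d])
  finally show ?thesis .
qed

lemma plus_assoc:
  assumes "a \<in> Arr X" "b \<in> Arr X" "d \<in> Arr X" "Dom X a = Dom X d" "Dom X b = Dom X d"
    "Cod X a = Cod X d" "Cod X b = Cod X d"
  shows "(a \<oplus> b) \<oplus> d = a \<oplus> (b \<oplus> d)"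
  using plus_interchange[of a b "zero_map X (Dom X d) (Cod X d)" d] assms by simp

lemma plus_commute:
  assumes "a \<in> Arr X" "b \<in> Arr X" "Dom X a = Dom X b" "Cod X a = Cod X b"
  shows "a \<oplus> b = b \<oplus> a"
  using plus_interchange[of "zero_map X (Dom X b) (Cod X b)" a b "zero_map X (Dom X b) (Cod X b)"]
    assms by simp

subsection \<open>The functor \<open>A \<mapsto> A \<times> A\<close>\<close>

lemma FObj_square [simp]: "FObj (square X) A = Bip X [A, A]"
  by (simp add: square_def)

lemma FMap_square: "FMap (square X) f =
    tup X [f \<cdot> Pr X [Dom X f, Dom X f] 0, f \<cdot> Pr X [Dom X f, Dom X f] (Suc 0)]"
  by (simp add: square_def)

lemma square_tup:
  assumes "f \<in> Arr X" "u \<in> Arr X" "v \<in> Arr X" "Dom X u = Dom X v" "Cod X u = Dom X f" "Cod X v = Dom X f"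
  shows "FMap (square X) f \<cdot> tup X [u, v] = tup X [f \<cdot> u, f \<cdot> v]"
  using assms by (simp add: FMap_square)

text \<open>Presents a map into a product by generalised elements, so that a composite of structure
  maps can be evaluated on explicit tuples.\<close>

lemma Bip2_cases:
  assumes "u \<in> hom X D (Bip X [A, B])" "A \<in> Obj X" "B \<in> Obj X"
  obtains a b where "u = tup X [a, b]" "a \<in> hom X D A" "b \<in> hom X D B"
proof -
  have u: "u \<in> Arr X" "Cod X u = Bip X [A, B]"
    using assms(1) by (simp_all add: in_hom_iff)
  have "Pr X [A, B] 0 \<cdot> u \<in> hom X D A" "Pr X [A, B] (Suc 0) \<cdot> u \<in> hom X D B"
    using assms by (simp_all add: in_hom_iff)
  then show thesis
    by (rule that[OF tup_eta[OF u assms(2,3), symmetric]])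
qed

lemma Bip4_cases:
  assumes "u \<in> hom X D (Bip X [Bip X [A, A], Bip X [A, A]])" "A \<in> Obj X"
  obtains a b c d where "u = tup X [tup X [a, b], tup X [c, d]]"
    "a \<in> hom X D A" "b \<in> hom X D A" "c \<in> hom X D A" "d \<in> hom X D A"
proof -
  have B: "Bip X [A, A] \<in> Obj X" using assms(2) by simp
  from Bip2_cases[OF assms(1) B B]
  obtain v w where vw: "u = tup X [v, w]" "v \<in> hom X D (Bip X [A, A])" "w \<in> hom X D (Bip X [A, A])" .
  from Bip2_cases[OF vw(2) assms(2,2)]
  obtain a b where ab: "v = tup X [a, b]" "a \<in> hom X D A" "b \<in> hom X D A" .
  from Bip2_cases[OF vw(3) assms(2,2)]
  obtain c d where cd: "w = tup X [c, d]" "c \<in> hom X D A" "d \<in> hom X D A" .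
  show thesis
    by (rule that[OF vw(1)[unfolded ab(1) cd(1)] ab(2,3) cd(2,3)])
qed

section \<open>Coordinates of the fourfold product\<close>

lemma pr4_simps [simp]:
  assumes "A \<in> Obj X" "i < 4"
  shows "pr4 X A i \<in> Arr X" "Dom X (pr4 X A i) = Bip X [Bip X [A, A], Bip X [A, A]]" "Cod X (pr4 X A i) = A"
proof -
  have i: "i mod 2 = 0 \<or> i mod 2 = Suc 0" "i div 2 = 0 \<or> i div 2 = Suc 0"
    using assms(2) by presburger+
  show "pr4 X A i \<in> Arr X" "Dom X (pr4 X A i) = Bip X [Bip X [A, A], Bip X [A, A]]" "Cod X (pr4 X A i) = A"
    unfolding pr4_def using i assms(1) by (elim disjE; simp)+
qed

lemma tup4_simps [simp]:
  assumes "f0 \<in> Arr X" "f1 \<in> Arr X" "f2 \<in> Arr X" "f3 \<in> Arr X"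
    "Dom X f0 = Dom X f3" "Dom X f1 = Dom X f3" "Dom X f2 = Dom X f3"
  shows "tup4 X f0 f1 f2 f3 \<in> Arr X" "Dom X (tup4 X f0 f1 f2 f3) = Dom X f3"
    "Cod X (tup4 X f0 f1 f2 f3) = Bip X [Bip X [Cod X f0, Cod X f1], Bip X [Cod X f2, Cod X f3]]"
  unfolding tup4_def using assms by simp_all

lemma tup4_comp [simp]:
  assumes "f0 \<in> Arr X" "f1 \<in> Arr X" "f2 \<in> Arr X" "f3 \<in> Arr X"
    "Dom X f0 = Dom X f3" "Dom X f1 = Dom X f3" "Dom X f2 = Dom X f3" "h \<in> Arr X" "Cod X h = Dom X f3"
  shows "tup4 X f0 f1 f2 f3 \<cdot> h = tup4 X (f0 \<cdot> h) (f1 \<cdot> h) (f2 \<cdot> h) (f3 \<cdot> h)"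
  unfolding tup4_def using assms by simp

lemma pr4_tup4 [simp]:
  assumes "f0 \<in> Arr X" "f1 \<in> Arr X" "f2 \<in> Arr X" "f3 \<in> Arr X"
    "Dom X f0 = Dom X f3" "Dom X f1 = Dom X f3" "Dom X f2 = Dom X f3"
    "Cod X f0 = A" "Cod X f1 = A" "Cod X f2 = A" "Cod X f3 = A"
  shows "pr4 X A 0 \<cdot> tup4 X f0 f1 f2 f3 = f0" "pr4 X A (Suc 0) \<cdot> tup4 X f0 f1 f2 f3 = f1"
    "pr4 X A 2 \<cdot> tup4 X f0 f1 f2 f3 = f2" "pr4 X A 3 \<cdot> tup4 X f0 f1 f2 f3 = f3"
  using assms(1-7) assms(8-11)[symmetric] by (simp_all add: pr4_def tup4_def)

lemma Bip4_eqI: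
  assumes "u \<in> Arr X" "v \<in> Arr X" "Cod X u = Bip X [Bip X [A, A], Bip X [A, A]]"
    "Cod X v = Bip X [Bip X [A, A], Bip X [A, A]]" "Dom X u = Dom X v" "A \<in> Obj X"
    "pr4 X A 0 \<cdot> u = pr4 X A 0 \<cdot> v" "pr4 X A (Suc 0) \<cdot> u = pr4 X A (Suc 0) \<cdot> v"
    "pr4 X A 2 \<cdot> u = pr4 X A 2 \<cdot> v" "pr4 X A 3 \<cdot> u = pr4 X A 3 \<cdot> v"
  shows "u = v"
  by (rule Bip2_eqI[of _ _ "Bip X [A, A]" "Bip X [A, A]"]; (rule Bip2_eqI[of _ _ A A])?)
    (use assms in \<open>simp_all add: pr4_def\<close>)

lemma tup4_pr4 [simp]:
  assumes "A \<in> Obj X"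
  shows "tup4 X (pr4 X A 0) (pr4 X A (Suc 0)) (pr4 X A 2) (pr4 X A 3) = Ide X (Bip X [Bip X [A, A], Bip X [A, A]])"
  by (rule Bip4_eqI[where A = A]) (use assms in simp_all)

lemma square_endofunctor: "endofunctor X (square X)"
proof unfold_locales
  fix f g A B D assume "f \<in> hom X A B" "g \<in> hom X B D"
  moreover from this have "A \<in> Obj X" "B \<in> Obj X"
    by (auto simp: in_hom_iff)
  ultimately show "FMap (square X) (g \<cdot> f) = FMap (square X) g \<cdot> FMap (square X) f"
    by (simp add: FMap_square in_hom_iff)
qed (simp_all add: FMap_square in_hom_iff)

end

section \<open>Limits in the category of algebras\<close>

text \<open>The index set is arbitrary so that one notion covers product projections, the legs of a
  fold pullback (with \<open>None\<close> for the base leg) and a single equalizer map.\<close>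

definition (in category) jointly_monic :: "'o \<Rightarrow> 'i set \<Rightarrow> ('i \<Rightarrow> 'm) \<Rightarrow> bool" where
  "jointly_monic P I g \<longleftrightarrow>
     (\<forall>D v w. v \<in> hom C D P \<longrightarrow> w \<in> hom C D P \<longrightarrow> (\<forall>i \<in> I. g i \<cdot> v = g i \<cdot> w) \<longrightarrow> v = w)"

lemma is_product_ex1:
  assumes "is_product C As P pr" "B \<in> Obj C" "\<And>i. i < length As \<Longrightarrow> f i \<in> hom C B (As ! i)"
  shows "\<exists>!u. u \<in> hom C B P \<and> (\<forall>i < length As. pr i \<cdot>\<^bsub>C\<^esub> u = f i)"
  using assms unfolding is_product_def by blast

lemma (in category) is_product_jointly_monic:
  assumes "is_product C As P pr" "set As \<subseteq> Obj C"
  shows "jointly_monic P {..<length As} pr"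
  unfolding jointly_monic_def
proof (intro allI impI)
  fix D v w
  assume v: "v \<in> hom C D P" and w: "w \<in> hom C D P"
    and eq: "\<forall>i \<in> {..<length As}. pr i \<cdot> v = pr i \<cdot> w"
  have D: "D \<in> Obj C" using v by (auto simp: in_hom_iff)
  have pr: "\<forall>i < length As. pr i \<in> hom C P (As ! i)"
    using assms(1) by (simp add: is_product_def)
  have "\<forall>i < length As. pr i \<cdot> v \<in> hom C D (As ! i)"
    using pr v by (blast intro: comp_hom)
  then have "\<exists>!u. u \<in> hom C D P \<and> (\<forall>i < length As. pr i \<cdot> u = pr i \<cdot> v)"
    using assms(1) D by (simp add: is_product_def)
  moreover have "\<forall>i < length As. pr i \<cdot> w = pr i \<cdot> v"
    using eq by simp
  ultimately show "v = w" using v w by blast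
qed

text \<open>\<open>is_fold_pullback\<close> with the leg to the base made explicit: for \<open>n = 0\<close> it is not determined by
  the projections, and it must be known to be a map of algebras.\<close>

definition fold_pullback_leg :: "('o, 'm, 'z) category_scheme \<Rightarrow> 'o \<Rightarrow> 'o \<Rightarrow> 'm \<Rightarrow> nat \<Rightarrow> 'o \<Rightarrow>
    (nat \<Rightarrow> 'm) \<Rightarrow> 'm \<Rightarrow> bool" where
  "fold_pullback_leg C E A p n P q b \<longleftrightarrow>
     p \<in> hom C E A \<and> P \<in> Obj C \<and> b \<in> hom C P A \<and>
     (\<forall>j < n. q j \<in> hom C P E \<and> p \<cdot>\<^bsub>C\<^esub> q j = b) \<and>
     (\<forall>B \<in> Obj C. \<forall>g \<in> hom C B A. \<forall>f.
        (\<forall>j < n. f j \<in> hom C B E \<and> p \<cdot>\<^bsub>C\<^esub> f j = g) \<longrightarrow>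
        (\<exists>!u. u \<in> hom C B P \<and> b \<cdot>\<^bsub>C\<^esub> u = g \<and> (\<forall>j < n. q j \<cdot>\<^bsub>C\<^esub> u = f j)))"

lemma is_fold_pullback_iff_leg: "is_fold_pullback C E A p n P q \<longleftrightarrow> (\<exists>b. fold_pullback_leg C E A p n P q b)"
  unfolding is_fold_pullback_def fold_pullback_leg_def by blast

lemma fold_pullback_leg_ex1:
  assumes "fold_pullback_leg C E A p n P q b" "B \<in> Obj C" "g \<in> hom C B A"
    "\<And>j. j < n \<Longrightarrow> f j \<in> hom C B E" "\<And>j. j < n \<Longrightarrow> p \<cdot>\<^bsub>C\<^esub> f j = g"
  shows "\<exists>!u. u \<in> hom C B P \<and> b \<cdot>\<^bsub>C\<^esub> u = g \<and> (\<forall>j < n. q j \<cdot>\<^bsub>C\<^esub> u = f j)"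
proof -
  have "\<forall>j < n. f j \<in> hom C B E \<and> p \<cdot>\<^bsub>C\<^esub> f j = g"
    using assms(4,5) by simp
  from assms(1)[unfolded fold_pullback_leg_def, THEN conjunct2, THEN conjunct2, THEN conjunct2,
    THEN conjunct2, THEN bspec, OF assms(2), THEN bspec, OF assms(3), THEN spec, THEN mp, OF this]
  show ?thesis .
qed

lemma (in category) fold_pullback_leg_eqI:
  assumes "fold_pullback_leg C E A p n P q b" "v \<in> hom C D P" "w \<in> hom C D P"
    "b \<cdot> v = b \<cdot> w" "\<And>j. j < n \<Longrightarrow> q j \<cdot> v = q j \<cdot> w"
  shows "v = w"
proof -
  have D: "D \<in> Obj C" using assms(2) by (auto simp: in_hom_iff)
  have b: "p \<in> hom C E A" "b \<in> hom C P A" and q: "\<And>j. j < n \<Longrightarrow> q j \<in> hom C P E \<and> p \<cdot> q j = b"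
    using assms(1) by (simp_all add: fold_pullback_leg_def)
  have "b \<cdot> v \<in> hom C D A" using b assms(2) by (blast intro: comp_hom)
  moreover have "\<forall>j < n. q j \<cdot> v \<in> hom C D E \<and> p \<cdot> (q j \<cdot> v) = b \<cdot> v"
  proof (intro allI impI conjI)
    fix j assume "j < n"
    then have qj: "q j \<in> hom C P E" "p \<cdot> q j = b" using q by auto
    show "q j \<cdot> v \<in> hom C D E" using qj assms(2) by (blast intro: comp_hom)
    show "p \<cdot> (q j \<cdot> v) = b \<cdot> v" using comp_assoc[OF assms(2) qj(1) b(1)] qj(2) by simp
  qed
  ultimately have "\<exists>!u. u \<in> hom C D P \<and> b \<cdot> u = b \<cdot> v \<and> (\<forall>j < n. q j \<cdot> u = q j \<cdot> v)"
    using assms(1) D by (simp add: fold_pullback_leg_def)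
  moreover have "\<forall>j < n. q j \<cdot> w = q j \<cdot> v"
    using assms(5) by simp
  ultimately show "v = w" using assms(2-4) by metis
qed

lemma (in category) fold_pullback_leg_jointly_monic:
  assumes "fold_pullback_leg C E A p n P q b"
  shows "jointly_monic P (insert None (Some ` {..<n})) (case_option b q)"
  unfolding jointly_monic_def using fold_pullback_leg_eqI[OF assms] by auto

text \<open>With at least one projection the base leg is \<open>p \<cdot> q 0\<close> and is
  therefore detected by the projections. This fits \<open>tan_pair\<close>, whose description
  mentions only the two projections.\<close>

lemma (in category) fold_pullback_jointly_monic:
  assumes "fold_pullback_leg C E A p n P q b" "0 < n"
  shows "jointly_monic P {..<n} q"
  unfolding jointly_monic_def
proof (intro allI impI)
  fix D v w assume v: "v \<in> hom C D P" and w: "w \<in> hom C D P"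
    and qvw: "\<forall>j \<in> {..<n}. q j \<cdot> v = q j \<cdot> w"
  have p: "p \<in> hom C E A" and q: "q 0 \<in> hom C P E" "p \<cdot> q 0 = b"
    using assms by (simp_all add: fold_pullback_leg_def)
  have "b \<cdot> v = b \<cdot> w"
    using comp_assoc[OF v q(1) p] comp_assoc[OF w q(1) p] qvw assms(2) q(2) by simp
  then show "v = w"
    using fold_pullback_leg_eqI[OF assms(1) v w] qvw by simp
qed

context monad
begin

abbreviation Alg where "Alg \<equiv> ALG X S \<mu> \<eta>"

abbreviation algs where "algs \<equiv> algebras X S \<mu> \<eta>"

section \<open>Algebras and their homomorphisms\<close>

lemma mu_simps [simp]:
  assumes "A \<in> Obj X"
  shows "\<mu> A \<in> Arr X" "Dom X (\<mu> A) = FObj S (FObj S A)" "Cod X (\<mu> A) = FObj S A"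
  using mu_natural assms by (simp_all add: natural_def in_hom_iff comp_functor_def)

lemma eta_simps [simp]:
  assumes "A \<in> Obj X"
  shows "\<eta> A \<in> Arr X" "Dom X (\<eta> A) = A" "Cod X (\<eta> A) = FObj S A"
  using eta_natural assms by (simp_all add: natural_def in_hom_iff id_functor_def)

lemma mu_nat:
  assumes "f \<in> Arr X" "Cod X f = B"
  shows "\<mu> B \<cdot> FMap S (FMap S f) = FMap S f \<cdot> \<mu> (Dom X f)"
  using mu_natural assms obj_simps[of f] by (simp add: natural_def in_hom_iff comp_functor_def)

lemma eta_nat:
  assumes "f \<in> Arr X" "Cod X f = B"
  shows "\<eta> B \<cdot> f = FMap S f \<cdot> \<eta> (Dom X f)"
  using eta_natural assms obj_simps[of f] by (simp add: natural_def in_hom_iff id_functor_def)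

lemma algs_iff: "P \<in> algs \<longleftrightarrow> fst P \<in> Obj X \<and> snd P \<in> Arr X \<and> Dom X (snd P) = FObj S (fst P) \<and>
    Cod X (snd P) = fst P \<and> snd P \<cdot> \<eta> (fst P) = Ide X (fst P) \<and>
    snd P \<cdot> \<mu> (fst P) = snd P \<cdot> FMap S (snd P)"
  by (cases P) (auto simp: algebras_def in_hom_iff)

lemma algs_simps [simp]:
  assumes "P \<in> algs"
  shows "fst P \<in> Obj X" "snd P \<in> Arr X" "Dom X (snd P) = FObj S (fst P)" "Cod X (snd P) = fst P"
  using assms unfolding algs_iff by blast+

lemma set_fst_algs:
  assumes "set As \<subseteq> algs"
  shows "set (map fst As) \<subseteq> Obj X"
  unfolding set_map using assms by (blast intro: algs_simps(1))

lemma algs_unit: "P \<in> algs \<Longrightarrow> snd P \<cdot> \<eta> (fst P) = Ide X (fst P)"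
  and algs_mult: "P \<in> algs \<Longrightarrow> snd P \<cdot> \<mu> (fst P) = snd P \<cdot> FMap S (snd P)"
  unfolding algs_iff by blast+

text \<open>Speaks of the bare map in \<open>X\<close> instead of the tagged triple, so that
  homomorphism properties are equations of \<open>X\<close>; \<open>hom_Alg\<close> translates
  back.\<close>

definition alg_hom :: "'o \<times> 'm \<Rightarrow> 'o \<times> 'm \<Rightarrow> 'm \<Rightarrow> bool" where
  "alg_hom P Q f \<longleftrightarrow> P \<in> algs \<and> Q \<in> algs \<and> f \<in> Arr X \<and> Dom X f = fst P \<and> Cod X f = fst Q \<and>
     f \<cdot> snd P = snd Q \<cdot> FMap S f"

lemma alg_homD:
  assumes "alg_hom P Q f"
  shows "P \<in> algs" "Q \<in> algs" "f \<in> Arr X" "Dom X f = fst P" "Cod X f = fst Q"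
    "f \<cdot> snd P = snd Q \<cdot> FMap S f"
  using assms by (simp_all add: alg_hom_def)

lemma alg_hom_comp:
  assumes "alg_hom P Q f" "alg_hom Q R g"
  shows "alg_hom P R (g \<cdot> f)"
proof -
  note f = alg_homD[OF assms(1)] and g = alg_homD[OF assms(2)]
  have "(g \<cdot> f) \<cdot> snd P = (g \<cdot> snd Q) \<cdot> FMap S f"
    using f g(1-5) by simp
  also have "\<dots> = snd R \<cdot> FMap S (g \<cdot> f)"
    unfolding g(6) using f g(1-5) by (simp add: functor_comp)
  finally show ?thesis
    using f g by (simp add: alg_hom_def)
qed

lemma alg_hom_ide: "P \<in> algs \<Longrightarrow> alg_hom P P (Ide X (fst P))"
  by (simp add: alg_hom_def)

lemma Alg_simps [simp]:
  "Obj Alg = algs"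
  "Dom Alg (P, Q, f) = P" "Cod Alg (P, Q, f) = Q"
  "Ide Alg P = (P, P, Ide X (fst P))"
  "(Q', R, g) \<cdot>\<^bsub>Alg\<^esub> (P, Q, f) = (P, R, g \<cdot> f)"
  by (simp_all add: ALG_def split: prod.split)

lemma hom_Alg: "x \<in> hom Alg P Q \<longleftrightarrow> (\<exists>f. x = (P, Q, f) \<and> alg_hom P Q f)"
  by (cases x; cases P; cases Q) (auto simp: alg_hom_def in_hom_iff ALG_def)

lemma hom_Alg_triple [simp]: "(P', Q', f) \<in> hom Alg P Q \<longleftrightarrow> P' = P \<and> Q' = Q \<and> alg_hom P Q f"
  by (auto simp: hom_Alg)

lemma category_Alg: "category Alg"
proof
  fix f assume "f \<in> Arr Alg"
  then have "f \<in> hom Alg (Dom Alg f) (Cod Alg f)" by (simp add: in_hom_iff)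
  then show "Dom Alg f \<in> Obj Alg" "Cod Alg f \<in> Obj Alg"
    by (auto simp: hom_Alg alg_hom_def)
qed (auto simp: hom_Alg alg_hom_ide alg_hom_comp, auto simp: alg_hom_def)

text \<open>After each leg \<open>g i\<close>, naturality of \<open>\<eta>\<close> or
  \<open>\<mu>\<close> turns the desired law for \<open>\<rho>\<close> into the corresponding law of
  \<open>Q i\<close>; joint monicity cancels the legs. It supplies the algebra structures on fold
  pullbacks and products.\<close>

lemma algebra_lift:
  assumes mono: "jointly_monic A I g" and A: "A \<in> Obj X"
    and rho: "\<rho> \<in> Arr X" "Dom X \<rho> = FObj S A" "Cod X \<rho> = A"
    and g: "\<And>i. i \<in> I \<Longrightarrow> Q i \<in> algs" "\<And>i. i \<in> I \<Longrightarrow> g i \<in> Arr X" "\<And>i. i \<in> I \<Longrightarrow> Dom X (g i) = A"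
      "\<And>i. i \<in> I \<Longrightarrow> Cod X (g i) = fst (Q i)"
    and hom: "\<And>i. i \<in> I \<Longrightarrow> g i \<cdot> \<rho> = snd (Q i) \<cdot> FMap S (g i)"
  shows "(A, \<rho>) \<in> algs"
proof -
  have mono': "v = w" if "v \<in> Arr X" "w \<in> Arr X" "Cod X v = A" "Cod X w = A" "Dom X v = Dom X w"
    "\<And>i. i \<in> I \<Longrightarrow> g i \<cdot> v = g i \<cdot> w" for v w
    using mono that unfolding jointly_monic_def in_hom_iff by blast
  have "\<rho> \<cdot> \<eta> A = Ide X A"
  proof (rule mono')
    fix i assume i: "i \<in> I"
    note Q = g[OF i]
    have "g i \<cdot> (\<rho> \<cdot> \<eta> A) = (g i \<cdot> \<rho>) \<cdot> \<eta> A"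
      using rho Q A by simp
    also have "\<dots> = snd (Q i) \<cdot> (FMap S (g i) \<cdot> \<eta> A)"
      unfolding hom[OF i] using rho Q A by simp
    also have "\<dots> = (snd (Q i) \<cdot> \<eta> (fst (Q i))) \<cdot> g i"
      using Q A eta_nat[of "g i" "fst (Q i)"] by simp
    also have "\<dots> = g i \<cdot> Ide X A"
      using Q by (simp add: algs_unit)
    finally show "g i \<cdot> (\<rho> \<cdot> \<eta> A) = g i \<cdot> Ide X A" .
  qed (use rho A in simp_all)
  moreover have "\<rho> \<cdot> \<mu> A = \<rho> \<cdot> FMap S \<rho>"
  proof (rule mono')
    fix i assume i: "i \<in> I"
    note Q = g[OF i]
    have "g i \<cdot> (\<rho> \<cdot> \<mu> A) = (g i \<cdot> \<rho>) \<cdot> \<mu> A"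
      using rho Q A by simp
    also have "\<dots> = snd (Q i) \<cdot> (FMap S (g i) \<cdot> \<mu> A)"
      unfolding hom[OF i] using rho Q A by simp
    also have "\<dots> = (snd (Q i) \<cdot> \<mu> (fst (Q i))) \<cdot> FMap S (FMap S (g i))"
      using Q A mu_nat[of "g i" "fst (Q i)"] by simp
    also have "\<dots> = snd (Q i) \<cdot> FMap S (g i \<cdot> \<rho>)"
      unfolding hom[OF i] using Q by (simp add: algs_mult functor_comp)
    also have "\<dots> = (snd (Q i) \<cdot> FMap S (g i)) \<cdot> FMap S \<rho>"
      using Q rho A functor_comp[of \<rho> "g i"] by simp
    also have "\<dots> = (g i \<cdot> \<rho>) \<cdot> FMap S \<rho>"
      unfolding hom[OF i] ..
    finally show "g i \<cdot> (\<rho> \<cdot> \<mu> A) = g i \<cdot> (\<rho> \<cdot> FMap S \<rho>)"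
      using Q rho A by simp
  qed (use rho A in simp_all)
  ultimately show ?thesis
    using A rho by (simp add: algs_iff)
qed

text \<open>Both sides of the homomorphism equation of \<open>u\<close> agree after every leg. Hence
  a mediating map found in \<open>X\<close> is automatically a map of algebras.\<close>

lemma alg_hom_lift:
  assumes mono: "jointly_monic (fst P) I g" and P: "P \<in> algs" and B: "B \<in> algs"
    and g: "\<And>i. i \<in> I \<Longrightarrow> alg_hom P (Q i) (g i)"
    and u: "u \<in> hom X (fst B) (fst P)" and gu: "\<And>i. i \<in> I \<Longrightarrow> alg_hom B (Q i) (g i \<cdot> u)"
  shows "alg_hom B P u"
proof -
  have u': "u \<in> Arr X" "Dom X u = fst B" "Cod X u = fst P"
    using u by (simp_all add: in_hom_iff)
  have eq: "g i \<cdot> (u \<cdot> snd B) = g i \<cdot> (snd P \<cdot> FMap S u)" if "i \<in> I" for i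
  proof -
    note gi = alg_homD[OF g[OF that]]
    have "g i \<cdot> (u \<cdot> snd B) = (g i \<cdot> u) \<cdot> snd B"
      using u' gi(1-5) B by simp
    also have "\<dots> = snd (Q i) \<cdot> FMap S (g i \<cdot> u)"
      using alg_homD(6)[OF gu[OF that]] .
    also have "\<dots> = (g i \<cdot> snd P) \<cdot> FMap S u"
      unfolding gi(6) using u' gi(1-5) by (simp add: functor_comp)
    finally show ?thesis
      using u' gi(1-5) by simp
  qed
  have "u \<cdot> snd B \<in> hom X (FObj S (fst B)) (fst P)" "snd P \<cdot> FMap S u \<in> hom X (FObj S (fst B)) (fst P)"
    using u' B P by (simp_all add: in_hom_iff)
  then have "u \<cdot> snd B = snd P \<cdot> FMap S u"
    using mono eq unfolding jointly_monic_def by blast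
  then show ?thesis
    using P B u' by (simp add: alg_hom_def)
qed

section \<open>Reflection of limits along the forgetful functor\<close>

definition und :: "('o, 'm) alg_map \<Rightarrow> 'm" where
  "und x = snd (snd x)"

lemma und_triple [simp]: "und (P, Q, f) = f"
  by (simp add: und_def)

lemma hom_AlgD:
  assumes "x \<in> hom Alg P Q"
  shows "alg_hom P Q (und x)" "x = (P, Q, und x)" "und x \<in> hom X (fst P) (fst Q)"
proof -
  show x: "alg_hom P Q (und x)" "x = (P, Q, und x)"
    using assms by (auto simp: hom_Alg)
  show "und x \<in> hom X (fst P) (fst Q)"
    using x(1) by (simp add: alg_hom_def in_hom_iff)
qed

lemma und_comp:
  assumes "x \<in> hom Alg P Q" "y \<in> hom Alg Q R"
  shows "y \<cdot>\<^bsub>Alg\<^esub> x = (P, R, und y \<cdot> und x)"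
  using assms by (auto simp: hom_Alg)

lemma alg_hom_in_hom: "alg_hom P Q f \<Longrightarrow> f \<in> hom X (fst P) (fst Q)"
  by (simp add: alg_hom_def in_hom_iff)

lemma product_reflected:
  assumes As: "set As \<subseteq> algs" and P: "P \<in> algs"
    and pr: "\<And>i. i < length As \<Longrightarrow> pr i \<in> hom Alg P (As ! i)"
    and prod: "is_product X (map fst As) (fst P) (\<lambda>i. und (pr i))"
  shows "is_product Alg As P pr"
  unfolding is_product_def
proof (intro conjI ballI allI impI)
  fix B f assume B: "B \<in> Obj Alg" and f: "\<forall>i < length As. f i \<in> hom Alg B (As ! i)"
  note objs = set_fst_algs[OF As]
  note mono = is_product_jointly_monic[OF prod objs]
  have "und (f i) \<in> hom X (fst B) (map fst As ! i)" if "i < length (map fst As)" for i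
    using f hom_AlgD(3) that by simp
  from ex1_implies_ex[OF is_product_ex1[OF prod _ this]]
  obtain u where u: "u \<in> hom X (fst B) (fst P)" "\<And>i. i < length As \<Longrightarrow> und (pr i) \<cdot> u = und (f i)"
    using B by auto
  have "alg_hom B P u"
    by (rule alg_hom_lift[OF mono, where Q = "(!) As"]) (use P B pr f u hom_AlgD(1) in auto)
  show "\<exists>!u. u \<in> hom Alg B P \<and> (\<forall>i < length As. pr i \<cdot>\<^bsub>Alg\<^esub> u = f i)"
  proof (rule ex1I[of _ "(B, P, u)"])
    show "(B, P, u) \<in> hom Alg B P \<and> (\<forall>i < length As. pr i \<cdot>\<^bsub>Alg\<^esub> (B, P, u) = f i)"
    proof (intro conjI allI impI)
      fix i assume i: "i < length As"
      have "pr i \<cdot>\<^bsub>Alg\<^esub> (B, P, u) = (B, As ! i, und (f i))"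
        using und_comp[OF _ pr[OF i], of "(B, P, u)" B] \<open>alg_hom B P u\<close> u(2)[OF i] by simp
      then show "pr i \<cdot>\<^bsub>Alg\<^esub> (B, P, u) = f i"
        using hom_AlgD(2) f i by metis
    qed (use \<open>alg_hom B P u\<close> in simp)
  next
    fix w assume w: "w \<in> hom Alg B P \<and> (\<forall>i < length As. pr i \<cdot>\<^bsub>Alg\<^esub> w = f i)"
    then obtain w' where w': "w = (B, P, w')" "alg_hom B P w'"
      by (auto simp: hom_Alg)
    have "und (pr i) \<cdot> w' = und (pr i) \<cdot> u" if "i < length As" for i
      using und_comp[OF _ pr[OF that], of w B] w w' u(2)[OF that] that
      by (metis und_triple)
    moreover have "w' \<in> hom X (fst B) (fst P)"
      using w' alg_hom_in_hom by simp
    ultimately have "w' = u"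
      using mono u(1) unfolding jointly_monic_def by (metis length_map lessThan_iff)
    then show "w = (B, P, u)" using w' by simp
  qed
qed (use P pr in auto)

lemma fold_pullback_reflected:
  assumes alg: "alg_hom P A b" "\<And>j. j < n \<Longrightarrow> q j \<in> hom Alg P E" "p \<in> hom Alg E A"
    and pb: "fold_pullback_leg X (fst E) (fst A) (und p) n (fst P) (\<lambda>j. und (q j)) b"
  shows "fold_pullback_leg Alg E A p n P q (P, A, b)"
proof -
  obtain p' where p: "p = (E, A, p')" "alg_hom E A p'"
    using alg by (auto simp: hom_Alg)
  obtain q' where q: "\<And>j. j < n \<Longrightarrow> q j = (P, E, q' j)" "\<And>j. j < n \<Longrightarrow> alg_hom P E (q' j)"
    using alg(2) unfolding hom_Alg by metis
  \<comment> \<open>The base leg is adjoined under the index \<open>None\<close>, because for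
    \<open>n = 0\<close> it is the only leg that can detect anything.\<close>
  define leg where "leg = case_option b q'"
  define I where "I = insert None (Some ` {..<n})"
  have pq: "p' \<cdot> q' j = b" if "j < n" for j
    using pb q that p by (simp add: fold_pullback_leg_def)
  have mono: "jointly_monic (fst P) I leg"
  proof -
    have "\<And>i. i \<in> I \<Longrightarrow> leg i = case_option b (\<lambda>j. und (q j)) i"
      unfolding I_def leg_def using q(1) by auto
    then show ?thesis
      using fold_pullback_leg_jointly_monic[OF pb] unfolding jointly_monic_def I_def by simp
  qed
  have P: "P \<in> algs" using alg(1) by (simp add: alg_hom_def)
  have main: "\<exists>!u. u \<in> hom Alg B P \<and> (P, A, b) \<cdot>\<^bsub>Alg\<^esub> u = g \<and> (\<forall>j < n. q j \<cdot>\<^bsub>Alg\<^esub> u = f j)"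
    if B: "B \<in> algs" and g: "g \<in> hom Alg B A"
      and f: "\<forall>j < n. f j \<in> hom Alg B E \<and> p \<cdot>\<^bsub>Alg\<^esub> f j = g" for B g f
  proof -
    obtain g' where g': "g = (B, A, g')" "alg_hom B A g'"
      using g by (auto simp: hom_Alg)
    obtain f' where f': "\<And>j. j < n \<Longrightarrow> f j = (B, E, f' j)" "\<And>j. j < n \<Longrightarrow> alg_hom B E (f' j)"
      using f unfolding hom_Alg by metis
    have "\<forall>j < n. f' j \<in> hom X (fst B) (fst E) \<and> p' \<cdot> f' j = g'"
      using f f' g' p by (fastforce simp: in_hom_iff alg_hom_def)
    moreover have "fst B \<in> Obj X" "g' \<in> hom X (fst B) (fst A)"
      using B g' by (simp_all add: in_hom_iff alg_hom_def)
    ultimately have "\<exists>!u. u \<in> hom X (fst B) (fst P) \<and> b \<cdot> u = g' \<and> (\<forall>j < n. und (q j) \<cdot> u = f' j)"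
      using pb p unfolding fold_pullback_leg_def by simp
    then obtain u where u: "u \<in> hom X (fst B) (fst P)" "b \<cdot> u = g'" "\<And>j. j < n \<Longrightarrow> q' j \<cdot> u = f' j"
      using q(1) by auto
    have "alg_hom B P u"
      by (rule alg_hom_lift[OF mono P B, where Q = "case_option A (\<lambda>_. E)"])
        (use alg q u g' f' in \<open>auto simp: I_def leg_def\<close>)
    show ?thesis
    proof (rule ex1I[of _ "(B, P, u)"])
      show "(B, P, u) \<in> hom Alg B P \<and> (P, A, b) \<cdot>\<^bsub>Alg\<^esub> (B, P, u) = g \<and> (\<forall>j < n. q j \<cdot>\<^bsub>Alg\<^esub> (B, P, u) = f j)"
        using \<open>alg_hom B P u\<close> u g' f' q by simp
    next
      fix w assume w: "w \<in> hom Alg B P \<and> (P, A, b) \<cdot>\<^bsub>Alg\<^esub> w = g \<and> (\<forall>j < n. q j \<cdot>\<^bsub>Alg\<^esub> w = f j)"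
      then obtain w' where w': "w = (B, P, w')" "alg_hom B P w'"
        by (auto simp: hom_Alg)
      have "w' = u"
      proof (rule fold_pullback_leg_eqI[OF pb _ u(1)])
        show "w' \<in> hom X (fst B) (fst P)" "b \<cdot> w' = b \<cdot> u"
          using w w' u g' by (simp_all add: in_hom_iff alg_hom_def)
      next
        fix j assume "j < n"
        then show "und (q j) \<cdot> w' = und (q j) \<cdot> u"
          using w w' u(3) f' q by simp
      qed
      then show "w = (B, P, u)" using w' by simp
    qed
  qed
  have "\<forall>j < n. q j \<in> hom Alg P E \<and> p \<cdot>\<^bsub>Alg\<^esub> q j = (P, A, b)"
    using alg q pq p by simp
  then show ?thesis
    unfolding fold_pullback_leg_def using alg p P main by simp
qed

lemma equalizer_reflected:
  assumes alg: "e \<in> hom Alg E A" "f \<in> hom Alg A B" "g \<in> hom Alg A B"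
    and eq: "is_equalizer X (fst E) (fst A) (fst B) (und e) (und f) (und g)"
  shows "is_equalizer Alg E A B e f g"
proof -
  obtain e' f' g' where efg: "e = (E, A, e')" "alg_hom E A e'" "f = (A, B, f')" "alg_hom A B f'"
    "g = (A, B, g')" "alg_hom A B g'"
    using alg by (auto simp: hom_Alg)
  have fe: "f' \<cdot> e' = g' \<cdot> e'" and E: "E \<in> algs"
    using eq efg by (simp_all add: is_equalizer_def alg_hom_def)
  have uniq: "\<exists>!u. u \<in> hom X D (fst E) \<and> e' \<cdot> u = h"
    if "D \<in> Obj X" "h \<in> hom X D (fst A)" "f' \<cdot> h = g' \<cdot> h" for D h
    using eq that efg by (simp add: is_equalizer_def)
  \<comment> \<open>An equalizer map is monic, so it serves as a one-element family of legs for
    \<open>alg_hom_lift\<close>.\<close>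
  have mono: "jointly_monic (fst E) {()} (\<lambda>_. e')"
    unfolding jointly_monic_def
  proof (intro allI impI)
    fix D v w assume v: "v \<in> hom X D (fst E)" and w: "w \<in> hom X D (fst E)"
      and vw: "\<forall>i \<in> {()}. e' \<cdot> v = e' \<cdot> w"
    have "D \<in> Obj X" "e' \<cdot> v \<in> hom X D (fst A)"
      using v efg by (auto simp: in_hom_iff alg_hom_def)
    moreover have "f' \<cdot> (e' \<cdot> v) = g' \<cdot> (e' \<cdot> v)"
    proof -
      have "(f' \<cdot> e') \<cdot> v = (g' \<cdot> e') \<cdot> v" using fe by simp
      then show ?thesis using v efg by (simp add: in_hom_iff alg_hom_def)
    qed
    ultimately have "\<exists>!u. u \<in> hom X D (fst E) \<and> e' \<cdot> u = e' \<cdot> v"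
      by (rule uniq)
    moreover have "e' \<cdot> w = e' \<cdot> v" using vw by simp
    ultimately show "v = w" using v w by blast
  qed
  have main: "\<exists>!u. u \<in> hom Alg D E \<and> e \<cdot>\<^bsub>Alg\<^esub> u = h"
    if D: "D \<in> algs" and h: "h \<in> hom Alg D A" and fh: "f \<cdot>\<^bsub>Alg\<^esub> h = g \<cdot>\<^bsub>Alg\<^esub> h" for D h
  proof -
    obtain h' where h': "h = (D, A, h')" "alg_hom D A h'"
      using h by (auto simp: hom_Alg)
    have hh: "h' \<in> hom X (fst D) (fst A)" "f' \<cdot> h' = g' \<cdot> h'"
      using h' fh efg by (simp_all add: in_hom_iff alg_hom_def)
    then obtain u where u: "u \<in> hom X (fst D) (fst E)" "e' \<cdot> u = h'"
      using uniq D by (metis algs_simps(1))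
    have "alg_hom D E u"
      by (rule alg_hom_lift[OF mono E D, where Q = "\<lambda>_. A"]) (use efg u h' in auto)
    show ?thesis
    proof (rule ex1I[of _ "(D, E, u)"])
      show "(D, E, u) \<in> hom Alg D E \<and> e \<cdot>\<^bsub>Alg\<^esub> (D, E, u) = h"
        using \<open>alg_hom D E u\<close> u h' efg by simp
    next
      fix w assume w: "w \<in> hom Alg D E \<and> e \<cdot>\<^bsub>Alg\<^esub> w = h"
      then obtain w' where w': "w = (D, E, w')" "alg_hom D E w'"
        by (auto simp: hom_Alg)
      then have "w' \<in> hom X (fst D) (fst E) \<and> e' \<cdot> w' = h'"
        using w efg h' by (simp add: in_hom_iff alg_hom_def)
      then have "w' = u"
        using uniq[OF algs_simps(1)[OF D] hh] u by blast
      then show "w = (D, E, u)" using w' by simp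
    qed
  qed
  show ?thesis
    unfolding is_equalizer_def using alg fe main efg by auto
qed

end

section \<open>Differentiating the structure map of an algebra\<close>

context cocartesian_differential_monad
begin

lemma delta_simps [simp]:
  assumes "A \<in> Obj X"
  shows "\<delta> A \<in> Arr X" "Dom X (\<delta> A) = FObj S A" "Cod X (\<delta> A) = FObj S (Bip X [A, A])"
  using delta_natural assms by (simp_all add: natural_def in_hom_iff comp_functor_def)

lemma delta_nat:
  assumes "f \<in> Arr X" "Cod X f = B"
  shows "\<delta> B \<cdot> FMap S f = FMap S (FMap (square X) f) \<cdot> \<delta> (Dom X f)"
  using delta_natural assms obj_simps[of f] by (simp add: natural_def in_hom_iff comp_functor_def)

text \<open>\<open>deriv P a b\<close> is \<open>D\<alpha>(a, b) = D\<alpha> \<circ> S\<langle>a, b\<rangle>\<close>, where \<open>D\<alpha>\<close> is \<open>alg_diff\<close>.\<close>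

definition deriv :: "'o \<times> 'm \<Rightarrow> 'm \<Rightarrow> 'm \<Rightarrow> 'm" where
  "deriv P a b = snd P \<cdot> (FMap S (a \<cdot> Pr X [Dom X b, Dom X b] 0 \<oplus> b \<cdot> Pr X [Dom X b, Dom X b] (Suc 0))
     \<cdot> \<delta> (Dom X b))"

lemma deriv_simps [simp]:
  assumes "P \<in> algs" "a \<in> Arr X" "b \<in> Arr X" "Dom X a = Dom X b" "Cod X a = fst P" "Cod X b = fst P"
  shows "deriv P a b \<in> Arr X" "Dom X (deriv P a b) = FObj S (Dom X b)" "Cod X (deriv P a b) = fst P"
  using assms by (simp_all add: deriv_def)

text \<open>Naturality of \<open>\<delta>\<close> at \<open>h\<close> replaces \<open>h\<close> by
  its square, which composes with each of the two summands separately.\<close>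

lemma deriv_comp:
  assumes "P \<in> algs" "a \<in> Arr X" "b \<in> Arr X" "Dom X a = Dom X b" "Cod X a = fst P" "Cod X b = fst P"
    "h \<in> Arr X" "Cod X h = Dom X b"
  shows "deriv P a b \<cdot> FMap S h = deriv P (a \<cdot> h) (b \<cdot> h)"
  using assms by (simp add: deriv_def delta_nat functor_comp_assoc FMap_square)

lemma alg_hom_deriv:
  assumes f: "alg_hom P Q f"
    and ab: "a \<in> Arr X" "b \<in> Arr X" "Dom X a = Dom X b" "Cod X a = fst P" "Cod X b = fst P"
  shows "f \<cdot> deriv P a b = deriv Q (f \<cdot> a) (f \<cdot> b)"
proof -
  note f' = alg_homD[OF f]
  let ?w = "a \<cdot> Pr X [Dom X b, Dom X b] 0 \<oplus> b \<cdot> Pr X [Dom X b, Dom X b] (Suc 0)"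
  have "f \<cdot> deriv P a b = (f \<cdot> snd P) \<cdot> (FMap S ?w \<cdot> \<delta> (Dom X b))"
    using f'(1-5) ab by (simp add: deriv_def)
  also have "\<dots> = snd Q \<cdot> (FMap S (f \<cdot> ?w) \<cdot> \<delta> (Dom X b))"
    unfolding f'(6) using f'(1-5) ab by (simp add: functor_comp_assoc del: comp_plus)
  finally show ?thesis
    using f'(1-5) ab by (simp add: deriv_def)
qed

text \<open>With zero direction only the first projection remains inside \<open>S\<close>, and
  [DC.1] annihilates it.\<close>

lemma deriv_zero:
  assumes P: "P \<in> algs" and a: "a \<in> Arr X" "Dom X a = D" "Cod X a = fst P"
  shows "deriv P a (zero_map X D (fst P)) = zero_map X (FObj S D) (fst P)"
proof -
  have D: "D \<in> Obj X" using a by auto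
  have "deriv P a (zero_map X D (fst P)) = snd P \<cdot> (FMap S a \<cdot> (FMap S (Pr X [D, D] 0) \<cdot> \<delta> D))"
    using P a D by (simp add: deriv_def functor_comp_assoc)
  then show ?thesis
    using P a D by (simp add: DC1)
qed

lemma deriv_plus:
  assumes P: "P \<in> algs" and a: "a \<in> Arr X" "Dom X a = D" "Cod X a = fst P"
    and b: "b \<in> Arr X" "Dom X b = D" "Cod X b = fst P"
    and c: "c \<in> Arr X" "Dom X c = D" "Cod X c = fst P"
  shows "deriv P a (b \<oplus> c) = deriv P a b \<oplus> deriv P a c"
proof -
  have D: "D \<in> Obj X" using a by auto
  \<comment> \<open>The two directions are given independent variables. Repeating the second
    variable recovers the direction \<open>b \<oplus> c\<close>, while setting one of the two to
    zero leaves \<open>b\<close> or \<open>c\<close> alone; [DC.2] relates exactly these three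
    restrictions.\<close>
  let ?w = "a \<cdot> Pr X [D, D, D] 0 \<oplus> (b \<cdot> Pr X [D, D, D] (Suc 0) \<oplus> c \<cdot> Pr X [D, D, D] 2)"
  let ?l = "\<lambda>u v. FMap S (tup X [Pr X [D, D] 0, u, v]) \<cdot> \<delta> D"
  let ?p = "Pr X [D, D] 1" and ?z = "zero_map X (Bip X [D, D]) D"
  have "deriv P a (b \<oplus> c) = snd P \<cdot> (FMap S ?w \<cdot> ?l ?p ?p)"
    using P a b c D by (simp add: deriv_def functor_comp_assoc numeral_2_eq_2)
  also have "\<dots> = snd P \<cdot> (FMap S ?w \<cdot> (?l ?p ?z \<oplus> ?l ?z ?p))"
    using DC2[OF D] by simp
  also have "\<dots> = deriv P a b \<oplus> deriv P a c"
    using P a b c D by (simp add: deriv_def functor_comp_assoc numeral_2_eq_2)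
  finally show ?thesis .
qed

lemma alg_diff_eq:
  assumes "P \<in> algs"
  shows "alg_diff X S \<delta> P = deriv P (Pr X [fst P, fst P] 0) (Pr X [fst P, fst P] (Suc 0))"
  using assms by (cases P) (simp add: alg_diff_def deriv_def pr4_def algebras_def in_hom_iff)

text \<open>This is the second component of the multiplication law of \<open>T_obj P\<close>: the
  chain rule [DC.4], followed by naturality of \<open>\<mu>\<close> and the multiplication law of
  \<open>P\<close>.\<close>

lemma deriv_DC4:
  assumes P: "P \<in> algs"
  defines "B \<equiv> Bip X [fst P, fst P]"
  shows "alg_diff X S \<delta> P \<cdot> \<mu> B
    = deriv P (snd P \<cdot> FMap S (Pr X [fst P, fst P] 0)) (alg_diff X S \<delta> P)"
proof -
  have A: "fst P \<in> Obj X" and B: "B \<in> Obj X"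
    using P by (simp_all add: B_def)
  define w where "w = Pr X [fst P, fst P] 0 \<cdot> Pr X [B, B] 0 \<oplus> Pr X [fst P, fst P] (Suc 0) \<cdot> Pr X [B, B] (Suc 0)"
  define k where "k = FMap S (tup X [Ide X B, zero_map X B B]) \<cdot> Pr X [FObj S B, FObj S B] 0
                  \<oplus> \<delta> B \<cdot> Pr X [FObj S B, FObj S B] 1"
  have w: "w \<in> Arr X" "Dom X w = Bip X [B, B]" "Cod X w = fst P"
    and k: "k \<in> Arr X" "Dom X k = Bip X [FObj S B, FObj S B]" "Cod X k = FObj S (Bip X [B, B])"
    using A B by (simp_all add: w_def k_def, simp_all add: B_def)
  have diff: "alg_diff X S \<delta> P = snd P \<cdot> (FMap S w \<cdot> \<delta> B)"
    using P by (simp add: alg_diff_eq deriv_def w_def B_def)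
  have "w \<cdot> tup X [Ide X B, zero_map X B B] = Pr X [fst P, fst P] 0"
    using A B by (simp add: w_def, simp add: B_def)
  \<comment> \<open>On the first summand of \<open>k\<close>, the map \<open>w\<close> meets the
    inclusion \<open><1, 0>\<close> and leaves a projection; on the second it meets
    \<open>\<delta> B\<close> and gives \<open>alg_diff\<close>. So the two components of the
    structure map of \<open>T_obj P\<close> appear as point and direction.\<close>
  then have swk: "snd P \<cdot> (FMap S w \<cdot> k)
    = (snd P \<cdot> FMap S (Pr X [fst P, fst P] 0)) \<cdot> Pr X [FObj S B, FObj S B] 0
      \<oplus> alg_diff X S \<delta> P \<cdot> Pr X [FObj S B, FObj S B] (Suc 0)"
    using P A B w by (simp add: k_def diff functor_comp_assoc B_def[symmetric])
  have "alg_diff X S \<delta> P \<cdot> \<mu> B = snd P \<cdot> (FMap S w \<cdot> (\<delta> B \<cdot> \<mu> B))"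
    using P B w by (simp add: diff)
  also have "\<dots> = snd P \<cdot> ((FMap S w \<cdot> \<mu> (Bip X [B, B])) \<cdot> (FMap S k \<cdot> \<delta> (FObj S B)))"
    using P B w k DC4[OF B, folded k_def] by simp
  also have "\<dots> = (snd P \<cdot> \<mu> (fst P)) \<cdot> (FMap S (FMap S w) \<cdot> (FMap S k \<cdot> \<delta> (FObj S B)))"
    using P B w k mu_nat[of w "fst P", symmetric] by simp
  also have "\<dots> = snd P \<cdot> (FMap S (snd P \<cdot> (FMap S w \<cdot> k)) \<cdot> \<delta> (FObj S B))"
    using P B w k by (simp add: algs_mult functor_comp_assoc)
  also have "\<dots> = deriv P (snd P \<cdot> FMap S (Pr X [fst P, fst P] 0)) (alg_diff X S \<delta> P)"
    unfolding swk using P A B w by (simp add: deriv_def diff B_def[symmetric])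
  finally show ?thesis .
qed

text \<open>On generators [DC.3] inserts \<open><0, 1>\<close>, which kills the point
  \<open>a\<close> and keeps the direction \<open>b\<close>; naturality of \<open>\<eta>\<close> and
  the unit law of \<open>P\<close> then remove \<open>\<alpha>\<close>.\<close>

lemma deriv_eta:
  assumes "P \<in> algs" "a \<in> Arr X" "b \<in> Arr X" "Dom X a = Dom X b" "Cod X a = fst P" "Cod X b = fst P"
  shows "deriv P a b \<cdot> \<eta> (Dom X b) = b"
proof -
  let ?D = "Dom X b"
  let ?w = "a \<cdot> Pr X [?D, ?D] 0 \<oplus> b \<cdot> Pr X [?D, ?D] (Suc 0)"
  have w: "?w \<cdot> tup X [zero_map X ?D ?D, Ide X ?D] = b"
    using assms by simp
  have "deriv P a b \<cdot> \<eta> ?D = snd P \<cdot> ((FMap S ?w \<cdot> \<eta> (Bip X [?D, ?D])) \<cdot> tup X [zero_map X ?D ?D, Ide X ?D])"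
    using assms by (simp add: deriv_def DC3)
  also have "\<dots> = (snd P \<cdot> \<eta> (fst P)) \<cdot> (?w \<cdot> tup X [zero_map X ?D ?D, Ide X ?D])"
    using assms eta_nat[of ?w "fst P", symmetric] by (simp del: plus_comp comp_plus)
  also have "\<dots> = b"
    unfolding w using assms by (simp add: algs_unit)
  finally show ?thesis .
qed

subsection \<open>The tangent functor\<close>

abbreviation T_obj where "T_obj \<equiv> alg_T_obj X S \<delta>"

lemma T_obj_eq:
  assumes "P \<in> algs"
  shows "T_obj P = (Bip X [fst P, fst P],
    tup X [snd P \<cdot> FMap S (Pr X [fst P, fst P] 0), alg_diff X S \<delta> P])"
  by (cases P) (simp add: alg_T_obj_def)

lemma fst_T_obj [simp]: "P \<in> algs \<Longrightarrow> fst (T_obj P) = Bip X [fst P, fst P]"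
  by (simp add: T_obj_eq)

lemma T_obj_struct:
  assumes "P \<in> algs" "h \<in> Arr X" "Cod X h = Bip X [fst P, fst P]"
  shows "snd (T_obj P) \<cdot> FMap S h = tup X [snd P \<cdot> FMap S (Pr X [fst P, fst P] 0 \<cdot> h),
    deriv P (Pr X [fst P, fst P] 0 \<cdot> h) (Pr X [fst P, fst P] (Suc 0) \<cdot> h)]"
  using assms by (simp add: T_obj_eq alg_diff_eq deriv_comp functor_comp)

lemma T_obj_algs [simp]:
  assumes P: "P \<in> algs"
  shows "T_obj P \<in> algs"
proof -
  let ?A = "fst P" and ?t = "snd (T_obj P)"
  let ?B = "Bip X [?A, ?A]"
  have t: "?t = tup X [snd P \<cdot> FMap S (Pr X [?A, ?A] 0), deriv P (Pr X [?A, ?A] 0) (Pr X [?A, ?A] (Suc 0))]"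
    using P by (simp add: T_obj_eq alg_diff_eq)
  have t': "?t \<in> Arr X" "Dom X ?t = FObj S ?B" "Cod X ?t = ?B"
    "Pr X [?A, ?A] 0 \<cdot> ?t = snd P \<cdot> FMap S (Pr X [?A, ?A] 0)"
    "Pr X [?A, ?A] (Suc 0) \<cdot> ?t = alg_diff X S \<delta> P"
    using P unfolding t by (simp_all add: alg_diff_eq)
  have d: "alg_diff X S \<delta> P \<in> Arr X" "Dom X (alg_diff X S \<delta> P) = FObj S ?B" "Cod X (alg_diff X S \<delta> P) = ?A"
    using P by (simp_all add: alg_diff_eq)
  have 1: "?t \<cdot> \<eta> ?B = Ide X ?B"
  proof -
    have "(snd P \<cdot> FMap S (Pr X [?A, ?A] 0)) \<cdot> \<eta> ?B = (snd P \<cdot> \<eta> ?A) \<cdot> Pr X [?A, ?A] 0"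
      using P eta_nat[of "Pr X [?A, ?A] 0" ?A] by simp
    moreover have "deriv P (Pr X [?A, ?A] 0) (Pr X [?A, ?A] (Suc 0)) \<cdot> \<eta> ?B = Pr X [?A, ?A] (Suc 0)"
      using P deriv_eta[of P "Pr X [?A, ?A] 0" "Pr X [?A, ?A] (Suc 0)"] by simp
    ultimately show ?thesis
      using P by (simp add: t algs_unit)
  qed
  \<comment> \<open>The first component only involves the structure of \<open>P\<close> along a
    projection, so naturality of \<open>\<mu>\<close> and the law of \<open>P\<close> suffice. The
    second component is \<open>deriv_DC4\<close>.\<close>
  have "snd P \<cdot> (FMap S (Pr X [?A, ?A] 0) \<cdot> \<mu> ?B)
    = (snd P \<cdot> \<mu> ?A) \<cdot> FMap S (FMap S (Pr X [?A, ?A] 0))"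
    using P mu_nat[of "Pr X [?A, ?A] 0" ?A] by simp
  also have "\<dots> = snd P \<cdot> FMap S (snd P \<cdot> FMap S (Pr X [?A, ?A] 0))"
    using P by (simp add: algs_mult functor_comp)
  finally have 2: "?t \<cdot> \<mu> ?B = tup X [snd P \<cdot> FMap S (Pr X [?A, ?A] 0 \<cdot> ?t), alg_diff X S \<delta> P \<cdot> \<mu> ?B]"
    using P d t'(4) by (simp add: T_obj_eq)
  have 3: "?t \<cdot> FMap S ?t = tup X [snd P \<cdot> FMap S (Pr X [?A, ?A] 0 \<cdot> ?t),
    deriv P (Pr X [?A, ?A] 0 \<cdot> ?t) (Pr X [?A, ?A] (Suc 0) \<cdot> ?t)]"
    using P t' by (intro T_obj_struct)
  have 4: "?t \<cdot> \<mu> ?B = ?t \<cdot> FMap S ?t"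
    unfolding 2 3 t' using deriv_DC4[OF P] by simp
  show ?thesis
    unfolding algs_iff using P t' 1 4 by simp
qed

text \<open>Since \<open>T_obj_struct\<close> evaluates the target structure on \<open>S f\<close>,
  a homomorphism into \<open>T_obj Q\<close> can be recognised from an equation between explicit
  pairs, one entry for the point and one for the derivative.\<close>

lemma alg_hom_TI:
  assumes "P \<in> algs" "Q \<in> algs" "f \<in> Arr X" "Dom X f = fst P" "Cod X f = Bip X [fst Q, fst Q]"
    "f \<cdot> snd P = tup X [snd Q \<cdot> FMap S (Pr X [fst Q, fst Q] 0 \<cdot> f),
      deriv Q (Pr X [fst Q, fst Q] 0 \<cdot> f) (Pr X [fst Q, fst Q] (Suc 0) \<cdot> f)]"
  shows "alg_hom P (T_obj Q) f"
  using assms by (simp add: alg_hom_def T_obj_struct)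

lemma T_obj_snd:
  assumes "P \<in> algs"
  shows "snd (T_obj P) = tup X [snd P \<cdot> FMap S (Pr X [fst P, fst P] 0),
    deriv P (Pr X [fst P, fst P] 0) (Pr X [fst P, fst P] (Suc 0))]"
  using assms by (simp add: T_obj_eq alg_diff_eq)

lemma alg_hom_square:
  assumes f: "alg_hom P Q f"
  shows "alg_hom (T_obj P) (T_obj Q) (FMap (square X) f)"
proof -
  note f' = alg_homD[OF f]
  have "f \<cdot> (snd P \<cdot> FMap S (Pr X [fst P, fst P] 0)) = (f \<cdot> snd P) \<cdot> FMap S (Pr X [fst P, fst P] 0)"
    using f'(1-5) by simp
  also have "\<dots> = snd Q \<cdot> FMap S (f \<cdot> Pr X [fst P, fst P] 0)"
    unfolding f'(6) using f'(1-5) by (simp add: functor_comp)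
  finally show ?thesis
    using f'(1-5)
    by (intro alg_hom_TI) (simp_all add: FMap_square T_obj_snd alg_hom_deriv[OF f])
qed

lemma alg_hom_p: "P \<in> algs \<Longrightarrow> alg_hom (T_obj P) P (Pr X [fst P, fst P] 0)"
  by (simp add: alg_hom_def T_obj_snd)

lemma alg_hom_z:
  assumes "P \<in> algs"
  shows "alg_hom P (T_obj P) (tup X [Ide X (fst P), zero_map X (fst P) (fst P)])"
  using assms by (intro alg_hom_TI) (simp_all add: deriv_zero)

subsection \<open>Second derivatives\<close>

text \<open>This differentiates \<open>D\<alpha>\<close> at the point \<open><a, c>\<close> in the
  direction \<open><b, d>\<close>: \<open>a\<close> is the base point, \<open>b\<close> and
  \<open>c\<close> are the first-order directions, and \<open>d\<close> is the second-order
  one.\<close>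

definition deriv2 :: "'o \<times> 'm \<Rightarrow> 'm \<Rightarrow> 'm \<Rightarrow> 'm \<Rightarrow> 'm \<Rightarrow> 'm" where
  "deriv2 P a b c d = 
     deriv P (a \<cdot> Pr X [Dom X d, Dom X d] 0 \<oplus> b \<cdot> Pr X [Dom X d, Dom X d] (Suc 0))
       (c \<cdot> Pr X [Dom X d, Dom X d] 0 \<oplus> d \<cdot> Pr X [Dom X d, Dom X d] (Suc 0)) \<cdot> \<delta> (Dom X d)"

text \<open>The first component follows because the projection to \<open>P\<close> is a homomorphism
  and thus commutes with derivatives. The second one differentiates \<open>alg_diff\<close>, which
  is how second derivatives arise.\<close>

lemma deriv_T:
  assumes P: "P \<in> algs" and a: "a \<in> Arr X" "Dom X a = D" "Cod X a = Bip X [fst P, fst P]"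
    and b: "b \<in> Arr X" "Dom X b = D" "Cod X b = Bip X [fst P, fst P]"
  defines "p0 \<equiv> Pr X [fst P, fst P] 0" and "p1 \<equiv> Pr X [fst P, fst P] (Suc 0)"
  shows "deriv (T_obj P) a b
    = tup X [deriv P (p0 \<cdot> a) (p0 \<cdot> b), deriv2 P (p0 \<cdot> a) (p0 \<cdot> b) (p1 \<cdot> a) (p1 \<cdot> b)]"
proof -
  have D: "D \<in> Obj X" using a by auto
  have 0: "p0 \<cdot> deriv (T_obj P) a b = deriv P (p0 \<cdot> a) (p0 \<cdot> b)"
    unfolding p0_def by (rule alg_hom_deriv[OF alg_hom_p]) (use P a b in simp_all)
  let ?w = "a \<cdot> Pr X [D, D] 0 \<oplus> b \<cdot> Pr X [D, D] (Suc 0)"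
  have w: "?w \<in> Arr X" "Dom X ?w = Bip X [D, D]" "Cod X ?w = Bip X [fst P, fst P]"
    using D a b by simp_all
  have "p1 \<cdot> deriv (T_obj P) a b = (p1 \<cdot> (snd (T_obj P) \<cdot> FMap S ?w)) \<cdot> \<delta> D"
    using P a b D by (simp add: deriv_def p1_def)
  also have "\<dots> = deriv P (p0 \<cdot> ?w) (p1 \<cdot> ?w) \<cdot> \<delta> D"
    unfolding T_obj_struct[OF P w(1,3)] p0_def p1_def using P w by (simp del: comp_plus plus_simps)
  also have "\<dots> = deriv2 P (p0 \<cdot> a) (p0 \<cdot> b) (p1 \<cdot> a) (p1 \<cdot> b)"
    using P a b D by (simp add: deriv2_def p0_def p1_def)
  finally have 1: "p1 \<cdot> deriv (T_obj P) a b = deriv2 P (p0 \<cdot> a) (p0 \<cdot> b) (p1 \<cdot> a) (p1 \<cdot> b)" .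
  have "tup X [p0 \<cdot> deriv (T_obj P) a b, p1 \<cdot> deriv (T_obj P) a b] = deriv (T_obj P) a b"
    unfolding p0_def p1_def using P a b by (intro tup_eta) simp_all
  then show ?thesis
    unfolding 0 1 by simp
qed

lemma deriv2_eq:
  assumes P: "P \<in> algs" and ar: "a \<in> Arr X" "b \<in> Arr X" "c \<in> Arr X" "d \<in> Arr X"
    and dom: "Dom X a = D" "Dom X b = D" "Dom X c = D" "Dom X d = D"
    and cod: "Cod X a = fst P" "Cod X b = fst P" "Cod X c = fst P" "Cod X d = fst P"
  shows "deriv2 P a b c d = snd P \<cdot> (FMap S ((a \<cdot> pr4 X D 0 \<oplus> b \<cdot> pr4 X D 1) \<oplus> (c \<cdot> pr4 X D 2 \<oplus> d \<cdot> pr4 X D 3))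
     \<cdot> (\<delta> (Bip X [D, D]) \<cdot> \<delta> D))"
proof -
  have D: "D \<in> Obj X" using ar dom by auto
  then show ?thesis
    using assms by (simp add: deriv2_def deriv_def pr4_def)
qed

lemma deriv2_swap:
  assumes P: "P \<in> algs" and ar: "a \<in> Arr X" "b \<in> Arr X" "c \<in> Arr X" "d \<in> Arr X"
    and dom: "Dom X a = D" "Dom X b = D" "Dom X c = D" "Dom X d = D"
    and cod: "Cod X a = fst P" "Cod X b = fst P" "Cod X c = fst P" "Cod X d = fst P"
  shows "deriv2 P a b c d = deriv2 P a c b d"
proof -
  have D: "D \<in> Obj X" using ar dom by auto
  define w where "w = (a \<cdot> pr4 X D 0 \<oplus> b \<cdot> pr4 X D 1) \<oplus> (c \<cdot> pr4 X D 2 \<oplus> d \<cdot> pr4 X D 3)"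
  define w' where "w' = (a \<cdot> pr4 X D 0 \<oplus> c \<cdot> pr4 X D 1) \<oplus> (b \<cdot> pr4 X D 2 \<oplus> d \<cdot> pr4 X D 3)"
  define t where "t = tup4 X (pr4 X D 0) (pr4 X D 2) (pr4 X D 1) (pr4 X D 3)"
  \<comment> \<open>The permutation \<open>t\<close> exchanges the middle two variables; regrouping
    the four summands by the interchange law then exchanges \<open>b\<close> and
    \<open>c\<close>.\<close>
  have "w \<cdot> t = (a \<cdot> pr4 X D 0 \<oplus> b \<cdot> pr4 X D 2) \<oplus> (c \<cdot> pr4 X D 1 \<oplus> d \<cdot> pr4 X D 3)"
    using D ar dom cod by (simp add: w_def t_def pr4_def tup4_def)
  also have "\<dots> = w'"
    unfolding w'_def using D ar dom cod by (intro plus_interchange) (simp_all add: pr4_def)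
  finally have wt: "w \<cdot> t = w'" .
  have w: "w \<in> Arr X" "Dom X w = Bip X [Bip X [D, D], Bip X [D, D]]" "Cod X w = fst P"
    and t: "t \<in> Arr X" "Dom X t = Bip X [Bip X [D, D], Bip X [D, D]]"
    "Cod X t = Bip X [Bip X [D, D], Bip X [D, D]]"
    using D ar dom cod by (simp_all add: w_def t_def pr4_def tup4_def)
  have "deriv2 P a b c d = snd P \<cdot> (FMap S w \<cdot> ((FMap S t \<cdot> \<delta> (Bip X [D, D])) \<cdot> \<delta> D))"
    using DC6[OF D, folded t_def] deriv2_eq[OF assms, folded w_def] by simp
  also have "\<dots> = snd P \<cdot> (FMap S w' \<cdot> (\<delta> (Bip X [D, D]) \<cdot> \<delta> D))"
    using P D w t by (simp add: functor_comp_assoc wt)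
  also have "\<dots> = deriv2 P a c b d"
    using deriv2_eq[of P a c b d D, folded w'_def] assms by simp
  finally show ?thesis .
qed

text \<open>With zero first-order directions the argument of \<open>S\<close> depends only on the
  outer two variables, hence factors through \<open>t\<close>; [DC.5] then cancels one of the two
  derivatives.\<close>

lemma deriv2_lift:
  assumes P: "P \<in> algs" and ar: "a \<in> Arr X" "d \<in> Arr X" and dom: "Dom X a = D" "Dom X d = D"
    and cod: "Cod X a = fst P" "Cod X d = fst P"
  defines "z \<equiv> zero_map X D (fst P)"
  shows "deriv2 P a z z d = deriv P a d"
proof -
  have D: "D \<in> Obj X" using ar dom by auto
  define w where "w = a \<cdot> Pr X [D, D] 0 \<oplus> d \<cdot> Pr X [D, D] (Suc 0)"
  define t where "t = tup X [pr4 X D 0, pr4 X D 3]"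
  have w: "w \<in> Arr X" "Dom X w = Bip X [D, D]" "Cod X w = fst P"
    and t: "t \<in> Arr X" "Dom X t = Bip X [Bip X [D, D], Bip X [D, D]]" "Cod X t = Bip X [D, D]"
    using D ar dom cod by (simp_all add: w_def t_def pr4_def)
  have "deriv2 P a z z d = snd P \<cdot> (FMap S (w \<cdot> t) \<cdot> (\<delta> (Bip X [D, D]) \<cdot> \<delta> D))"
    unfolding z_def using P D ar dom cod by (subst deriv2_eq[where D = D]) (simp_all add: w_def t_def pr4_def)
  also have "\<dots> = snd P \<cdot> (FMap S w \<cdot> ((FMap S t \<cdot> \<delta> (Bip X [D, D])) \<cdot> \<delta> D))"
    using P D w t by (simp add: functor_comp_assoc)
  also have "\<dots> = deriv P a d"
    using DC5[OF D, folded t_def] dom by (simp add: deriv_def w_def)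
  finally show ?thesis .
qed

lemma deriv2_simps [simp]:
  assumes "P \<in> algs" "a \<in> Arr X" "b \<in> Arr X" "c \<in> Arr X" "d \<in> Arr X"
    "Dom X a = Dom X d" "Dom X b = Dom X d" "Dom X c = Dom X d"
    "Cod X a = fst P" "Cod X b = fst P" "Cod X c = fst P" "Cod X d = fst P"
  shows "deriv2 P a b c d \<in> Arr X" "Dom X (deriv2 P a b c d) = FObj S (Dom X d)"
    "Cod X (deriv2 P a b c d) = fst P"
  using assms by (simp_all add: deriv2_def)

text \<open>The outer derivative is taken at the point \<open>(h0, h1)\<close> in the direction
  \<open>(h2, h3)\<close>. In the argument order of \<open>deriv2\<close> this puts
  \<open>h2\<close> before \<open>h1\<close>.\<close>

lemma T_T_obj_struct:
  assumes P: "P \<in> algs" and h: "h \<in> Arr X" "Cod X h = Bip X [Bip X [fst P, fst P], Bip X [fst P, fst P]]"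
  defines "h0 \<equiv> pr4 X (fst P) 0 \<cdot> h" and "h1 \<equiv> pr4 X (fst P) 1 \<cdot> h"
    and "h2 \<equiv> pr4 X (fst P) 2 \<cdot> h" and "h3 \<equiv> pr4 X (fst P) 3 \<cdot> h"
  shows "snd (T_obj (T_obj P)) \<cdot> FMap S h
    = tup4 X (snd P \<cdot> FMap S h0) (deriv P h0 h1) (deriv P h0 h2) (deriv2 P h0 h2 h1 h3)"
  using P h by (simp add: T_obj_struct deriv_T h0_def h1_def h2_def h3_def tup4_def pr4_def)

lemma alg_hom_TTI:
  assumes P: "P \<in> algs" and Q: "Q \<in> algs"
    and h: "h \<in> Arr X" "Dom X h = fst P" "Cod X h = Bip X [Bip X [fst Q, fst Q], Bip X [fst Q, fst Q]]"
  defines "h0 \<equiv> pr4 X (fst Q) 0 \<cdot> h" and "h1 \<equiv> pr4 X (fst Q) 1 \<cdot> h"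
    and "h2 \<equiv> pr4 X (fst Q) 2 \<cdot> h" and "h3 \<equiv> pr4 X (fst Q) 3 \<cdot> h"
  assumes "h \<cdot> snd P = tup4 X (snd Q \<cdot> FMap S h0) (deriv Q h0 h1) (deriv Q h0 h2) (deriv2 Q h0 h2 h1 h3)"
  shows "alg_hom P (T_obj (T_obj Q)) h"
  using assms by (simp add: alg_hom_def T_T_obj_struct)

lemma alg_hom_l:
  assumes "P \<in> algs"
  defines "z \<equiv> zero_map X (Bip X [fst P, fst P]) (fst P)"
  shows "alg_hom (T_obj P) (T_obj (T_obj P)) (tup4 X (Pr X [fst P, fst P] 0) z z (Pr X [fst P, fst P] (Suc 0)))"
  unfolding z_def using assms(1)
  by (intro alg_hom_TTI) (simp_all add: T_obj_snd deriv_zero deriv2_lift)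

lemma alg_hom_c:
  assumes "P \<in> algs"
  shows "alg_hom (T_obj (T_obj P)) (T_obj (T_obj P))
    (tup4 X (pr4 X (fst P) 0) (pr4 X (fst P) 2) (pr4 X (fst P) 1) (pr4 X (fst P) 3))"
proof -
  let ?BB = "Bip X [Bip X [fst P, fst P], Bip X [fst P, fst P]]" and ?x = "pr4 X (fst P)"
  let ?c = "tup4 X (?x 0) (?x 2) (?x 1) (?x 3)"
  \<comment> \<open>Inserting the identity brings the structure map into the shape
    \<open>_ \<cdot> FMap S h\<close> of \<open>T_T_obj_struct\<close>, with \<open>h\<close> the
    identity, so its components become visible.\<close>
  have "snd (T_obj (T_obj P)) = snd (T_obj (T_obj P)) \<cdot> FMap S (Ide X ?BB)"
    using assms by simp
  also have "\<dots> = tup4 X (snd P \<cdot> FMap S (?x 0)) (deriv P (?x 0) (?x 1)) (deriv P (?x 0) (?x 2))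
    (deriv2 P (?x 0) (?x 2) (?x 1) (?x 3))"
    using assms by (subst T_T_obj_struct) simp_all
  also have "deriv2 P (?x 0) (?x 2) (?x 1) (?x 3) = deriv2 P (?x 0) (?x 1) (?x 2) (?x 3)"
    by (rule deriv2_swap[where D = ?BB]) (use assms in simp_all)
  finally have "?c \<cdot> snd (T_obj (T_obj P)) = tup4 X (snd P \<cdot> FMap S (?x 0)) (deriv P (?x 0) (?x 2))
      (deriv P (?x 0) (?x 1)) (deriv2 P (?x 0) (?x 1) (?x 2) (?x 3))"
    using assms by simp
  then show ?thesis
    using assms by (intro alg_hom_TTI) simp_all
qed

end

section \<open>Fold pullbacks and products are preserved by \<open>A \<mapsto> A \<times> A\<close>\<close>

context semi_additive_category
begin

text \<open>Maps into \<open>A \<times> A\<close> with a common first coordinate amount to that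
  coordinate together with \<open>n\<close> free second coordinates, hence to one map into the
  biproduct of \<open>n + 1\<close> copies. For \<open>n = 0\<close> only the base leg
  remains.\<close>

lemma fold_pullback_Bip:
  fixes n :: nat
  assumes A: "A \<in> Obj X"
  defines "As \<equiv> replicate (n + 1) A"
  shows "fold_pullback_leg X (Bip X [A, A]) A (Pr X [A, A] 0) n (Bip X As)
    (\<lambda>j. tup X [Pr X As 0, Pr X As (j + 1)]) (Pr X As 0)"
proof -
  have As: "set As \<subseteq> Obj X" "length As = n + 1" "\<And>i. i < n + 1 \<Longrightarrow> As ! i = A"
    using A by (simp_all add: As_def nth_append del: replicate_Suc)
  have Pr: "Pr X As i \<in> Arr X \<and> Dom X (Pr X As i) = Bip X As \<and> Cod X (Pr X As i) = A" if "i < n + 1" for i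
    using that As by simp
  have univ: "\<exists>!u. u \<in> hom X B (Bip X As) \<and> Pr X As 0 \<cdot> u = g \<and>
      (\<forall>j < n. tup X [Pr X As 0, Pr X As (j + 1)] \<cdot> u = f j)"
    if B: "B \<in> Obj X" and g: "g \<in> hom X B A"
      and f: "\<forall>j < n. f j \<in> hom X B (Bip X [A, A]) \<and> Pr X [A, A] 0 \<cdot> f j = g" for B g f
  proof -
    \<comment> \<open>Position 0 carries the base point; the shift \<open>i - 1\<close> is needed
      because the \<open>j\<close>-th tangent vector sits at position \<open>j + 1\<close>.\<close>
    define h where "h i = (if i = 0 then g else Pr X [A, A] (Suc 0) \<cdot> f (i - 1))" for i
    have "h i \<in> hom X B (As ! i)" if "i < length As" for i
      using that As g f A by (auto simp: h_def in_hom_iff)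
    from is_product_ex1[OF bip_product[OF As(1)] B this]
    have ex1: "\<exists>!u. u \<in> hom X B (Bip X As) \<and> (\<forall>i < length As. Pr X As i \<cdot> u = h i)" .
    have "(Pr X As 0 \<cdot> u = g \<and> (\<forall>j < n. tup X [Pr X As 0, Pr X As (j + 1)] \<cdot> u = f j))
        \<longleftrightarrow> (\<forall>i < length As. Pr X As i \<cdot> u = h i)" if u: "u \<in> hom X B (Bip X As)" for u
    proof -
      have u': "u \<in> Arr X" "Dom X u = B" "Cod X u = Bip X As"
        using u by (simp_all add: in_hom_iff)
      have t: "tup X [Pr X As 0, Pr X As (j + 1)] \<cdot> u = f j \<longleftrightarrow> Pr X As (j + 1) \<cdot> u = h (j + 1)"
        if j: "j < n" and 0: "Pr X As 0 \<cdot> u = g" for j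
      proof -
        have fj: "f j \<in> Arr X" "Dom X (f j) = B" "Cod X (f j) = Bip X [A, A]" "Pr X [A, A] 0 \<cdot> f j = g"
          using f j by (simp_all add: in_hom_iff)
        have eta: "tup X [g, h (j + 1)] = f j"
          using tup_eta[of "f j" A A] fj A by (simp add: h_def)
        have tu: "tup X [Pr X As 0, Pr X As (j + 1)] \<cdot> u = tup X [g, Pr X As (j + 1) \<cdot> u]"
          using u' Pr[of 0] Pr[of "j + 1"] j 0 by simp
        have "Pr X [A, A] (Suc 0) \<cdot> tup X [g, Pr X As (j + 1) \<cdot> u] = Pr X As (j + 1) \<cdot> u"
          using u' Pr[of "j + 1"] j g by (simp add: in_hom_iff)
        then have "Pr X As (j + 1) \<cdot> u = h (j + 1)" if "tup X [g, Pr X As (j + 1) \<cdot> u] = f j"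
          using that by (simp add: h_def)
        then show ?thesis
          unfolding tu using eta by metis
      qed
      have all: "(\<forall>i < length As. Pr X As i \<cdot> u = h i)
          \<longleftrightarrow> Pr X As 0 \<cdot> u = g \<and> (\<forall>j < n. Pr X As (j + 1) \<cdot> u = h (j + 1))"
        by (simp add: As(2) All_less_Suc2 h_def)
      show ?thesis
        unfolding all using t by blast
    qed
    then show ?thesis
      using ex1 by (metis (no_types, lifting))
  qed
  have "tup X [Pr X As 0, Pr X As (j + 1)] \<in> hom X (Bip X As) (Bip X [A, A])
    \<and> Pr X [A, A] 0 \<cdot> tup X [Pr X As 0, Pr X As (j + 1)] = Pr X As 0" if "j < n" for j
    using that Pr[of 0] Pr[of "j + 1"] by (simp add: in_hom_iff)
  moreover have "Pr X [A, A] 0 \<in> hom X (Bip X [A, A]) A" "Bip X As \<in> Obj X" "Pr X As 0 \<in> hom X (Bip X As) A"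
    using A As Pr[of 0] by (simp_all add: in_hom_iff)
  ultimately show ?thesis
    unfolding fold_pullback_leg_def using univ by blast
qed

interpretation square: endofunctor X "square X"
  by (rule square_endofunctor)

section \<open>Universal properties in a square, coordinate by coordinate\<close>

lemma Pr_square [simp]:
  assumes "f \<in> Arr X" "Dom X f = A" "Cod X f = B" "h \<in> Arr X" "Cod X h = Bip X [A, A]"
  shows "Pr X [B, B] 0 \<cdot> (FMap (square X) f \<cdot> h) = f \<cdot> (Pr X [A, A] 0 \<cdot> h)"
    "Pr X [B, B] (Suc 0) \<cdot> (FMap (square X) f \<cdot> h) = f \<cdot> (Pr X [A, A] (Suc 0) \<cdot> h)"
proof -
  have "A \<in> Obj X" "B \<in> Obj X" using assms by auto
  then show "Pr X [B, B] 0 \<cdot> (FMap (square X) f \<cdot> h) = f \<cdot> (Pr X [A, A] 0 \<cdot> h)"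
    "Pr X [B, B] (Suc 0) \<cdot> (FMap (square X) f \<cdot> h) = f \<cdot> (Pr X [A, A] (Suc 0) \<cdot> h)"
    using assms by (simp_all add: FMap_square)
qed

lemma square_comp_eq_iff:
  assumes "f \<in> hom X A B" "h \<in> hom X D (Bip X [A, A])" "k \<in> hom X D (Bip X [B, B])"
  shows "FMap (square X) f \<cdot> h = k \<longleftrightarrow>
    f \<cdot> (Pr X [A, A] 0 \<cdot> h) = Pr X [B, B] 0 \<cdot> k \<and> f \<cdot> (Pr X [A, A] (Suc 0) \<cdot> h) = Pr X [B, B] (Suc 0) \<cdot> k"
proof
  have obj: "A \<in> Obj X" "B \<in> Obj X" using assms by (auto simp: in_hom_iff)
  show "f \<cdot> (Pr X [A, A] 0 \<cdot> h) = Pr X [B, B] 0 \<cdot> k \<and> f \<cdot> (Pr X [A, A] (Suc 0) \<cdot> h) = Pr X [B, B] (Suc 0) \<cdot> k"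
    if "FMap (square X) f \<cdot> h = k"
    unfolding that[symmetric] using assms by (simp add: in_hom_iff)
  show "FMap (square X) f \<cdot> h = k"
    if "f \<cdot> (Pr X [A, A] 0 \<cdot> h) = Pr X [B, B] 0 \<cdot> k \<and> f \<cdot> (Pr X [A, A] (Suc 0) \<cdot> h) = Pr X [B, B] (Suc 0) \<cdot> k"
    by (rule Bip2_eqI[of _ _ B B]) (use that assms obj in \<open>simp_all add: in_hom_iff\<close>)
qed

text \<open>A mediating map into a square consists of two independent mediating maps. Together with
  \<open>square_comp_eq_iff\<close>, this makes the square of a limit cone a limit cone.\<close>

lemma Bip2_ex1:
  assumes A: "A \<in> Obj X" and D: "D \<in> Obj X"
    and 0: "\<exists>!u. u \<in> hom X D A \<and> Q0 u" and 1: "\<exists>!u. u \<in> hom X D A \<and> Q1 u"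
  shows "\<exists>!u. u \<in> hom X D (Bip X [A, A]) \<and> Q0 (Pr X [A, A] 0 \<cdot> u) \<and> Q1 (Pr X [A, A] (Suc 0) \<cdot> u)"
proof -
  obtain u0 where u0: "u0 \<in> hom X D A" "Q0 u0" "\<And>v. v \<in> hom X D A \<Longrightarrow> Q0 v \<Longrightarrow> v = u0"
    using 0 by blast
  obtain u1 where u1: "u1 \<in> hom X D A" "Q1 u1" "\<And>v. v \<in> hom X D A \<Longrightarrow> Q1 v \<Longrightarrow> v = u1"
    using 1 by blast
  show ?thesis
  proof (rule ex1I[of _ "tup X [u0, u1]"])
    show "tup X [u0, u1] \<in> hom X D (Bip X [A, A]) \<and>
      Q0 (Pr X [A, A] 0 \<cdot> tup X [u0, u1]) \<and> Q1 (Pr X [A, A] (Suc 0) \<cdot> tup X [u0, u1])"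
      using u0(1,2) u1(1,2) by (simp add: in_hom_iff)
  next
    fix w assume w: "w \<in> hom X D (Bip X [A, A]) \<and> Q0 (Pr X [A, A] 0 \<cdot> w) \<and> Q1 (Pr X [A, A] (Suc 0) \<cdot> w)"
    have "Pr X [A, A] 0 \<cdot> w = u0"
      using w A by (intro u0(3)) (simp_all add: in_hom_iff)
    moreover have "Pr X [A, A] (Suc 0) \<cdot> w = u1"
      using w A by (intro u1(3)) (simp_all add: in_hom_iff)
    ultimately show "w = tup X [u0, u1]"
      using w A tup_eta[of w A A] by (simp add: in_hom_iff)
  qed
qed

lemma Pr_hom:
  assumes "f \<in> hom X B (Bip X [A, A])" "A \<in> Obj X"
  shows "Pr X [A, A] 0 \<cdot> f \<in> hom X B A" "Pr X [A, A] (Suc 0) \<cdot> f \<in> hom X B A"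
  using assms by (simp_all add: in_hom_iff)

lemma square_hom: "f \<in> hom X A B \<Longrightarrow> FMap (square X) f \<in> hom X (Bip X [A, A]) (Bip X [B, B])"
  using square.fmap[of f A B] by simp

lemma square_fold_pullback:
  assumes pb: "fold_pullback_leg X E A p n P q b"
  shows "fold_pullback_leg X (FObj (square X) E) (FObj (square X) A) (FMap (square X) p) n
    (FObj (square X) P) (\<lambda>j. FMap (square X) (q j)) (FMap (square X) b)"
proof -
  have p: "p \<in> hom X E A" and b: "b \<in> hom X P A" and q: "\<And>j. j < n \<Longrightarrow> q j \<in> hom X P E"
    and pq: "\<And>j. j < n \<Longrightarrow> p \<cdot> q j = b"
    using pb by (simp_all add: fold_pullback_leg_def)
  have obj: "E \<in> Obj X" "A \<in> Obj X" "P \<in> Obj X"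
    using p b by (auto simp: in_hom_iff)
  have univ: "\<exists>!u. u \<in> hom X B (Bip X [P, P]) \<and> FMap (square X) b \<cdot> u = g \<and>
      (\<forall>j < n. FMap (square X) (q j) \<cdot> u = f j)"
    if B: "B \<in> Obj X" and g: "g \<in> hom X B (Bip X [A, A])"
      and f: "\<forall>j < n. f j \<in> hom X B (Bip X [E, E]) \<and> FMap (square X) p \<cdot> f j = g" for B g f
  proof -
    \<comment> \<open>\<open>?Q i\<close> is the mediating problem in coordinate \<open>i\<close>;
      each coordinate is an instance of the universal property of the original cone.\<close>
    let ?Q = "\<lambda>i u. b \<cdot> u = Pr X [A, A] i \<cdot> g \<and> (\<forall>j < n. q j \<cdot> u = Pr X [E, E] i \<cdot> f j)"
    have fp: "p \<cdot> (Pr X [E, E] 0 \<cdot> f j) = Pr X [A, A] 0 \<cdot> g \<and>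
      p \<cdot> (Pr X [E, E] (Suc 0) \<cdot> f j) = Pr X [A, A] (Suc 0) \<cdot> g" if "j < n" for j
      using f that square_comp_eq_iff[OF p _ g, of "f j"] by simp
    have "\<exists>!u. u \<in> hom X B P \<and> ?Q 0 u"
      by (rule fold_pullback_leg_ex1[OF pb B]) (use Pr_hom g f fp obj in auto)
    moreover have "\<exists>!u. u \<in> hom X B P \<and> ?Q (Suc 0) u"
      by (rule fold_pullback_leg_ex1[OF pb B]) (use Pr_hom g f fp obj in auto)
    ultimately have "\<exists>!u. u \<in> hom X B (Bip X [P, P]) \<and>
        ?Q 0 (Pr X [P, P] 0 \<cdot> u) \<and> ?Q (Suc 0) (Pr X [P, P] (Suc 0) \<cdot> u)"
      by (rule Bip2_ex1[OF obj(3) B])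
    moreover have "?Q 0 (Pr X [P, P] 0 \<cdot> u) \<and> ?Q (Suc 0) (Pr X [P, P] (Suc 0) \<cdot> u)
      \<longleftrightarrow> FMap (square X) b \<cdot> u = g \<and> (\<forall>j < n. FMap (square X) (q j) \<cdot> u = f j)"
      if u: "u \<in> hom X B (Bip X [P, P])" for u
      unfolding square_comp_eq_iff[OF b u g] using square_comp_eq_iff[OF q u, of _ "f _"] f by blast
    ultimately show ?thesis
      by (metis (no_types, lifting))
  qed
  have "FMap (square X) (q j) \<in> hom X (Bip X [P, P]) (Bip X [E, E])
    \<and> FMap (square X) p \<cdot> FMap (square X) (q j) = FMap (square X) b" if "j < n" for j
    using square_hom[OF q[OF that]] square.fmap_comp[OF q[OF that] p] pq[OF that] by simp
  then show ?thesis
    unfolding fold_pullback_leg_def FObj_square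
    using univ square_hom[OF p] square_hom[OF b] obj by simp
qed

lemma square_pow_fold_pullback:
  assumes "fold_pullback_leg X E A p n P q b"
  shows "fold_pullback_leg X ((FObj (square X) ^^ m) E) ((FObj (square X) ^^ m) A)
    ((FMap (square X) ^^ m) p) n ((FObj (square X) ^^ m) P) (\<lambda>j. (FMap (square X) ^^ m) (q j))
    ((FMap (square X) ^^ m) b)"
proof (induction m)
  case (Suc m)
  \<comment> \<open>\<open>FObj_square\<close> stays switched off so that the objects remain
    iterates of \<open>FObj (square X)\<close>.\<close>
  from square_fold_pullback[OF this] show ?case by (simp del: FObj_square)
qed (simp add: assms)

lemma square_product:
  assumes prod: "is_product X As P pr" and As: "set As \<subseteq> Obj X"
  shows "is_product X (map (FObj (square X)) As) (FObj (square X) P) (\<lambda>i. FMap (square X) (pr i))"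
proof -
  have P: "P \<in> Obj X" and pr: "\<And>i. i < length As \<Longrightarrow> pr i \<in> hom X P (As ! i)"
    using prod by (simp_all add: is_product_def)
  have univ: "\<exists>!u. u \<in> hom X B (Bip X [P, P]) \<and> (\<forall>i < length As. FMap (square X) (pr i) \<cdot> u = f i)"
    if B: "B \<in> Obj X" and f: "\<forall>i < length As. f i \<in> hom X B (Bip X [As ! i, As ! i])" for B f
  proof -
    let ?Q = "\<lambda>k u. \<forall>i < length As. pr i \<cdot> u = Pr X [As ! i, As ! i] k \<cdot> f i"
    have As': "As ! i \<in> Obj X" if "i < length As" for i
      using As that by auto
    have "\<exists>!u. u \<in> hom X B P \<and> ?Q 0 u"
      by (rule is_product_ex1[OF prod B]) (use Pr_hom f As' in auto)
    moreover have "\<exists>!u. u \<in> hom X B P \<and> ?Q (Suc 0) u"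
      by (rule is_product_ex1[OF prod B]) (use Pr_hom f As' in auto)
    ultimately have "\<exists>!u. u \<in> hom X B (Bip X [P, P]) \<and>
        ?Q 0 (Pr X [P, P] 0 \<cdot> u) \<and> ?Q (Suc 0) (Pr X [P, P] (Suc 0) \<cdot> u)"
      by (rule Bip2_ex1[OF P B])
    moreover have "?Q 0 (Pr X [P, P] 0 \<cdot> u) \<and> ?Q (Suc 0) (Pr X [P, P] (Suc 0) \<cdot> u)
      \<longleftrightarrow> (\<forall>i < length As. FMap (square X) (pr i) \<cdot> u = f i)"
      if u: "u \<in> hom X B (Bip X [P, P])" for u
      using square_comp_eq_iff[OF pr u, of _ "f _"] f by blast
    ultimately show ?thesis
      by (metis (no_types, lifting))
  qed
  show ?thesis
    unfolding is_product_def using univ P square_hom[OF pr] by simp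
qed

end

section \<open>The tangent structure on algebras\<close>

context cocartesian_differential_monad
begin

interpretation square: endofunctor X "square X"
  by (rule square_endofunctor)

subsection \<open>The fold pullbacks of the tangent projection\<close>

lemma replicate_3_4 [simp]: "replicate 3 A = [A, A, A]" "replicate 4 A = [A, A, A, A]"
  by (simp_all add: numeral_eq_Suc)

abbreviation Tn where "Tn \<equiv> alg_Tn X S \<delta>"

lemma fst_Tn [simp]: "fst (Tn n P) = Bip X (replicate (n + 1) (fst P))"
  by (cases P) (simp add: alg_Tn_def Let_def)

text \<open>Each component involves only the base point and one vector, so the structure is
  described by first derivatives at the common point. In this form it can be tested on the legs of
  the pullback.\<close>

lemma Tn_struct:
  fixes n :: nat
  assumes P: "P \<in> algs"
  defines "As \<equiv> replicate (n + 1) (fst P)"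
  shows "snd (Tn n P) \<in> hom X (FObj S (Bip X As)) (Bip X As)"
    "Pr X As 0 \<cdot> snd (Tn n P) = snd P \<cdot> FMap S (Pr X As 0)"
    "\<And>j. 0 < j \<Longrightarrow> j < n + 1 \<Longrightarrow> Pr X As j \<cdot> snd (Tn n P) = deriv P (Pr X As 0) (Pr X As j)"
proof -
  have As: "set As \<subseteq> Obj X" "length As = n + 1" "\<And>i. i < n + 1 \<Longrightarrow> As ! i = fst P"
    using P by (simp_all add: As_def nth_append del: replicate_Suc)
  have Pr: "Pr X As i \<in> Arr X \<and> Dom X (Pr X As i) = Bip X As \<and> Cod X (Pr X As i) = fst P"
    if "i < n + 1" for i
    using that As by simp
  define fs where "fs = snd P \<cdot> FMap S (Pr X As 0) #
        map (\<lambda>j. alg_diff X S \<delta> P \<cdot> FMap S (tup X [Pr X As 0, Pr X As j])) [1..<n + 1]"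
  have snd: "snd (Tn n P) = tup X fs"
    by (cases P) (simp only: alg_Tn_def Let_def fs_def As_def prod.case snd_conv fst_conv)
  have len: "length fs = n + 1" "fs \<noteq> []"
    by (simp_all add: fs_def del: upt_Suc)
  \<comment> \<open>\<open>alg_diff\<close> after \<open>S\<close> of a pairing of projections is
    absorbed into a single \<open>deriv\<close> by \<open>deriv_comp\<close>.\<close>
  have nth: "fs ! i = (if i = 0 then snd P \<cdot> FMap S (Pr X As 0) else deriv P (Pr X As 0) (Pr X As i))"
    if "i < n + 1" for i
    using that P Pr[of 0] Pr[of i]
    by (cases i) (simp_all add: fs_def alg_diff_eq deriv_comp del: upt_Suc)
  have hom: "fs ! i \<in> Arr X \<and> Dom X (fs ! i) = FObj S (Bip X As) \<and> Cod X (fs ! i) = fst P"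
    if "i < n + 1" for i
    using that P Pr[of 0] Pr[of i] by (simp add: nth)
  have "\<forall>f \<in> set fs. f \<in> Arr X \<and> Dom X f = FObj S (Bip X As)"
    using hom len(1) by (metis in_set_conv_nth)
  note t = tup_char[OF len(2) this]
  have cod: "map (Cod X) fs = As"
    by (rule nth_equalityI) (use len As hom in auto)
  show "snd (Tn n P) \<in> hom X (FObj S (Bip X As)) (Bip X As)"
    "Pr X As 0 \<cdot> snd (Tn n P) = snd P \<cdot> FMap S (Pr X As 0)"
    "\<And>j. 0 < j \<Longrightarrow> j < n + 1 \<Longrightarrow> Pr X As j \<cdot> snd (Tn n P) = deriv P (Pr X As 0) (Pr X As j)"
    using t unfolding snd cod len by (simp_all add: nth)
qed

lemma Tn_legs:
  fixes n :: nat
  assumes P: "P \<in> algs"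
  defines "As \<equiv> replicate (n + 1) (fst P)"
  shows Tn_algs: "Tn n P \<in> algs"
    and alg_hom_Tn_base: "alg_hom (Tn n P) P (Pr X As 0)"
    and alg_hom_q: "\<And>j. j < n \<Longrightarrow> alg_hom (Tn n P) (T_obj P) (tup X [Pr X As 0, Pr X As (j + 1)])"
proof -
  have As: "set As \<subseteq> Obj X" "length As = n + 1" "\<And>i. i < n + 1 \<Longrightarrow> As ! i = fst P"
    using P by (simp_all add: As_def nth_append del: replicate_Suc)
  have Pr: "Pr X As i \<in> Arr X \<and> Dom X (Pr X As i) = Bip X As \<and> Cod X (Pr X As i) = fst P"
    if "i < n + 1" for i
    using that As by simp
  \<comment> \<open>\<open>None\<close> indexes the base leg into \<open>P\<close>,
    \<open>Some j\<close> the \<open>j\<close>-th projection into \<open>T_obj P\<close>. Both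
    targets are already known to be algebras, so the laws for \<open>Tn n P\<close> follow from
    \<open>algebra_lift\<close>.\<close>
  let ?g = "case_option (Pr X As 0) (\<lambda>j. tup X [Pr X As 0, Pr X As (j + 1)])"
  let ?Q = "case_option P (\<lambda>_. T_obj P)"
  let ?I = "insert None (Some ` {..<n})"
  note st = Tn_struct[OF P, where n = n, folded As_def]
  have g: "?Q i \<in> algs \<and> ?g i \<in> Arr X \<and> Dom X (?g i) = Bip X As \<and> Cod X (?g i) = fst (?Q i)
      \<and> ?g i \<cdot> snd (Tn n P) = snd (?Q i) \<cdot> FMap S (?g i)" if "i \<in> ?I" for i
  proof (cases i)
    case None
    then show ?thesis using Pr[of 0] P st by simp
  next
    case (Some j)
    then have "j < n" using that by auto
    then show ?thesis
      using Some Pr[of 0] Pr[of "j + 1"] P st by (simp add: T_obj_struct in_hom_iff)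
  qed
  note mono = fold_pullback_leg_jointly_monic[OF fold_pullback_Bip[of "fst P" n, folded As_def]]
  have "(Bip X As, snd (Tn n P)) \<in> algs"
    by (rule algebra_lift[of _ ?I ?g _ ?Q]) (use mono P As st g in \<open>auto simp: in_hom_iff\<close>)
  then show Tn: "Tn n P \<in> algs"
    by (metis As_def fst_Tn prod.collapse)
  show "alg_hom (Tn n P) P (Pr X As 0)"
    using g[of None] Tn P by (simp add: alg_hom_def As_def del: replicate_Suc)
  show "alg_hom (Tn n P) (T_obj P) (tup X [Pr X As 0, Pr X As (j + 1)])" if "j < n" for j
    using g[of "Some j"] that Tn P by (simp add: alg_hom_def As_def del: replicate_Suc)
qed

declare Tn_algs [simp]

subsection \<open>Iterating the tangent functor\<close>

abbreviation T where "T \<equiv> alg_T X S \<delta>"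

lemma FObj_T [simp]: "FObj T = T_obj"
  by (simp add: alg_T_def)

lemma FMap_T [simp]: "FMap T (P, Q, f) = (T_obj P, T_obj Q, FMap (square X) f)"
  by (simp add: alg_T_def)

lemma endofunctor_T: "endofunctor Alg T"
proof -
  interpret Alg: category Alg by (rule category_Alg)
  show ?thesis
  proof
    fix P assume "P \<in> Obj Alg"
    then show "FObj T P \<in> Obj Alg" "FMap T (Ide Alg P) = Ide Alg (FObj T P)"
      using square.functor_simps(5)[of "fst P"] by simp_all
  next
    fix f P Q assume "f \<in> hom Alg P Q"
    then show "FMap T f \<in> hom Alg (FObj T P) (FObj T Q)"
      by (auto simp: hom_Alg alg_hom_square)
  next
    fix f g P Q R assume "f \<in> hom Alg P Q" "g \<in> hom Alg Q R"
    then show "FMap T (g \<cdot>\<^bsub>Alg\<^esub> f) = FMap T g \<cdot>\<^bsub>Alg\<^esub> FMap T f"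
      by (auto simp: hom_Alg square.functor_comp alg_hom_def)
  qed
qed

lemma T_pow_algs [simp]: "P \<in> algs \<Longrightarrow> (T_obj ^^ m) P \<in> algs"
  by (induction m) simp_all

lemma fst_T_pow: "P \<in> algs \<Longrightarrow> fst ((T_obj ^^ m) P) = (FObj (square X) ^^ m) (fst P)"
  by (induction m) simp_all

lemma FMap_T_pow [simp]:
  "(FMap T ^^ m) (P, Q, f) = ((T_obj ^^ m) P, (T_obj ^^ m) Q, (FMap (square X) ^^ m) f)"
  by (induction m) simp_all

lemma alg_hom_square_pow:
  "alg_hom P Q f \<Longrightarrow> alg_hom ((T_obj ^^ m) P) ((T_obj ^^ m) Q) ((FMap (square X) ^^ m) f)"
  by (induction m) (simp_all add: alg_hom_square)

lemma p_eq: "alg_p X S \<delta> P = (T_obj P, P, Pr X [fst P, fst P] 0)"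
  by (cases P) (simp add: alg_p_def)

lemma q_eq: "alg_q X S \<delta> n P j = (Tn n P, T_obj P,
    tup X [Pr X (replicate (n + 1) (fst P)) 0, Pr X (replicate (n + 1) (fst P)) (j + 1)])"
  by (cases P) (simp add: alg_q_def Let_def)

lemma T_pow_fold_pullback_underlying:
  fixes n :: nat
  assumes P: "P \<in> algs"
  defines "As \<equiv> replicate (n + 1) (fst P)"
  shows "fold_pullback_leg X (fst ((T_obj ^^ m) (T_obj P))) (fst ((T_obj ^^ m) P))
    ((FMap (square X) ^^ m) (Pr X [fst P, fst P] 0)) n (fst ((T_obj ^^ m) (Tn n P)))
    (\<lambda>j. (FMap (square X) ^^ m) (tup X [Pr X As 0, Pr X As (j + 1)]))
    ((FMap (square X) ^^ m) (Pr X As 0))"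
  using square_pow_fold_pullback[OF fold_pullback_Bip[of "fst P" n], of m] P
  by (simp add: fst_T_pow As_def del: replicate_Suc)

text \<open>The case \<open>m = 0\<close> is the pullback axiom itself and general \<open>m\<close>
  its preservation. The iterated base leg must be a map of algebras for the reflection argument,
  which \<open>alg_hom_Tn_base\<close> provides also for \<open>n = 0\<close>.\<close>

lemma T_pow_fold_pullback:
  assumes P: "P \<in> algs"
  shows "is_fold_pullback Alg ((T_obj ^^ m) (T_obj P)) ((T_obj ^^ m) P) ((FMap T ^^ m) (alg_p X S \<delta> P)) n
    ((T_obj ^^ m) (Tn n P)) (\<lambda>j. (FMap T ^^ m) (alg_q X S \<delta> n P j))"
proof -
  have "fold_pullback_leg X (fst ((T_obj ^^ m) (T_obj P))) (fst ((T_obj ^^ m) P))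
    (und ((FMap T ^^ m) (alg_p X S \<delta> P))) n (fst ((T_obj ^^ m) (Tn n P)))
    (\<lambda>j. und ((FMap T ^^ m) (alg_q X S \<delta> n P j)))
    ((FMap (square X) ^^ m) (Pr X (replicate (n + 1) (fst P)) 0))"
    using T_pow_fold_pullback_underlying[OF P, of m n]
    by (simp add: p_eq q_eq del: replicate_Suc fst_Tn)
  moreover have "(FMap T ^^ m) (alg_q X S \<delta> n P j) \<in> hom Alg ((T_obj ^^ m) (Tn n P)) ((T_obj ^^ m) (T_obj P))"
    if "j < n" for j
    using alg_hom_square_pow[OF alg_hom_q[OF P that], of m] by (simp add: q_eq del: replicate_Suc)
  moreover have "(FMap T ^^ m) (alg_p X S \<delta> P) \<in> hom Alg ((T_obj ^^ m) (T_obj P)) ((T_obj ^^ m) P)"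
    using P by (simp add: p_eq alg_hom_square_pow alg_hom_p)
  ultimately show ?thesis
    unfolding is_fold_pullback_iff_leg
    by (blast intro: fold_pullback_reflected alg_hom_square_pow[OF alg_hom_Tn_base[OF P]])
qed

subsection \<open>Pairing into the twofold pullback\<close>

text \<open>A candidate \<open>u\<close> that is correct in \<open>X\<close> is a homomorphism by
  \<open>alg_hom_lift\<close> and the only solution by joint monicity, so it is the described
  pairing. The second conclusion allows such pairings to be composed further.\<close>

lemma tan_pair_eq:
  fixes P :: "'o \<times> 'm" and m :: nat
  defines "q \<equiv> \<lambda>j. tup X [Pr X [fst P, fst P, fst P] 0, Pr X [fst P, fst P, fst P] (Suc j)]"
  assumes P: "P \<in> algs" and f: "alg_hom B ((T_obj ^^ m) (T_obj P)) f"
    and g: "alg_hom B ((T_obj ^^ m) (T_obj P)) g"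
    and u: "u \<in> hom X (fst B) (fst ((T_obj ^^ m) (Tn 2 P)))"
    and qu: "(FMap (square X) ^^ m) (q 0) \<cdot> u = f" "(FMap (square X) ^^ m) (q 1) \<cdot> u = g"
  shows "tan_pair Alg T Tn (alg_q X S \<delta>) m P (B, (T_obj ^^ m) (T_obj P), f) (B, (T_obj ^^ m) (T_obj P), g) = (B, (T_obj ^^ m) (Tn 2 P), u)"
    and "alg_hom B ((T_obj ^^ m) (Tn 2 P)) u"
proof -
  let ?q = "\<lambda>j. (FMap (square X) ^^ m) (q j)"
  have rep: "replicate (2 + 1) (fst P) = [fst P, fst P, fst P]"
    by simp
  have q_eq': "alg_q X S \<delta> 2 P j = (Tn 2 P, T_obj P, q j)" for j
    unfolding q_eq rep by (simp add: q_def)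
  have mono: "jointly_monic (fst ((T_obj ^^ m) (Tn 2 P))) {..<2} ?q"
    using fold_pullback_jointly_monic[OF T_pow_fold_pullback_underlying[OF P, of m 2, unfolded rep]]
    by (simp add: q_def)
  have q: "alg_hom (Tn 2 P) (T_obj P) (q j)" if "j < 2" for j
    using alg_hom_q[OF P that] unfolding rep by (simp add: q_def)
  have two: "j = 0 \<or> j = 1" if "j \<in> {..<2}" for j :: nat
    using that by auto
  have B: "B \<in> algs" using f by (simp add: alg_hom_def)
  show hom: "alg_hom B ((T_obj ^^ m) (Tn 2 P)) u"
  proof (rule alg_hom_lift[OF mono _ B _ u, where Q = "\<lambda>_. (T_obj ^^ m) (T_obj P)"])
    fix j :: nat assume j: "j \<in> {..<2}"
    show "alg_hom ((T_obj ^^ m) (Tn 2 P)) ((T_obj ^^ m) (T_obj P)) (?q j)"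
      using q j by (intro alg_hom_square_pow) simp
    show "alg_hom B ((T_obj ^^ m) (T_obj P)) (?q j \<cdot> u)"
      using two[OF j] qu f g by auto
  qed (use P in simp)
  show "tan_pair Alg T Tn (alg_q X S \<delta>) m P (B, (T_obj ^^ m) (T_obj P), f) (B, (T_obj ^^ m) (T_obj P), g) = (B, (T_obj ^^ m) (Tn 2 P), u)"
    unfolding tan_pair_def
  proof (rule the_equality)
    fix x assume x: "x \<in> hom Alg (Dom Alg (B, (T_obj ^^ m) (T_obj P), f)) ((FObj T ^^ m) (Tn 2 P)) \<and>
      (FMap T ^^ m) (alg_q X S \<delta> 2 P 0) \<cdot>\<^bsub>Alg\<^esub> x = (B, (T_obj ^^ m) (T_obj P), f) \<and>
      (FMap T ^^ m) (alg_q X S \<delta> 2 P 1) \<cdot>\<^bsub>Alg\<^esub> x = (B, (T_obj ^^ m) (T_obj P), g)"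
    then obtain v where v: "x = (B, (T_obj ^^ m) (Tn 2 P), v)" "alg_hom B ((T_obj ^^ m) (Tn 2 P)) v"
      by (auto simp: hom_Alg)
    have "?q 0 \<cdot> v = f" "?q 1 \<cdot> v = g"
      using x v by (simp_all add: q_eq')
    then have "v = u"
      using mono alg_hom_in_hom[OF v(2)] u qu two unfolding jointly_monic_def by metis
    then show "x = (B, (T_obj ^^ m) (Tn 2 P), u)"
      using v by simp
  qed (use f hom P qu in \<open>simp_all add: q_eq'\<close>)
qed

text \<open>Two tangent vectors over a common base point are combined by listing that point once,
  followed by both vectors.\<close>

lemma tan_pair_0:
  assumes P: "P \<in> algs" and f: "alg_hom B (T_obj P) f" and g: "alg_hom B (T_obj P) g"
    and eq: "Pr X [fst P, fst P] 0 \<cdot> f = Pr X [fst P, fst P] 0 \<cdot> g"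
  defines "u \<equiv> tup X [Pr X [fst P, fst P] 0 \<cdot> f, Pr X [fst P, fst P] (Suc 0) \<cdot> f, Pr X [fst P, fst P] (Suc 0) \<cdot> g]"
  shows "tan_pair Alg T Tn (alg_q X S \<delta>) 0 P (B, T_obj P, f) (B, T_obj P, g) = (B, Tn 2 P, u)"
    and "alg_hom B (Tn 2 P) u"
proof -
  have fst: "fst (Tn 2 P) = Bip X [fst P, fst P, fst P]"
    by simp
  note f' = alg_homD(3-5)[OF f] and g' = alg_homD(3-5)[OF g]
  have "u \<in> hom X (fst B) (fst ((T_obj ^^ 0) (Tn 2 P)))"
    using P f' g' by (simp add: u_def in_hom_iff fst)
  note * = tan_pair_eq[where m = 0, OF P _ _ this, of f g]
  have "tup X [Pr X [fst P, fst P, fst P] 0, Pr X [fst P, fst P, fst P] (Suc 0)] \<cdot> u = f"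
    "tup X [Pr X [fst P, fst P, fst P] 0, Pr X [fst P, fst P, fst P] (Suc 1)] \<cdot> u = g"
    using P f' g' tup_eta[of f "fst P" "fst P"] tup_eta[of g "fst P" "fst P"] eq by (simp_all add: u_def)
  then show "tan_pair Alg T Tn (alg_q X S \<delta>) 0 P (B, T_obj P, f) (B, T_obj P, g) = (B, Tn 2 P, u)"
    and "alg_hom B (Tn 2 P) u"
    using * f g by simp_all
qed

lemma tup_pr4_eta:
  assumes "f \<in> Arr X" "Cod X f = Bip X [Bip X [A, A], Bip X [A, A]]" "A \<in> Obj X"
  shows "tup X [pr4 X A 0 \<cdot> f, pr4 X A (Suc 0) \<cdot> f] = Pr X [Bip X [A, A], Bip X [A, A]] 0 \<cdot> f"
    "tup X [pr4 X A 2 \<cdot> f, pr4 X A 3 \<cdot> f] = Pr X [Bip X [A, A], Bip X [A, A]] (Suc 0) \<cdot> f"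
  by (rule Bip2_eqI[of _ _ A A]; use assms in \<open>simp add: pr4_def\<close>)+

text \<open>\<open>T\<close> of the projection to the base reads off coordinates 0 and 2, so these
  must agree. The pairing is formed separately in the two blocks of three, one per copy of the
  threefold product.\<close>

lemma tan_pair_1:
  assumes P: "P \<in> algs" and f: "alg_hom B (T_obj (T_obj P)) f" and g: "alg_hom B (T_obj (T_obj P)) g"
    and eq: "pr4 X (fst P) 0 \<cdot> f = pr4 X (fst P) 0 \<cdot> g" "pr4 X (fst P) 2 \<cdot> f = pr4 X (fst P) 2 \<cdot> g"
  defines "u \<equiv> tup X [tup X [pr4 X (fst P) 0 \<cdot> f, pr4 X (fst P) (Suc 0) \<cdot> f, pr4 X (fst P) (Suc 0) \<cdot> g],
    tup X [pr4 X (fst P) 2 \<cdot> f, pr4 X (fst P) 3 \<cdot> f, pr4 X (fst P) 3 \<cdot> g]]"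
  shows "tan_pair Alg T Tn (alg_q X S \<delta>) 1 P (B, T_obj (T_obj P), f) (B, T_obj (T_obj P), g) = (B, T_obj (Tn 2 P), u)"
    and "alg_hom B (T_obj (Tn 2 P)) u"
proof -
  have fst: "fst (Tn 2 P) = Bip X [fst P, fst P, fst P]"
    by simp
  note f' = alg_homD(3-5)[OF f] and g' = alg_homD(3-5)[OF g]
  have "u \<in> hom X (fst B) (fst ((T_obj ^^ 1) (Tn 2 P)))"
    using P f' g' by (simp add: u_def in_hom_iff fst)
  note * = tan_pair_eq[where m = 1, OF P _ _ this, of f g]
  have "FMap (square X) (tup X [Pr X [fst P, fst P, fst P] 0, Pr X [fst P, fst P, fst P] (Suc 0)]) \<cdot> u = f"
    using P f' g'
    by (subst square_comp_eq_iff[of _ "Bip X [fst P, fst P, fst P]" "Bip X [fst P, fst P]" _ "fst B"])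
      (simp_all add: u_def in_hom_iff tup_pr4_eta)
  moreover have "FMap (square X) (tup X [Pr X [fst P, fst P, fst P] 0, Pr X [fst P, fst P, fst P] (Suc 1)]) \<cdot> u = g"
    using P f' g' eq
    by (subst square_comp_eq_iff[of _ "Bip X [fst P, fst P, fst P]" "Bip X [fst P, fst P]" _ "fst B"])
      (simp_all add: u_def in_hom_iff tup_pr4_eta)
  ultimately show "tan_pair Alg T Tn (alg_q X S \<delta>) 1 P (B, T_obj (T_obj P), f) (B, T_obj (T_obj P), g) = (B, T_obj (Tn 2 P), u)"
    and "alg_hom B (T_obj (Tn 2 P)) u"
    using * f g by simp_all
qed

text \<open>The underlying maps of \<open>c\<close> and \<open>l\<close> get their own names so that
  they can stay folded while their action on tuples (\<open>flip_tup\<close>,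
  \<open>vlift_tup\<close>) is used for rewriting.\<close>

definition flip where
  "flip A = tup4 X (pr4 X A 0) (pr4 X A 2) (pr4 X A 1) (pr4 X A 3)"

definition vlift where
  "vlift A = tup4 X (Pr X [A, A] 0) (zero_map X (Bip X [A, A]) A) (zero_map X (Bip X [A, A]) A)
    (Pr X [A, A] (Suc 0))"

lemma flip_simps [simp]:
  assumes "A \<in> Obj X"
  shows "flip A \<in> Arr X" "Dom X (flip A) = Bip X [Bip X [A, A], Bip X [A, A]]"
    "Cod X (flip A) = Bip X [Bip X [A, A], Bip X [A, A]]"
  using assms by (simp_all add: flip_def)

lemma vlift_simps [simp]:
  assumes "A \<in> Obj X"
  shows "vlift A \<in> Arr X" "Dom X (vlift A) = Bip X [A, A]"
    "Cod X (vlift A) = Bip X [Bip X [A, A], Bip X [A, A]]"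
  using assms by (simp_all add: vlift_def)

lemma flip_tup:
  assumes "a \<in> Arr X" "b \<in> Arr X" "c \<in> Arr X" "d \<in> Arr X"
    "Dom X a = Dom X d" "Dom X b = Dom X d" "Dom X c = Dom X d"
    "Cod X a = A" "Cod X b = A" "Cod X c = A" "Cod X d = A"
  shows "flip A \<cdot> tup X [tup X [a, b], tup X [c, d]] = tup X [tup X [a, c], tup X [b, d]]"
proof -
  have "A \<in> Obj X" using assms by auto
  then show ?thesis
    using assms unfolding tup4_def[symmetric] by (simp add: flip_def)
qed

lemma vlift_tup:
  assumes "a \<in> Arr X" "b \<in> Arr X" "Dom X a = D" "Dom X b = D" "Cod X a = A" "Cod X b = A"
  shows "vlift A \<cdot> tup X [a, b] = tup X [tup X [a, zero_map X D A], tup X [zero_map X D A, b]]"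
proof -
  have "A \<in> Obj X" "D \<in> Obj X" using assms by auto
  then show ?thesis
    using assms by (simp add: vlift_def tup4_def)
qed

subsection \<open>The structure maps\<close>

abbreviation q where "q \<equiv> alg_q X S \<delta>"

lemma fst_Tn_2_3 [simp]:
  "fst (Tn 2 P) = Bip X [fst P, fst P, fst P]" "fst (Tn 3 P) = Bip X [fst P, fst P, fst P, fst P]"
  by simp_all

lemma q_2_3 [simp]:
  "q 2 P 0 = (Tn 2 P, T_obj P, tup X [Pr X [fst P, fst P, fst P] 0, Pr X [fst P, fst P, fst P] (Suc 0)])"
  "q 2 P (Suc 0) = (Tn 2 P, T_obj P, tup X [Pr X [fst P, fst P, fst P] 0, Pr X [fst P, fst P, fst P] 2])"
  "q 3 P 0 = (Tn 3 P, T_obj P,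
    tup X [Pr X [fst P, fst P, fst P, fst P] 0, Pr X [fst P, fst P, fst P, fst P] (Suc 0)])"
  "q 3 P (Suc 0) = (Tn 3 P, T_obj P,
    tup X [Pr X [fst P, fst P, fst P, fst P] 0, Pr X [fst P, fst P, fst P, fst P] 2])"
  "q 3 P 2 = (Tn 3 P, T_obj P,
    tup X [Pr X [fst P, fst P, fst P, fst P] 0, Pr X [fst P, fst P, fst P, fst P] 3])"
  by (simp_all add: q_eq numeral_2_eq_2[symmetric] numeral_3_eq_3[symmetric])

lemma alg_hom_q_2_3:
  assumes P: "P \<in> algs"
  shows "alg_hom (Tn 2 P) (T_obj P) (tup X [Pr X [fst P, fst P, fst P] 0, Pr X [fst P, fst P, fst P] (Suc 0)])"
    "alg_hom (Tn 2 P) (T_obj P) (tup X [Pr X [fst P, fst P, fst P] 0, Pr X [fst P, fst P, fst P] 2])"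
    "alg_hom (Tn 3 P) (T_obj P)
      (tup X [Pr X [fst P, fst P, fst P, fst P] 0, Pr X [fst P, fst P, fst P, fst P] (Suc 0)])"
    "alg_hom (Tn 3 P) (T_obj P)
      (tup X [Pr X [fst P, fst P, fst P, fst P] 0, Pr X [fst P, fst P, fst P, fst P] 2])"
    "alg_hom (Tn 3 P) (T_obj P)
      (tup X [Pr X [fst P, fst P, fst P, fst P] 0, Pr X [fst P, fst P, fst P, fst P] 3])"
  using alg_hom_q[OF P, of 0 2] alg_hom_q[OF P, of 1 2] alg_hom_q[OF P, of 0 3]
    alg_hom_q[OF P, of 1 3] alg_hom_q[OF P, of 2 3]
  by (simp_all add: numeral_2_eq_2[symmetric] numeral_3_eq_3[symmetric])

lemma structure_maps [simp]:
  "alg_p X S \<delta> P = (T_obj P, P, Pr X [fst P, fst P] 0)"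
  "alg_s X S \<delta> P = (Tn 2 P, T_obj P,
    tup X [Pr X [fst P, fst P, fst P] 0, Pr X [fst P, fst P, fst P] (Suc 0) \<oplus> Pr X [fst P, fst P, fst P] 2])"
  "alg_z X S \<delta> P = (P, T_obj P, tup X [Ide X (fst P), zero_map X (fst P) (fst P)])"
  "alg_l X S \<delta> P = (T_obj P, T_obj (T_obj P), vlift (fst P))"
  "alg_c X S \<delta> P = (T_obj (T_obj P), T_obj (T_obj P), flip (fst P))"
  "alg_n X S \<delta> P = (T_obj P, T_obj P, tup X [Pr X [fst P, fst P] 0, neg_map X (Pr X [fst P, fst P] (Suc 0))])"
  by (cases P; simp add: alg_p_def alg_s_def alg_z_def alg_l_def alg_c_def alg_n_def Let_def vlift_def flip_def)+

lemma alg_hom_vlift: "P \<in> algs \<Longrightarrow> alg_hom (T_obj P) (T_obj (T_obj P)) (vlift (fst P))"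
  unfolding vlift_def by (rule alg_hom_l)

lemma alg_hom_flip: "P \<in> algs \<Longrightarrow> alg_hom (T_obj (T_obj P)) (T_obj (T_obj P)) (flip (fst P))"
  unfolding flip_def by (rule alg_hom_c)

lemma alg_hom_s:
  assumes P: "P \<in> algs"
  shows "alg_hom (Tn 2 P) (T_obj P)
    (tup X [Pr X [fst P, fst P, fst P] 0, Pr X [fst P, fst P, fst P] (Suc 0) \<oplus> Pr X [fst P, fst P, fst P] 2])"
proof -
  let ?As = "[fst P, fst P, fst P]"
  have "snd (Tn 2 P) \<in> Arr X" "Dom X (snd (Tn 2 P)) = FObj S (Bip X ?As)" "Cod X (snd (Tn 2 P)) = Bip X ?As"
    "Pr X ?As 0 \<cdot> snd (Tn 2 P) = snd P \<cdot> FMap S (Pr X ?As 0)"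
    "Pr X ?As (Suc 0) \<cdot> snd (Tn 2 P) = deriv P (Pr X ?As 0) (Pr X ?As (Suc 0))"
    "Pr X ?As 2 \<cdot> snd (Tn 2 P) = deriv P (Pr X ?As 0) (Pr X ?As 2)"
    using Tn_struct[OF P, where n = 2] by (simp_all add: in_hom_iff)
  then show ?thesis
    using P by (intro alg_hom_TI) (simp_all add: deriv_plus[where D = "Bip X ?As"])
qed

lemma natural_AlgI:
  assumes "\<And>P. P \<in> algs \<Longrightarrow> \<tau> P \<in> hom Alg (FObj F P) (FObj G P)"
    "\<And>P Q f. alg_hom P Q f \<Longrightarrow> \<tau> Q \<cdot>\<^bsub>Alg\<^esub> FMap F (P, Q, f) = FMap G (P, Q, f) \<cdot>\<^bsub>Alg\<^esub> \<tau> P"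
  shows "natural Alg F G \<tau>"
  unfolding natural_def using assms by (auto simp: hom_Alg)

text \<open>The functor is defined by pairing the two composites with \<open>T f\<close>; in
  coordinates the pairing is \<open>f\<close> applied to the base point and to both vectors.\<close>

lemma T2_functor_map:
  assumes f: "alg_hom P Q f"
  shows "FMap (T2_functor Alg T Tn q) (P, Q, f) = (Tn 2 P, Tn 2 Q,
    tup X [f \<cdot> Pr X [fst P, fst P, fst P] 0, f \<cdot> Pr X [fst P, fst P, fst P] (Suc 0), f \<cdot> Pr X [fst P, fst P, fst P] 2])"
proof -
  note f' = alg_homD(1-5)[OF f]
  note h = alg_hom_comp[OF alg_hom_q_2_3(1)[OF f'(1)] alg_hom_square[OF f]]
    alg_hom_comp[OF alg_hom_q_2_3(2)[OF f'(1)] alg_hom_square[OF f]]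
  show ?thesis
    unfolding T2_functor_def using f' tan_pair_0(1)[OF f'(2) h] by (simp add: FMap_square)
qed

section \<open>Naturality of the structure maps\<close>

lemma p_natural: "natural Alg T id_functor (alg_p X S \<delta>)"
proof (rule natural_AlgI)
  fix P Q f assume "alg_hom P Q f"
  from alg_homD(1-5)[OF this]
  show "alg_p X S \<delta> Q \<cdot>\<^bsub>Alg\<^esub> FMap T (P, Q, f) = FMap id_functor (P, Q, f) \<cdot>\<^bsub>Alg\<^esub> alg_p X S \<delta> P"
    by (simp add: id_functor_def FMap_square)
qed (simp add: id_functor_def alg_hom_p)

lemma s_natural: "natural Alg (T2_functor Alg T Tn q) T (alg_s X S \<delta>)"
proof (rule natural_AlgI)
  fix P Q f assume f: "alg_hom P Q f"
  from alg_homD(1-5)[OF this]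
  show "alg_s X S \<delta> Q \<cdot>\<^bsub>Alg\<^esub> FMap (T2_functor Alg T Tn q) (P, Q, f) = FMap T (P, Q, f) \<cdot>\<^bsub>Alg\<^esub> alg_s X S \<delta> P"
    by (simp add: T2_functor_map[OF f] FMap_square)
qed (simp add: T2_functor_def alg_hom_s)

lemma z_natural: "natural Alg id_functor T (alg_z X S \<delta>)"
proof (rule natural_AlgI)
  fix P Q f assume "alg_hom P Q f"
  from alg_homD(1-5)[OF this]
  show "alg_z X S \<delta> Q \<cdot>\<^bsub>Alg\<^esub> FMap id_functor (P, Q, f) = FMap T (P, Q, f) \<cdot>\<^bsub>Alg\<^esub> alg_z X S \<delta> P"
    by (simp add: id_functor_def FMap_square)
qed (simp add: id_functor_def alg_hom_z)

lemma l_natural: "natural Alg T (comp_functor T T) (alg_l X S \<delta>)"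
proof (rule natural_AlgI)
  fix P Q f assume "alg_hom P Q f"
  from alg_homD(1-5)[OF this]
  show "alg_l X S \<delta> Q \<cdot>\<^bsub>Alg\<^esub> FMap T (P, Q, f) = FMap (comp_functor T T) (P, Q, f) \<cdot>\<^bsub>Alg\<^esub> alg_l X S \<delta> P"
    by (simp add: comp_functor_def FMap_square vlift_def tup4_def)
qed (simp add: comp_functor_def alg_hom_vlift)

lemma c_natural: "natural Alg (comp_functor T T) (comp_functor T T) (alg_c X S \<delta>)"
proof (rule natural_AlgI)
  fix P Q f assume "alg_hom P Q f"
  from alg_homD(1-5)[OF this]
  show "alg_c X S \<delta> Q \<cdot>\<^bsub>Alg\<^esub> FMap (comp_functor T T) (P, Q, f)
      = FMap (comp_functor T T) (P, Q, f) \<cdot>\<^bsub>Alg\<^esub> alg_c X S \<delta> P"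
    by (simp add: comp_functor_def FMap_square flip_def tup4_def pr4_def)
qed (simp add: comp_functor_def alg_hom_flip)

lemma monoid:
  assumes P: "P \<in> algs"
  shows "commutative_monoid_over Alg P (T_obj P) (alg_p X S \<delta> P) (tan_pair Alg T Tn q 0 P)
    (q 2 P 0) (q 2 P 1) (q 3 P 0) (q 3 P 1) (q 3 P 2) (alg_s X S \<delta> P) (alg_z X S \<delta> P)"
proof -
  let ?A = "fst P"
  let ?B = "Bip X [?A, ?A]"
  let ?p = "Pr X [?A, ?A]" and ?r = "Pr X [?A, ?A, ?A, ?A]" and ?pair = "tan_pair Alg T Tn q 0 P"
  note h = alg_hom_q_2_3[OF P]
  have zp: "alg_hom (T_obj P) (T_obj P) (tup X [?p 0, zero_map X ?B ?A])"
    using alg_hom_comp[OF alg_hom_p[OF P] alg_hom_z[OF P]] P by simp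
  have id: "alg_hom (T_obj P) (T_obj P) (Ide X ?B)"
    using alg_hom_ide[of "T_obj P"] P by simp
  \<comment> \<open>The partial sums of three tangent vectors are needed as homomorphisms, since
    \<open>tan_pair_0\<close> only evaluates pairings of maps of algebras.\<close>
  have s01: "alg_hom (Tn 3 P) (T_obj P) (tup X [?r 0, ?r (Suc 0) \<oplus> ?r 2])"
    using alg_hom_comp[OF tan_pair_0(2)[OF P h(3,4)] alg_hom_s[OF P]] P by simp
  have s12: "alg_hom (Tn 3 P) (T_obj P) (tup X [?r 0, ?r 2 \<oplus> ?r 3])"
    using alg_hom_comp[OF tan_pair_0(2)[OF P h(4,5)] alg_hom_s[OF P]] P by simp
  show ?thesis
    unfolding commutative_monoid_over_def
    using P tan_pair_0(1)[OF P h(3,4)] tan_pair_0(1)[OF P h(4,5)] tan_pair_0(1)[OF P s01 h(5)]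
      tan_pair_0(1)[OF P h(3) s12] tan_pair_0(1)[OF P id zp] tan_pair_0(1)[OF P zp id]
      tan_pair_0(1)[OF P h(2,1)]
    by (simp add: plus_assoc plus_commute[of "Pr X [?A, ?A, ?A] 2" "Pr X [?A, ?A, ?A] (Suc 0)"])
qed

section \<open>Compatibilities between projection, zero, sum, lift and flip\<close>

lemma c_p:
  assumes "P \<in> algs"
  shows "alg_p X S \<delta> (T_obj P) \<cdot>\<^bsub>Alg\<^esub> alg_c X S \<delta> P = FMap T (alg_p X S \<delta> P)"
  using assms by (simp add: FMap_square flip_def vlift_def tup4_def pr4_def)

lemma l_p:
  assumes "P \<in> algs"
  shows "FMap T (alg_p X S \<delta> P) \<cdot>\<^bsub>Alg\<^esub> alg_l X S \<delta> P = alg_z X S \<delta> P \<cdot>\<^bsub>Alg\<^esub> alg_p X S \<delta> P"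
  using assms by (simp add: FMap_square vlift_def tup4_def)

lemma l_z:
  assumes "P \<in> algs"
  shows "alg_l X S \<delta> P \<cdot>\<^bsub>Alg\<^esub> alg_z X S \<delta> P = FMap T (alg_z X S \<delta> P) \<cdot>\<^bsub>Alg\<^esub> alg_z X S \<delta> P"
  using assms by (simp add: FMap_square vlift_def tup4_def)

lemma c_z:
  assumes "P \<in> algs"
  shows "alg_c X S \<delta> P \<cdot>\<^bsub>Alg\<^esub> FMap T (alg_z X S \<delta> P) = alg_z X S \<delta> (T_obj P)"
  using assms
  by (simp add: FMap_square flip_def vlift_def pr4_def tup4_def tup_zero)

lemma c_c:
  assumes "P \<in> algs"
  shows "alg_c X S \<delta> P \<cdot>\<^bsub>Alg\<^esub> alg_c X S \<delta> P = Ide Alg (FObj T (FObj T P))"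
  using assms by (simp add: flip_def)

lemma c_l:
  assumes "P \<in> algs"
  shows "alg_c X S \<delta> P \<cdot>\<^bsub>Alg\<^esub> alg_l X S \<delta> P = alg_l X S \<delta> P"
  using assms by (simp add: flip_def vlift_def)

lemma l_l:
  assumes "P \<in> algs"
  shows "FMap T (alg_l X S \<delta> P) \<cdot>\<^bsub>Alg\<^esub> alg_l X S \<delta> P = alg_l X S \<delta> (T_obj P) \<cdot>\<^bsub>Alg\<^esub> alg_l X S \<delta> P"
  using assms by (simp add: FMap_square vlift_def tup4_def tup_zero)

lemma l_s:
  assumes P: "P \<in> algs"
  shows "alg_l X S \<delta> P \<cdot>\<^bsub>Alg\<^esub> alg_s X S \<delta> P = FMap T (alg_s X S \<delta> P) \<cdot>\<^bsub>Alg\<^esub>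
    tan_pair Alg T Tn q 1 P (alg_l X S \<delta> P \<cdot>\<^bsub>Alg\<^esub> q 2 P 0) (alg_l X S \<delta> P \<cdot>\<^bsub>Alg\<^esub> q 2 P 1)"
proof -
  note h = alg_hom_q_2_3(1,2)[OF P, THEN alg_hom_comp, OF alg_hom_vlift[OF P]]
  show ?thesis
    using P tan_pair_1(1)[OF P h] by (simp add: FMap_square flip_def vlift_def tup4_def pr4_def)
qed

lemma flip_square_tup:
  assumes "f \<in> Arr X" "g \<in> Arr X" "Dom X f = D" "Dom X g = D" "Cod X f = A" "Cod X g = A"
  shows "flip A \<cdot> FMap (square X) (tup X [f, g])
    = tup X [tup X [f \<cdot> Pr X [D, D] 0, f \<cdot> Pr X [D, D] (Suc 0)],
        tup X [g \<cdot> Pr X [D, D] 0, g \<cdot> Pr X [D, D] (Suc 0)]]"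
proof -
  have "A \<in> Obj X" "D \<in> Obj X" using assms by auto
  then show ?thesis
    using assms by (simp add: FMap_square flip_def tup4_def pr4_def)
qed

lemma c_s:
  assumes P: "P \<in> algs"
  shows "alg_c X S \<delta> P \<cdot>\<^bsub>Alg\<^esub> FMap T (alg_s X S \<delta> P) = alg_s X S \<delta> (T_obj P) \<cdot>\<^bsub>Alg\<^esub>
    tan_pair Alg T Tn q 0 (T_obj P) (alg_c X S \<delta> P \<cdot>\<^bsub>Alg\<^esub> FMap T (q 2 P 0))
      (alg_c X S \<delta> P \<cdot>\<^bsub>Alg\<^esub> FMap T (q 2 P 1))"
proof -
  let ?B = "Bip X [fst P, fst P, fst P]"
  \<comment> \<open>\<open>x i k\<close> is coordinate \<open>i\<close> in the \<open>k\<close>-th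
    copy of the threefold product. The flip regroups by \<open>i\<close> what was grouped by
    \<open>k\<close>, producing tangent vectors over \<open>T_obj P\<close> that \<open>s\<close>
    can add.\<close>
  define x where "x i k = Pr X [fst P, fst P, fst P] i \<cdot> Pr X [?B, ?B] k" for i k
  have x: "x i k \<in> Arr X" "Dom X (x i k) = Bip X [?B, ?B]" "Cod X (x i k) = fst P" if "i < 3" "k < 2" for i k
    using P that by (auto simp: x_def less_Suc_eq numeral_2_eq_2 numeral_3_eq_3)
  let ?f = "\<lambda>i. tup X [tup X [x 0 0, x 0 (Suc 0)], tup X [x i 0, x i (Suc 0)]]"
  have cq: "flip (fst P) \<cdot> FMap (square X) (tup X [Pr X [fst P, fst P, fst P] 0, Pr X [fst P, fst P, fst P] (Suc 0)]) = ?f (Suc 0)"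
    "flip (fst P) \<cdot> FMap (square X) (tup X [Pr X [fst P, fst P, fst P] 0, Pr X [fst P, fst P, fst P] 2]) = ?f 2"
    using P by (subst flip_square_tup[where D = ?B]; simp add: x_def)+
  have cs: "flip (fst P) \<cdot> FMap (square X) (tup X [Pr X [fst P, fst P, fst P] 0,
      Pr X [fst P, fst P, fst P] (Suc 0) \<oplus> Pr X [fst P, fst P, fst P] 2])
    = tup X [tup X [x 0 0, x 0 (Suc 0)], tup X [x (Suc 0) 0 \<oplus> x 2 0, x (Suc 0) (Suc 0) \<oplus> x 2 (Suc 0)]]"
    using P by (subst flip_square_tup[where D = ?B]) (simp_all add: x_def)
  note h = alg_hom_q_2_3(1,2)[OF P, THEN alg_hom_square, THEN alg_hom_comp, OF alg_hom_flip[OF P], unfolded cq]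
  have "tan_pair Alg T Tn q 0 (T_obj P) (T_obj (Tn 2 P), T_obj (T_obj P), ?f (Suc 0))
      (T_obj (Tn 2 P), T_obj (T_obj P), ?f 2)
    = (T_obj (Tn 2 P), Tn 2 (T_obj P), tup X [tup X [x 0 0, x 0 (Suc 0)],
        tup X [x (Suc 0) 0, x (Suc 0) (Suc 0)], tup X [x 2 0, x 2 (Suc 0)]])"
    using tan_pair_0(1)[OF T_obj_algs[OF P] h] P x by simp
  then show ?thesis
    using P x cq cs by (simp add: tup_plus)
qed

lemma c_c_l:
  assumes "P \<in> algs"
  shows "alg_c X S \<delta> (T_obj P) \<cdot>\<^bsub>Alg\<^esub> FMap T (alg_c X S \<delta> P) \<cdot>\<^bsub>Alg\<^esub> alg_l X S \<delta> (T_obj P)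
    = FMap T (alg_l X S \<delta> P) \<cdot>\<^bsub>Alg\<^esub> alg_c X S \<delta> P"
proof -
  define A where "A = fst P"
  define B where "B = Bip X [A, A]"
  define D where "D = Bip X [B, B]"
  have obj: "A \<in> Obj X" "B \<in> Obj X" "D \<in> Obj X"
    using assms by (simp_all add: A_def B_def D_def)
  \<comment> \<open>Splitting the identity of \<open>D\<close> into components yields a generic
    element; evaluating both sides on it and cancelling the identity gives the equation of
    maps.\<close>
  have "Ide X D \<in> hom X D (Bip X [B, B])"
    using obj by (simp add: in_hom_iff, simp add: D_def)
  from Bip2_cases[OF this obj(2,2)]
  obtain u v where uv: "Ide X D = tup X [u, v]" "u \<in> hom X D (Bip X [A, A])" "v \<in> hom X D (Bip X [A, A])"
    unfolding B_def .
  from Bip2_cases[OF uv(2) obj(1,1)]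
  obtain a b where ab: "u = tup X [a, b]" "a \<in> hom X D A" "b \<in> hom X D A" .
  from Bip2_cases[OF uv(3) obj(1,1)]
  obtain c d where cd: "v = tup X [c, d]" "c \<in> hom X D A" "d \<in> hom X D A" .
  have z: "zero_map X D B = tup X [zero_map X D A, zero_map X D A]"
    using obj by (simp add: tup_zero B_def)
  have "(flip B \<cdot> (FMap (square X) (flip A) \<cdot> vlift B)) \<cdot> Ide X D = (FMap (square X) (vlift A) \<cdot> flip A) \<cdot> Ide X D"
    unfolding uv(1) ab(1) cd(1) using obj ab(2,3) cd(2,3)
    by (simp add: in_hom_iff B_def[symmetric] D_def[symmetric] flip_tup vlift_tup square_tup z)
  then have "flip B \<cdot> (FMap (square X) (flip A) \<cdot> vlift B) = FMap (square X) (vlift A) \<cdot> flip A"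
    using obj by (simp add: B_def[symmetric] D_def[symmetric])
  then show ?thesis
    using assms by (simp add: A_def B_def)
qed

text \<open>The eight coordinates are indexed by three binary positions. \<open>flip B\<close>
  exchanges the outer and middle positions, and the square of \<open>flip A\<close> exchanges the
  middle and inner ones; the claim is the braid relation of these transpositions, verified on a
  generic element.\<close>

lemma c_c_c:
  assumes "P \<in> algs"
  shows "FMap T (alg_c X S \<delta> P) \<cdot>\<^bsub>Alg\<^esub> alg_c X S \<delta> (T_obj P) \<cdot>\<^bsub>Alg\<^esub> FMap T (alg_c X S \<delta> P)
    = alg_c X S \<delta> (T_obj P) \<cdot>\<^bsub>Alg\<^esub> FMap T (alg_c X S \<delta> P) \<cdot>\<^bsub>Alg\<^esub> alg_c X S \<delta> (T_obj P)"
proof -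
  define A where "A = fst P"
  define B where "B = Bip X [A, A]"
  define C where "C = Bip X [B, B]"
  define D where "D = Bip X [C, C]"
  have obj: "A \<in> Obj X" "B \<in> Obj X" "C \<in> Obj X" "D \<in> Obj X"
    using assms by (simp_all add: A_def B_def C_def D_def)
  have "Ide X D \<in> hom X D (Bip X [C, C])"
    using obj by (simp add: in_hom_iff, simp add: D_def)
  from Bip2_cases[OF this obj(3,3)]
  obtain u v where uv: "Ide X D = tup X [u, v]" "u \<in> hom X D C" "v \<in> hom X D C" .
  from Bip4_cases[OF uv(2)[unfolded C_def B_def] obj(1)]
  obtain a b c d where ad: "u = tup X [tup X [a, b], tup X [c, d]]"
    "a \<in> hom X D A" "b \<in> hom X D A" "c \<in> hom X D A" "d \<in> hom X D A" .
  from Bip4_cases[OF uv(3)[unfolded C_def B_def] obj(1)]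
  obtain e f g h where eh: "v = tup X [tup X [e, f], tup X [g, h]]"
    "e \<in> hom X D A" "f \<in> hom X D A" "g \<in> hom X D A" "h \<in> hom X D A" .
  have "(FMap (square X) (flip A) \<cdot> (flip B \<cdot> FMap (square X) (flip A))) \<cdot> Ide X D
    = (flip B \<cdot> (FMap (square X) (flip A) \<cdot> flip B)) \<cdot> Ide X D"
    unfolding uv(1) ad(1) eh(1) using obj ad(2-) eh(2-)
    by (simp add: in_hom_iff B_def[symmetric] C_def[symmetric] D_def[symmetric] flip_tup square_tup)
  then have "FMap (square X) (flip A) \<cdot> (flip B \<cdot> FMap (square X) (flip A))
    = flip B \<cdot> (FMap (square X) (flip A) \<cdot> flip B)"
    using obj by (simp add: B_def[symmetric] C_def[symmetric] D_def[symmetric])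
  then show ?thesis
    using assms by (simp add: A_def B_def)
qed

subsection \<open>Universality of the vertical lift\<close>

text \<open>On elements, \<open>(a, b, c, d)\<close> equalizes the two maps exactly when
  \<open>c\<close> vanishes, and the remaining three entries are free.\<close>

lemma lift_universal_underlying:
  assumes A: "A \<in> Obj X"
  defines "z \<equiv> zero_map X (Bip X [A, A, A]) A"
  shows "is_equalizer X (Bip X [A, A, A]) (Bip X [Bip X [A, A], Bip X [A, A]]) (Bip X [A, A])
    (tup X [tup X [Pr X [A, A, A] 0, Pr X [A, A, A] 2], tup X [z, Pr X [A, A, A] (Suc 0)]])
    (FMap (square X) (Pr X [A, A] 0)) (tup X [Ide X A, zero_map X A A] \<cdot> (Pr X [A, A] 0 \<cdot> Pr X [Bip X [A, A], Bip X [A, A]] 0))"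
    (is "is_equalizer X ?E ?BB ?B ?e ?f ?g")
proof -
  have z: "z \<in> Arr X" "Dom X z = ?E" "Cod X z = A"
    using A by (simp_all add: z_def)
  have e: "?e \<in> hom X ?E ?BB" and f: "?f \<in> hom X ?BB ?B" and g: "?g \<in> hom X ?BB ?B"
    using A z by (simp_all add: in_hom_iff)
  have "?f \<cdot> ?e = ?g \<cdot> ?e"
    using A z by (simp add: square_tup) (simp add: z_def)
  moreover have "\<exists>!u. u \<in> hom X D ?E \<and> ?e \<cdot> u = h"
    if D: "D \<in> Obj X" and h: "h \<in> hom X D ?BB" and eq: "?f \<cdot> h = ?g \<cdot> h" for D h
  proof -
    from Bip4_cases[OF h A] obtain a b c d where h': "h = tup X [tup X [a, b], tup X [c, d]]"
      and abcd: "a \<in> hom X D A" "b \<in> hom X D A" "c \<in> hom X D A" "d \<in> hom X D A" .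
    have eqc: "tup X [a, c] = tup X [a, zero_map X D A]"
      using eq A D abcd unfolding h' by (simp add: in_hom_iff square_tup)
    have "Pr X [A, A] (Suc 0) \<cdot> tup X [a, c] = Pr X [A, A] (Suc 0) \<cdot> tup X [a, zero_map X D A]"
      unfolding eqc ..
    then have c: "c = zero_map X D A"
      using D A abcd by (simp add: in_hom_iff)
    show ?thesis
    \<comment> \<open>The map \<open>?e\<close> places its third coordinate beside the base point
      and its second one last; so \<open>b\<close> goes to the third place and \<open>d\<close> to
      the second.\<close>
    proof (rule ex1I[of _ "tup X [a, d, b]"])
      show "tup X [a, d, b] \<in> hom X D ?E \<and> ?e \<cdot> tup X [a, d, b] = h"
        unfolding h' c using D A abcd by (simp add: in_hom_iff z_def)
    next
      fix u assume u: "u \<in> hom X D ?E \<and> ?e \<cdot> u = h"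
      then have u': "u \<in> Arr X" "Dom X u = D" "Cod X u = ?E"
        by (simp_all add: in_hom_iff)
      have eu: "pr4 X A i \<cdot> (?e \<cdot> u) = pr4 X A i \<cdot> h" for i
        using u by simp
      have ar: "a \<in> Arr X" "Dom X a = D" "Cod X a = A" "b \<in> Arr X" "Dom X b = D" "Cod X b = A"
        "d \<in> Arr X" "Dom X d = D" "Cod X d = A"
        using abcd by (simp_all add: in_hom_iff)
      \<comment> \<open>Coordinates 0, 1 and 3 of \<open>?e\<close> are the three projections in
        some order, and coordinate 2 is constantly zero.\<close>
      have "Pr X [A, A, A] 0 \<cdot> u = a" "Pr X [A, A, A] 2 \<cdot> u = b" "Pr X [A, A, A] (Suc 0) \<cdot> u = d"
        using eu[of 0] eu[of 1] eu[of 3] A D u' z ar unfolding h' c tup4_def[symmetric]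
        by simp_all
      note Pru = this
      show "u = tup X [a, d, b]"
        by (rule Bip3_eqI[of _ _ A A A]) (use A u' ar Pru in simp_all)
    qed
  qed
  ultimately show ?thesis
    unfolding is_equalizer_def using e f g by blast
qed

text \<open>For \<open>(a, v, w)\<close>, the lift of \<open>v\<close> is
  \<open>(a, 0, 0, v)\<close> and the zero over \<open>(a, w)\<close> is
  \<open>(a, w, 0, 0)\<close>. Adding them by \<open>T\<close> of the sum gives
  \<open>(a, w, 0, v)\<close>, so the map is the one treated in \<open>X\<close>, and
  \<open>equalizer_reflected\<close> transfers its universal property.\<close>

lemma lift_universal:
  assumes P: "P \<in> algs"
  shows "is_equalizer Alg (Tn 2 P) (FObj T (FObj T P)) (FObj T P)
    (FMap T (alg_s X S \<delta> P) \<cdot>\<^bsub>Alg\<^esub>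
      tan_pair Alg T Tn q 1 P (alg_l X S \<delta> P \<cdot>\<^bsub>Alg\<^esub> q 2 P 0) (alg_z X S \<delta> (FObj T P) \<cdot>\<^bsub>Alg\<^esub> q 2 P 1))
    (FMap T (alg_p X S \<delta> P)) (alg_z X S \<delta> P \<cdot>\<^bsub>Alg\<^esub> alg_p X S \<delta> P \<cdot>\<^bsub>Alg\<^esub> alg_p X S \<delta> (FObj T P))"
proof -
  define A where "A = fst P"
  have A: "A \<in> Obj X" using P by (simp add: A_def)
  let ?E = "Bip X [A, A, A]" and ?B = "Bip X [A, A]"
  let ?z = "zero_map X ?E A"
  let ?p = "Pr X [A, A, A]"
  let ?e = "tup X [tup X [?p 0, ?p 2], tup X [?z, ?p (Suc 0)]]"
  let ?l = "tup X [tup X [?p 0, ?z], tup X [?z, ?p (Suc 0)]]"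
  let ?m = "tup X [tup X [?p 0, ?p 2], tup X [?z, ?z]]"
  have l: "vlift A \<cdot> tup X [?p 0, ?p (Suc 0)] = ?l"
    using A by (subst vlift_tup) simp_all
  have m: "tup X [Ide X ?B, zero_map X ?B ?B] \<cdot> tup X [?p 0, ?p 2] = ?m"
    using A by (simp add: tup_zero)
  have hl: "alg_hom (Tn 2 P) (T_obj (T_obj P)) ?l"
    using alg_hom_comp[OF alg_hom_q_2_3(1)[OF P] alg_hom_vlift[OF P]] l by (simp add: A_def)
  have hm: "alg_hom (Tn 2 P) (T_obj (T_obj P)) ?m"
    using alg_hom_comp[OF alg_hom_q_2_3(2)[OF P] alg_hom_z[OF T_obj_algs[OF P]]] P m
    unfolding fst_T_obj[OF P] by (simp only: A_def)
  have x: "pr4 X A 0 \<cdot> ?l = ?p 0" "pr4 X A (Suc 0) \<cdot> ?l = ?z" "pr4 X A 2 \<cdot> ?l = ?z" "pr4 X A 3 \<cdot> ?l = ?p (Suc 0)"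
    "pr4 X A 0 \<cdot> ?m = ?p 0" "pr4 X A (Suc 0) \<cdot> ?m = ?p 2" "pr4 X A 2 \<cdot> ?m = ?z" "pr4 X A 3 \<cdot> ?m = ?z"
    using A unfolding tup4_def[symmetric] by simp_all
  have eq: "pr4 X (fst P) 0 \<cdot> ?l = pr4 X (fst P) 0 \<cdot> ?m" "pr4 X (fst P) 2 \<cdot> ?l = pr4 X (fst P) 2 \<cdot> ?m"
    unfolding A_def[symmetric] x by simp_all
  have pair: "tan_pair Alg T Tn q 1 P (alg_l X S \<delta> P \<cdot>\<^bsub>Alg\<^esub> q 2 P 0) (alg_z X S \<delta> (FObj T P) \<cdot>\<^bsub>Alg\<^esub> q 2 P 1)
    = (Tn 2 P, T_obj (Tn 2 P), tup X [tup X [?p 0, ?z, ?p 2], tup X [?z, ?p (Suc 0), ?z]])"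
    using tan_pair_1(1)[OF P hl hm eq] P l m unfolding A_def[symmetric] x
    by (simp add: A_def[symmetric] del: tup2_comp)
  have se: "FMap (square X) (tup X [?p 0, ?p (Suc 0) \<oplus> ?p 2]) \<cdot> tup X [tup X [?p 0, ?z, ?p 2], tup X [?z, ?p (Suc 0), ?z]] = ?e"
    using A by (subst square_tup) simp_all
  have e: "FMap T (alg_s X S \<delta> P) \<cdot>\<^bsub>Alg\<^esub>
      tan_pair Alg T Tn q 1 P (alg_l X S \<delta> P \<cdot>\<^bsub>Alg\<^esub> q 2 P 0) (alg_z X S \<delta> (FObj T P) \<cdot>\<^bsub>Alg\<^esub> q 2 P 1)
    = (Tn 2 P, T_obj (T_obj P), ?e)"
    unfolding pair using se by (simp add: A_def)
  have he: "alg_hom (Tn 2 P) (T_obj (T_obj P)) ?e"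
    using alg_hom_comp[OF tan_pair_1(2)[OF P hl hm eq] alg_hom_square[OF alg_hom_s[OF P]]]
    unfolding A_def[symmetric] x se .
  have p: "FMap T (alg_p X S \<delta> P) = (T_obj (T_obj P), T_obj P, FMap (square X) (Pr X [A, A] 0))"
    by (simp add: A_def)
  have zpp: "alg_z X S \<delta> P \<cdot>\<^bsub>Alg\<^esub> alg_p X S \<delta> P \<cdot>\<^bsub>Alg\<^esub> alg_p X S \<delta> (FObj T P) = (T_obj (T_obj P), T_obj P,
    tup X [Ide X A, zero_map X A A] \<cdot> (Pr X [A, A] 0 \<cdot> Pr X [?B, ?B] 0))"
    using P by (simp add: A_def)
  have hzpp: "alg_hom (T_obj (T_obj P)) (T_obj P)
      (tup X [Ide X A, zero_map X A A] \<cdot> (Pr X [A, A] 0 \<cdot> Pr X [?B, ?B] 0))"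
    using alg_hom_comp[OF alg_hom_comp[OF alg_hom_p[OF T_obj_algs[OF P]] alg_hom_p[OF P]] alg_hom_z[OF P]]
    unfolding fst_T_obj[OF P] A_def .
  show ?thesis
    unfolding e p zpp unfolding FObj_T
  proof (rule equalizer_reflected)
    show "is_equalizer X (fst (Tn 2 P)) (fst (T_obj (T_obj P))) (fst (T_obj P)) (und (Tn 2 P, T_obj (T_obj P), ?e))
      (und (T_obj (T_obj P), T_obj P, FMap (square X) (Pr X [A, A] 0)))
      (und (T_obj (T_obj P), T_obj P, tup X [Ide X A, zero_map X A A] \<cdot> (Pr X [A, A] 0 \<cdot> Pr X [?B, ?B] 0)))"
      using lift_universal_underlying[OF A] P unfolding und_triple by (simp add: A_def del: tup2_comp)
  qed (use he hzpp alg_hom_square[OF alg_hom_p[OF P]] in \<open>simp_all add: A_def\<close>)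
qed

subsection \<open>Finite products\<close>

lemma product_exists:
  assumes As: "set As \<subseteq> algs"
  obtains P pr where "is_product Alg As P pr" "is_product X (map fst As) (fst P) (\<lambda>i. und (pr i))"
    "P \<in> algs" "\<forall>i < length As. pr i \<in> hom Alg P (As ! i)"
proof -
  let ?Bs = "map fst As"
  note Bs = set_fst_algs[OF As]
  note prod = bip_product[OF Bs]
  have Pr: "Pr X ?Bs i \<in> Arr X \<and> Dom X (Pr X ?Bs i) = Bip X ?Bs \<and> Cod X (Pr X ?Bs i) = fst (As ! i)"
    if "i < length As" for i
    using Bs that by simp
  have algs: "As ! i \<in> algs" if "i < length As" for i
    using As that by auto
  \<comment> \<open>The equations demanded of \<open>r\<close> say precisely that the projections
    respect the structures, so \<open>r\<close> is forced as the mediating map of this cone.\<close>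
  have "\<exists>!r. r \<in> hom X (FObj S (Bip X ?Bs)) (Bip X ?Bs) \<and>
      (\<forall>i < length ?Bs. Pr X ?Bs i \<cdot> r = snd (As ! i) \<cdot> FMap S (Pr X ?Bs i))"
    by (rule is_product_ex1[OF prod]) (use Bs Pr algs in \<open>simp_all add: in_hom_iff\<close>)
  then obtain r where r: "r \<in> hom X (FObj S (Bip X ?Bs)) (Bip X ?Bs)"
    "\<And>i. i < length As \<Longrightarrow> Pr X ?Bs i \<cdot> r = snd (As ! i) \<cdot> FMap S (Pr X ?Bs i)"
    by auto
  let ?P = "(Bip X ?Bs, r)"
  have P: "?P \<in> algs"
    by (rule algebra_lift[of _ "{..<length As}" "Pr X ?Bs" _ "(!) As"])
      (use is_product_jointly_monic[OF prod Bs] Bs Pr r algs in \<open>simp_all add: in_hom_iff\<close>)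
  let ?pr = "\<lambda>i. (?P, As ! i, Pr X ?Bs i)"
  have pr: "?pr i \<in> hom Alg ?P (As ! i)" if "i < length As" for i
    using P algs[OF that] Pr[OF that] r(2)[OF that] by (simp add: alg_hom_def)
  have "is_product X ?Bs (fst ?P) (\<lambda>i. und (?pr i))"
    using prod by simp
  with product_reflected[OF As P pr this] P pr show thesis
    by (blast intro: that)
qed

text \<open>A product cone of algebras need not have a chosen biproduct as carrier. It is compared
  with the cone from \<open>product_exists\<close>, whose underlying cone is known to be a
  product.\<close>

lemma product_underlying:
  assumes prod: "is_product Alg As P pr" and As: "set As \<subseteq> algs"
  shows "is_product X (map fst As) (fst P) (\<lambda>i. und (pr i))"
proof -
  interpret Alg: category Alg by (rule category_Alg)
  obtain P0 pr0 where prod0: "is_product Alg As P0 pr0"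
    and und0: "is_product X (map fst As) (fst P0) (\<lambda>i. und (pr0 i))"
    and P0: "P0 \<in> algs" and pr0_all: "\<forall>i < length As. pr0 i \<in> hom Alg P0 (As ! i)"
    using product_exists[OF As] by metis
  have pr0: "\<And>i. i < length As \<Longrightarrow> pr0 i \<in> hom Alg P0 (As ! i)"
    using pr0_all by simp
  have P: "P \<in> algs" and pr: "\<And>i. i < length As \<Longrightarrow> pr i \<in> hom Alg P (As ! i)"
    using prod by (simp_all add: is_product_def)
  have As': "set As \<subseteq> Obj Alg" using As by simp
  have "\<exists>u. u \<in> hom Alg P P0 \<and> (\<forall>i < length As. pr0 i \<cdot>\<^bsub>Alg\<^esub> u = pr i)"
    by (rule ex1_implies_ex, rule is_product_ex1[OF prod0]) (use P pr in simp_all)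
  then obtain u where u1: "u \<in> hom Alg P P0" and u2: "\<forall>i < length As. pr0 i \<cdot>\<^bsub>Alg\<^esub> u = pr i"
    by blast
  have "\<exists>v. v \<in> hom Alg P0 P \<and> (\<forall>i < length As. pr i \<cdot>\<^bsub>Alg\<^esub> v = pr0 i)"
    by (rule ex1_implies_ex, rule is_product_ex1[OF prod]) (use P0 pr0 in simp_all)
  then obtain v where v1: "v \<in> hom Alg P0 P" and v2: "\<forall>i < length As. pr i \<cdot>\<^bsub>Alg\<^esub> v = pr0 i"
    by blast
  note u = u1 u2[rule_format] and v = v1 v2[rule_format]
  \<comment> \<open>The two sides agree after all projections of \<open>P\<close>, which are jointly
    monic. In the universal property below, existence is carried over from \<open>P0\<close> along
    \<open>v\<close>, and uniqueness by going to \<open>P0\<close> along \<open>u\<close> and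
    back.\<close>
  have vu: "v \<cdot>\<^bsub>Alg\<^esub> u = Ide Alg P"
  proof -
    have "v \<cdot>\<^bsub>Alg\<^esub> u \<in> hom Alg P P" "Ide Alg P \<in> hom Alg P P"
      using Alg.comp_hom[OF u(1) v(1)] Alg.ide_hom[of P] P by simp_all
    moreover have "\<forall>i \<in> {..<length As}. pr i \<cdot>\<^bsub>Alg\<^esub> (v \<cdot>\<^bsub>Alg\<^esub> u) = pr i \<cdot>\<^bsub>Alg\<^esub> Ide Alg P"
    proof
      fix i assume "i \<in> {..<length As}"
      then have i: "i < length As" by simp
      show "pr i \<cdot>\<^bsub>Alg\<^esub> (v \<cdot>\<^bsub>Alg\<^esub> u) = pr i \<cdot>\<^bsub>Alg\<^esub> Ide Alg P"
        using Alg.comp_assoc[OF u(1) v(1) pr[OF i]] Alg.comp_ide_right[OF pr[OF i]] u(2)[OF i] v(2)[OF i]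
        by (simp del: Alg_simps)
    qed
    ultimately show ?thesis
      using Alg.is_product_jointly_monic[OF prod As'] unfolding Alg.jointly_monic_def by blast
  qed
  have u': "und u \<in> hom X (fst P) (fst P0)" and v': "und v \<in> hom X (fst P0) (fst P)"
    using hom_AlgD(3) u(1) v(1) by blast+
  have pr': "und (pr i) \<in> hom X (fst P) (fst (As ! i))" if "i < length As" for i
    using hom_AlgD(3)[OF pr[OF that]] .
  have pr0': "und (pr0 i) \<in> hom X (fst P0) (fst (As ! i))" if "i < length As" for i
    using hom_AlgD(3)[OF pr0[OF that]] .
  have pru: "und (pr0 i) \<cdot> und u = und (pr i)" if "i < length As" for i
    using und_comp[OF u(1) pr0[OF that]] u(2)[OF that] by (metis und_triple)
  have prv: "und (pr i) \<cdot> und v = und (pr0 i)" if "i < length As" for i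
    using und_comp[OF v(1) pr[OF that]] v(2)[OF that] by (metis und_triple)
  have vu': "und v \<cdot> und u = Ide X (fst P)"
    using und_comp[OF u(1) v(1)] vu by simp
  have "\<exists>!w. w \<in> hom X B (fst P) \<and> (\<forall>i < length As. und (pr i) \<cdot> w = f i)"
    if B: "B \<in> Obj X" and f: "\<forall>i < length As. f i \<in> hom X B (fst (As ! i))" for B f
  proof -
    have ex0: "\<exists>!w. w \<in> hom X B (fst P0) \<and> (\<forall>i < length (map fst As). und (pr0 i) \<cdot> w = f i)"
      by (rule is_product_ex1[OF und0 B]) (use f in simp)
    then obtain w where w: "w \<in> hom X B (fst P0)" "\<And>i. i < length As \<Longrightarrow> und (pr0 i) \<cdot> w = f i"
      by auto
    show ?thesis
    proof (rule ex1I[of _ "und v \<cdot> w"])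
      have "und (pr i) \<cdot> (und v \<cdot> w) = f i" if "i < length As" for i
        using comp_assoc[OF w(1) v' pr'[OF that]] prv[OF that] w(2)[OF that] by simp
      then show "und v \<cdot> w \<in> hom X B (fst P) \<and> (\<forall>i < length As. und (pr i) \<cdot> (und v \<cdot> w) = f i)"
        using comp_hom[OF w(1) v'] by simp
    next
      fix y assume y: "y \<in> hom X B (fst P) \<and> (\<forall>i < length As. und (pr i) \<cdot> y = f i)"
      then have y': "y \<in> hom X B (fst P)" by simp
      have "und (pr0 i) \<cdot> (und u \<cdot> y) = f i" if "i < length As" for i
        using comp_assoc[OF y' u' pr0'[OF that]] pru[OF that] y that by simp
      then have "und u \<cdot> y = w"
        using ex0 comp_hom[OF y' u'] w by (metis length_map)
      then show "y = und v \<cdot> w"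
        using comp_assoc[OF y' u' v'] vu' comp_ide_left[OF y'] by simp
    qed
  qed
  then show ?thesis
    unfolding is_product_def using P pr' by simp
qed

lemma has_finite_products_Alg: "has_finite_products Alg"
  unfolding has_finite_products_def
proof (intro allI impI)
  fix As assume "set As \<subseteq> Obj Alg"
  then have "set As \<subseteq> algs" by simp
  from product_exists[OF this] show "\<exists>P pr. is_product Alg As P pr"
    by blast
qed

text \<open>The cone is sent to \<open>X\<close> by \<open>product_underlying\<close>, squared
  there, and returned by \<open>product_reflected\<close>.\<close>

lemma T_preserves_finite_products: "preserves_finite_products Alg T"
  unfolding preserves_finite_products_def
proof (intro allI impI)
  fix As P pr assume "set As \<subseteq> Obj Alg" and prod: "is_product Alg As P pr"
  then have As: "set As \<subseteq> algs" by simp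
  have P: "P \<in> algs" and pr: "\<And>i. i < length As \<Longrightarrow> pr i \<in> hom Alg P (As ! i)"
    using prod by (simp_all add: is_product_def)
  interpret T: endofunctor Alg T by (rule endofunctor_T)
  have FMap: "FMap T (pr i) = (T_obj P, T_obj (As ! i), FMap (square X) (und (pr i)))" if "i < length As" for i
    using hom_AlgD(2)[OF pr[OF that]] by (metis FMap_T)
  have fst: "map (FObj (square X)) (map fst As) = map fst (map T_obj As)"
    using As by auto
  have "is_product X (map fst (map T_obj As)) (fst (T_obj P)) (\<lambda>i. FMap (square X) (und (pr i)))"
    using square_product[OF product_underlying[OF prod As] set_fst_algs[OF As]] P
    unfolding fst by simp
  then have "is_product X (map fst (map T_obj As)) (fst (T_obj P)) (\<lambda>i. und (FMap T (pr i)))"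
    unfolding is_product_def by (simp add: FMap)
  then show "is_product Alg (map (FObj T) As) (FObj T P) (\<lambda>i. FMap T (pr i))"
    unfolding FObj_T
    by (intro product_reflected) (use As P T.fmap[OF pr] in \<open>auto simp del: hom_Alg_triple\<close>)
qed

section \<open>Assembly of the tangent structure\<close>

lemma tangent_structure_Alg:
  "tangent_structure Alg T (alg_p X S \<delta>) Tn q (alg_s X S \<delta>) (alg_z X S \<delta>) (alg_l X S \<delta>) (alg_c X S \<delta>)"
proof (intro tangent_structure.intro tangent_structure_axioms.intro endofunctor_T)
  fix P assume "P \<in> Obj Alg"
  then have P: "P \<in> algs" by simp
  show "is_fold_pullback Alg (FObj T P) P (alg_p X S \<delta> P) n (Tn n P) (q n P)" for n
    using T_pow_fold_pullback[OF P, of 0] by simp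
  show "is_fold_pullback Alg ((FObj T ^^ m) (FObj T P)) ((FObj T ^^ m) P) ((FMap T ^^ m) (alg_p X S \<delta> P)) n
      ((FObj T ^^ m) (Tn n P)) (\<lambda>j. (FMap T ^^ m) (q n P j))" for m n
    using T_pow_fold_pullback[OF P] by simp
qed (simp_all only: p_natural s_natural z_natural l_natural c_natural monoid l_p l_s l_z c_p c_s c_z c_c c_l
    l_l c_c_c c_c_l lift_universal[unfolded FObj_T] FObj_T Alg_simps(1))

subsection \<open>Negatives\<close>

context
  assumes additive: "additive_category X"
begin

text \<open>Additive inverses are unique by associativity and commutativity. The equivalence reduces
  later identities about negatives to checking that a sum is zero.\<close>

lemma neg_char:
  assumes f: "f \<in> Arr X" "Dom X f = A" "Cod X f = B"
  shows "g \<in> hom X A B \<and> f \<oplus> g = zero_map X A B \<longleftrightarrow> g = neg_map X f"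
proof -
  interpret additive_category X by (rule additive)
  obtain h where h: "h \<in> hom X A B" "f \<oplus> h = zero_map X A B"
    using has_negatives[of f A B] f by (auto simp: in_hom_iff)
  have unique: "g = h" if g: "g \<in> hom X A B \<and> f \<oplus> g = zero_map X A B" for g
  proof -
    have "g = g \<oplus> (f \<oplus> h)"
      using g f h by (simp add: in_hom_iff)
    also have "\<dots> = (f \<oplus> g) \<oplus> h"
      using g f h plus_assoc[of g f h] plus_commute[of g f] by (simp add: in_hom_iff)
    also have "\<dots> = h"
      using g h by (simp add: in_hom_iff)
    finally show ?thesis .
  qed
  have "neg_map X f = h"
    unfolding neg_map_def f(2,3) by (rule the_equality, rule conjI[OF h], rule unique)
  then show ?thesis
    using h unique by blast
qed

lemma neg_simps [simp]:
  assumes "f \<in> Arr X"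
  shows "neg_map X f \<in> Arr X" "Dom X (neg_map X f) = Dom X f" "Cod X (neg_map X f) = Cod X f"
    "f \<oplus> neg_map X f = zero_map X (Dom X f) (Cod X f)"
  using neg_char[OF assms refl refl, of "neg_map X f"] by (simp_all add: in_hom_iff)

lemma neg_comp:
  assumes "f \<in> Arr X" "h \<in> Arr X" "Cod X h = Dom X f"
  shows "neg_map X f \<cdot> h = neg_map X (f \<cdot> h)"
proof -
  have "f \<cdot> h \<oplus> neg_map X f \<cdot> h = (f \<oplus> neg_map X f) \<cdot> h"
    \<comment> \<open>Cancellation is switched off so that the right-hand sum is distributed over
      the composite before it collapses to zero.\<close>
    using assms by (simp del: neg_simps(4))
  then show ?thesis
    using assms neg_char[of "f \<cdot> h" "Dom X h" "Cod X f" "neg_map X f \<cdot> h"] by (simp add: in_hom_iff)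
qed

lemma comp_neg:
  assumes "f \<in> Arr X" "h \<in> Arr X" "Dom X h = Cod X f"
  shows "h \<cdot> neg_map X f = neg_map X (h \<cdot> f)"
proof -
  have "h \<cdot> f \<oplus> h \<cdot> neg_map X f = h \<cdot> (f \<oplus> neg_map X f)"
    using assms by (simp del: neg_simps(4))
  then show ?thesis
    using assms neg_char[of "h \<cdot> f" "Dom X f" "Cod X h" "h \<cdot> neg_map X f"] by (simp add: in_hom_iff)
qed

text \<open>Additivity in the direction turns \<open>b \<oplus> neg_map X b\<close> into a sum of
  derivatives that equals the derivative in direction zero, so the second summand is an additive
  inverse of the first.\<close>

lemma deriv_neg:
  assumes "P \<in> algs" "a \<in> Arr X" "b \<in> Arr X" "Dom X a = Dom X b" "Cod X a = fst P" "Cod X b = fst P"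
  shows "deriv P a (neg_map X b) = neg_map X (deriv P a b)"
proof -
  have "deriv P a b \<oplus> deriv P a (neg_map X b) = zero_map X (FObj S (Dom X b)) (fst P)"
    using assms deriv_plus[of P a "Dom X b" b "neg_map X b"] by (simp add: deriv_zero)
  then show ?thesis
    using assms neg_char[of "deriv P a b" "FObj S (Dom X b)" "fst P" "deriv P a (neg_map X b)"] by (simp add: in_hom_iff)
qed

lemma alg_hom_n:
  assumes P: "P \<in> algs"
  shows "alg_hom (T_obj P) (T_obj P) (tup X [Pr X [fst P, fst P] 0, neg_map X (Pr X [fst P, fst P] (Suc 0))])"
  using P by (intro alg_hom_TI) (simp_all add: T_obj_snd neg_comp deriv_neg)

lemma n_natural: "natural Alg T T (alg_n X S \<delta>)"
proof (rule natural_AlgI)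
  fix P Q f assume "alg_hom P Q f"
  from alg_homD(1-5)[OF this]
  show "alg_n X S \<delta> Q \<cdot>\<^bsub>Alg\<^esub> FMap T (P, Q, f) = FMap T (P, Q, f) \<cdot>\<^bsub>Alg\<^esub> alg_n X S \<delta> P"
    by (simp add: FMap_square neg_comp comp_neg)
qed (simp add: alg_hom_n)

lemma n_s:
  assumes P: "P \<in> algs"
  shows "alg_s X S \<delta> P \<cdot>\<^bsub>Alg\<^esub> tan_pair Alg T Tn q 0 P (Ide Alg (T_obj P)) (alg_n X S \<delta> P)
    = alg_z X S \<delta> P \<cdot>\<^bsub>Alg\<^esub> alg_p X S \<delta> P"
proof -
  have id: "alg_hom (T_obj P) (T_obj P) (Ide X (Bip X [fst P, fst P]))"
    using alg_hom_ide[of "T_obj P"] P by simp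
  show ?thesis
    using P tan_pair_0(1)[OF P id alg_hom_n[OF P]] by simp
qed

lemma rosicky_tangent_structure_Alg:
  "rosicky_tangent_structure Alg T (alg_p X S \<delta>) Tn q (alg_s X S \<delta>) (alg_z X S \<delta>) (alg_l X S \<delta>)
    (alg_c X S \<delta>) (alg_n X S \<delta>)"
proof (intro rosicky_tangent_structure.intro rosicky_tangent_structure_axioms.intro tangent_structure_Alg n_natural)
  fix P assume "P \<in> Obj Alg"
  then have P: "P \<in> algs" by simp
  show "alg_p X S \<delta> P \<cdot>\<^bsub>Alg\<^esub> alg_n X S \<delta> P = alg_p X S \<delta> P"
    using P by simp
  show "alg_s X S \<delta> P \<cdot>\<^bsub>Alg\<^esub> tan_pair Alg T Tn q 0 P (Ide Alg (FObj T P)) (alg_n X S \<delta> P)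
    = alg_z X S \<delta> P \<cdot>\<^bsub>Alg\<^esub> alg_p X S \<delta> P"
    using n_s[OF P] by simp
qed

end

end

theorem theorem3p2p7:
  fixes X :: "('o, 'm) biproduct_category"
    and S :: "('o, 'm) endofunctor"
    and \<mu> \<eta> \<delta> :: "'o \<Rightarrow> 'm"
  assumes "cocartesian_differential_monad X S \<mu> \<eta> \<delta>"
  shows "tangent_structure (ALG X S \<mu> \<eta>) (alg_T X S \<delta>) (alg_p X S \<delta>) (alg_Tn X S \<delta>) (alg_q X S \<delta>)
           (alg_s X S \<delta>) (alg_z X S \<delta>) (alg_l X S \<delta>) (alg_c X S \<delta>)
    \<and> cartesian_tangent_category (ALG X S \<mu> \<eta>) (alg_T X S \<delta>) (alg_p X S \<delta>) (alg_Tn X S \<delta>) (alg_q X S \<delta>)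
           (alg_s X S \<delta>) (alg_z X S \<delta>) (alg_l X S \<delta>) (alg_c X S \<delta>)
    \<and> (additive_category X \<longrightarrow>
        rosicky_tangent_structure (ALG X S \<mu> \<eta>) (alg_T X S \<delta>) (alg_p X S \<delta>) (alg_Tn X S \<delta>) (alg_q X S \<delta>)
           (alg_s X S \<delta>) (alg_z X S \<delta>) (alg_l X S \<delta>) (alg_c X S \<delta>) (alg_n X S \<delta>)
      \<and> cartesian_rosicky_tangent_category (ALG X S \<mu> \<eta>) (alg_T X S \<delta>) (alg_p X S \<delta>) (alg_Tn X S \<delta>) (alg_q X S \<delta>)
           (alg_s X S \<delta>) (alg_z X S \<delta>) (alg_l X S \<delta>) (alg_c X S \<delta>) (alg_n X S \<delta>))"
proof -
  interpret cocartesian_differential_monad X S \<mu> \<eta> \<delta>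
    by (rule assms)
  show ?thesis
    by (intro conjI impI tangent_structure_Alg rosicky_tangent_structure_Alg
      cartesian_tangent_category.intro cartesian_tangent_category_axioms.intro
      cartesian_rosicky_tangent_category.intro cartesian_rosicky_tangent_category_axioms.intro
      has_finite_products_Alg T_preserves_finite_products)
qed

end
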